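(* Let $\{\varepsilon_t\}_{t\in\mathbb{Z}}$ be i.i.d. real random variables with mean zero, variance $\sigma_0^2>0$ and $E\varepsilon_1^4<\infty$, and let $\{Y_t\}_{t\in\mathbb{Z}}$ be the strictly stationary solution of $Y_t=\mu_0+\phi_0Y_{t-2}+b_0Y_{t-2}\varepsilon_{t-1}+\varepsilon_t$. Write $\theta=(\mu,\phi,\sigma^2,b^2)^\top$ and $\theta_0=(\mu_0,\phi_0,\sigma_0^2,b_0^2)^\top$. Suppose the parameter space $\Theta$ is a compact subset of $$\{\theta:\ E\ln|\phi+b\varepsilon_1|<0,\ |\mu|\le\bar\mu,\ |\phi|\le\bar\phi,\ \underline\omega\le\sigma^2\le\overline\omega,\ \underline\alpha\le b^2\le\overline\alpha\},$$ where $\bar\mu,\bar\phi,\underline\omega,\overline\omega,\underline\alpha,\overline\alpha$ are some finite positive constants, and that $\theta_0$ is an interior point of $\Theta$. Let $\hat\theta_n=(\hat\theta_{n1},\hat\theta_{n2},\hat\theta_{n3},\hat\theta_{n4})^\top$ be the maximizer over $\Theta$ of $L_n(\theta)=\sum_{t=1}^n\ell_t(\theta)$, with $\ell_t$, $\Omega$, $\Sigma$ as defined in the context. Put $$\hat\Omega_n=\frac1n\sum_{t=1}^n\left[\frac{\partial\ell_t(\hat\theta_n)}{\partial\theta}+\frac{\partial\ell_{t-1}(\hat\theta_n)}{\partial\theta}\right]\left[\frac{\partial\ell_t(\hat\theta_n)}{\partial\theta}+\frac{\partial\ell_{t-1}(\hat\theta_n)}{\partial\theta}\right]^\top-\frac1n\sum_{t=1}^n\left[\frac{\partial\ell_t(\hat\theta_n)}{\partial\theta}\frac{\partial\ell_t(\hat\theta_n)}{\partial\theta^\top}\right]$$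 and $\hat\Sigma_n={\rm diag}\{\hat\Sigma_{n,1},\hat\Sigma_{n,2}\}$ with $$\hat\Sigma_{n,1}=\frac1n\sum_{t=1}^n\frac{1}{\hat\theta_{n3}(1+\hat\theta_{n4}Y_{t-2}^2)}\begin{pmatrix}1&Y_{t-2}\\ Y_{t-2}&Y_{t-2}^2\end{pmatrix},\qquad \hat\Sigma_{n,2}=\frac1n\sum_{t=1}^n\begin{pmatrix}\dfrac{1}{2\hat\theta_{n3}^2}&\dfrac{Y_{t-2}^2}{2\hat\theta_{n3}(1+\hat\theta_{n4}Y_{t-2}^2)}\\ \dfrac{Y_{t-2}^2}{2\hat\theta_{n3}(1+\hat\theta_{n4}Y_{t-2}^2)}&\dfrac{Y_{t-2}^4}{2(1+\hat\theta_{n4}Y_{t-2}^2)^2}\end{pmatrix}.$$ Then $\hat\Omega_n$ and $\hat\Sigma_n$ are consistent estimators of $\Omega$ and $\Sigma$ respectively, i.e. $\hat\Omega_n\to\Omega$ and $\hat\Sigma_n\to\Sigma$ in probability as $n\to\infty$.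
   Context: For $\theta=(\mu,\phi,\sigma^2,b^2)^\top$, $$\ell_t(\theta)=-\frac12\left[\ln[\sigma^2(1+b^2Y_{t-2}^2)]+\frac{(Y_t-\mu-\phi Y_{t-2})^2}{\sigma^2(1+b^2Y_{t-2}^2)}\right].$$ The function $\ell_t$ depends on $b$ only through $b^2$, and $\sigma^2$ and $b^2$ are the third and fourth coordinates of $\theta$; $\partial\ell_t/\partial\theta$ is the gradient with respect to $(\mu,\phi,\sigma^2,b^2)$. In the condition $E\ln|\phi+b\varepsilon_1|<0$ defining the parameter set, $\varepsilon_1$ is the actual innovation and $b$ is the square root of the fourth coordinate $b^2$ having the same sign as $b_0$. The observations, including any values $Y_{-2},Y_{-1},Y_0$ appearing in the sums, come from the strictly stationary solution. The matrices (which do not depend on $t$, by stationarity) are $$\Omega=E\left[\frac{\partial\ell_t(\theta_0)}{\partial\theta}+\frac{\partial\ell_{t-1}(\theta_0)}{\partial\theta}\right]\left[\frac{\partial\ell_t(\theta_0)}{\partial\theta}+\frac{\partial\ell_{t-1}(\theta_0)}{\partial\theta}\right]^\top-E\left[\frac{\partial\ell_t(\theta_0)}{\partial\theta}\frac{\partial\ell_t(\theta_0)}{\partial\theta^\top}\right],$$ and $\Sigma={\rm diag}\{\Sigma_1,\Sigma_2\}$ (block diagonal, $4\times4$) with $$\Sigma_1=E\left[\frac{1}{\sigma_0^2(1+b_0^2Y_{t-2}^2)}\begin{pmatrix}1&Y_{t-2}\\ Y_{t-2}&Y_{t-2}^2\end{pmatrix}\right],\qquad \Sigma_2=E\begin{pmatrix}\dfrac{1}{2\sigma_0^4}&\dfrac{Y_{t-2}^2}{2\sigma_0^2(1+b_0^2Y_{t-2}^2)}\\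 \dfrac{Y_{t-2}^2}{2\sigma_0^2(1+b_0^2Y_{t-2}^2)}&\dfrac{Y_{t-2}^4}{2(1+b_0^2Y_{t-2}^2)^2}\end{pmatrix}.$$ *)

theory Defs
  imports "HOL-Probability.Probability"
begin

definition strictly_stationary :: "'a measure \<Rightarrow> (int \<Rightarrow> 'a \<Rightarrow> real) \<Rightarrow> bool" where
  "strictly_stationary M Y \<longleftrightarrow>
     (\<forall>t. Y t \<in> borel_measurable M) \<and>
     (\<forall>J h. finite J \<longrightarrow>
        distr M (PiM J (\<lambda>_. borel)) (\<lambda>\<omega>. \<lambda>t\<in>J. Y (t + h) \<omega>) =
        distr M (PiM J (\<lambda>_. borel)) (\<lambda>\<omega>. \<lambda>t\<in>J. Y t \<omega>))"

definition stationary_solution ::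
  "'a measure \<Rightarrow> (int \<Rightarrow> 'a \<Rightarrow> real) \<Rightarrow> real \<Rightarrow> real \<Rightarrow> real \<Rightarrow> (int \<Rightarrow> 'a \<Rightarrow> real) \<Rightarrow> bool" where
  "stationary_solution M \<epsilon> \<mu> \<phi> b Y \<longleftrightarrow>
     strictly_stationary M Y \<and>
     (\<forall>t. AE \<omega> in M. Y t \<omega> = \<mu> + \<phi> * Y (t - 2) \<omega> + b * Y (t - 2) \<omega> * \<epsilon> (t - 1) \<omega> + \<epsilon> t \<omega>)"

definition converges_in_prob ::
  "'a measure \<Rightarrow> (nat \<Rightarrow> 'a \<Rightarrow> 'b::metric_space) \<Rightarrow> 'b \<Rightarrow> bool" where
  "converges_in_prob M X L \<longleftrightarrow>
     (\<forall>n. X n \<in> borel_measurable M) \<and>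
     (\<forall>e>0. (\<lambda>n. measure M {\<omega> \<in> space M. dist (X n \<omega>) L > e}) \<longlonglongrightarrow> 0)"

text \<open>
  The mean of \<open>ln \<bar>\<phi> + b \<epsilon>\<bar>\<close> may be \<open>-\<infinity>\<close>, in particular when \<open>\<phi> + b \<epsilon>\<close> vanishes with positive
  probability, whereas on the reals \<open>ln 0 = 0\<close> and the Bochner integral of a non-integrable
  function is \<open>0\<close>. Both the logarithm and its mean are therefore extended-real valued. As
  \<open>\<infinity> - \<infinity> = \<infinity>\<close> in \<^typ>\<open>ereal\<close>, a negative value always means that the mean exists.
\<close>

definition ln_abs :: "real \<Rightarrow> ereal" where
  "ln_abs x = (if x = 0 then -\<infinity> else ereal (ln \<bar>x\<bar>))"

definition ereal_expectation :: "'a measure \<Rightarrow> ('a \<Rightarrow> ereal) \<Rightarrow> ereal" where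
  "ereal_expectation M X =
     enn2ereal (\<integral>\<^sup>+ \<omega>. e2ennreal (X \<omega>) \<partial>M) - enn2ereal (\<integral>\<^sup>+ \<omega>. e2ennreal (- X \<omega>) \<partial>M)"

text \<open>
  A parameter is \<open>\<theta> = (\<mu>, \<phi>, \<sigma>\<^sup>2, b\<^sup>2)\<close>; its third and fourth coordinates are \<open>\<sigma>\<^sup>2\<close> and
  \<open>b\<^sup>2\<close> themselves. In the log-moment condition, \<open>b\<close> is the square root of \<open>b\<^sup>2\<close> with the
  sign of the true value \<open>b0\<close>; \<open>e\<close> is a random variable with the law of the innovations.
\<close>

definition param_region ::
  "'a measure \<Rightarrow> ('a \<Rightarrow> real) \<Rightarrow> real \<Rightarrow> real \<Rightarrow> real \<Rightarrow> real \<Rightarrow> real \<Rightarrow> real \<Rightarrow> real \<Rightarrow> (real^4) set" where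
  "param_region M e b0 mu_max phi_max om_lo om_hi al_lo al_hi =
     {\<theta>. ereal_expectation M (\<lambda>\<omega>. ln_abs (\<theta>$2 + (sgn b0 * sqrt (\<theta>$4)) * e \<omega>)) < 0 \<and>
          \<bar>\<theta>$1\<bar> \<le> mu_max \<and> \<bar>\<theta>$2\<bar> \<le> phi_max \<and>
          om_lo \<le> \<theta>$3 \<and> \<theta>$3 \<le> om_hi \<and> al_lo \<le> \<theta>$4 \<and> \<theta>$4 \<le> al_hi}"

text \<open>Below, \<open>y\<close> stands for a sample path \<open>\<lambda>t. Y t \<omega>\<close>.\<close>

definition loglik :: "(int \<Rightarrow> real) \<Rightarrow> int \<Rightarrow> real^4 \<Rightarrow> real" where
  "loglik y t \<theta> =
     - (1 / 2) * (ln (\<theta>$3 * (1 + \<theta>$4 * (y (t - 2))\<^sup>2)) +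
                  (y t - \<theta>$1 - \<theta>$2 * y (t - 2))\<^sup>2 / (\<theta>$3 * (1 + \<theta>$4 * (y (t - 2))\<^sup>2)))"

definition total_loglik :: "(int \<Rightarrow> real) \<Rightarrow> nat \<Rightarrow> real^4 \<Rightarrow> real" where
  "total_loglik y n \<theta> = (\<Sum>t\<in>{1..int n}. loglik y t \<theta>)"

definition gradient :: "(real^'n \<Rightarrow> real) \<Rightarrow> real^'n \<Rightarrow> real^'n" where
  "gradient f x = (\<chi> i. deriv (\<lambda>s. f (x + s *\<^sub>R axis i 1)) 0)"

definition score :: "(int \<Rightarrow> real) \<Rightarrow> int \<Rightarrow> real^4 \<Rightarrow> real^4" where
  "score y t \<theta> = gradient (loglik y t) \<theta>"

definition outer_product :: "real^'n \<Rightarrow> real^'m \<Rightarrow> real^'m^'n" where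
  "outer_product u v = (\<chi> i j. u$i * v$j)"

definition block_diag :: "real^2^2 \<Rightarrow> real^2^2 \<Rightarrow> real^4^4" where
  "block_diag A B =
     vector [vector [A$1$1, A$1$2, 0, 0],
             vector [A$2$1, A$2$2, 0, 0],
             vector [0, 0, B$1$1, B$1$2],
             vector [0, 0, B$2$1, B$2$2]]"

definition Sigma1_term :: "real \<Rightarrow> real^4 \<Rightarrow> real^2^2" where
  "Sigma1_term x \<theta> =
     (1 / (\<theta>$3 * (1 + \<theta>$4 * x\<^sup>2))) *\<^sub>R vector [vector [1, x], vector [x, x\<^sup>2]]"

definition Sigma2_term :: "real \<Rightarrow> real^4 \<Rightarrow> real^2^2" where
  "Sigma2_term x \<theta> =
     vector [vector [1 / (2 * (\<theta>$3)\<^sup>2), x\<^sup>2 / (2 * \<theta>$3 * (1 + \<theta>$4 * x\<^sup>2))],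
             vector [x\<^sup>2 / (2 * \<theta>$3 * (1 + \<theta>$4 * x\<^sup>2)), x^4 / (2 * (1 + \<theta>$4 * x\<^sup>2)\<^sup>2)]]"

definition Omega :: "'a measure \<Rightarrow> (int \<Rightarrow> 'a \<Rightarrow> real) \<Rightarrow> real^4 \<Rightarrow> int \<Rightarrow> real^4^4" where
  "Omega M Y \<theta> t =
     (LINT \<omega>|M. outer_product (score (\<lambda>s. Y s \<omega>) t \<theta> + score (\<lambda>s. Y s \<omega>) (t - 1) \<theta>)
                              (score (\<lambda>s. Y s \<omega>) t \<theta> + score (\<lambda>s. Y s \<omega>) (t - 1) \<theta>))
     - (LINT \<omega>|M. outer_product (score (\<lambda>s. Y s \<omega>) t \<theta>) (score (\<lambda>s. Y s \<omega>) t \<theta>))"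

definition Sigma_mat :: "'a measure \<Rightarrow> (int \<Rightarrow> 'a \<Rightarrow> real) \<Rightarrow> real^4 \<Rightarrow> int \<Rightarrow> real^4^4" where
  "Sigma_mat M Y \<theta> t =
     block_diag (LINT \<omega>|M. Sigma1_term (Y (t - 2) \<omega>) \<theta>) (LINT \<omega>|M. Sigma2_term (Y (t - 2) \<omega>) \<theta>)"

definition Omega_hat :: "(int \<Rightarrow> real) \<Rightarrow> nat \<Rightarrow> real^4 \<Rightarrow> real^4^4" where
  "Omega_hat y n \<theta> =
     (1 / real n) *\<^sub>R (\<Sum>t\<in>{1..int n}. outer_product (score y t \<theta> + score y (t - 1) \<theta>)
                                                  (score y t \<theta> + score y (t - 1) \<theta>))
     - (1 / real n) *\<^sub>R (\<Sum>t\<in>{1..int n}. outer_product (score y t \<theta>) (score y t \<theta>))"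

definition Sigma_hat :: "(int \<Rightarrow> real) \<Rightarrow> nat \<Rightarrow> real^4 \<Rightarrow> real^4^4" where
  "Sigma_hat y n \<theta> =
     block_diag ((1 / real n) *\<^sub>R (\<Sum>t\<in>{1..int n}. Sigma1_term (y (t - 2)) \<theta>))
                ((1 / real n) *\<^sub>R (\<Sum>t\<in>{1..int n}. Sigma2_term (y (t - 2)) \<theta>))"

end

theory Submission
  imports Defs
begin

text \<open>
  The contraction condition gives \<open>E \<bar>\<phi> + b \<epsilon>\<bar>\<^sup>\<kappa> < 1\<close> for some \<open>\<kappa> > 0\<close>, so the recursion
  started at \<open>0\<close> at time \<open>t - 2m\<close> approximates \<open>Y t\<close> in probability as \<open>m\<close> grows, uniformly in \<open>t\<close>.
  These approximations are finitely dependent, which replaces the ergodic theorem: Chebyshev's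
  inequality yields a law of large numbers for bounded uniformly continuous functions of the
  stationary windows, truncation extends it to integrable continuous ones, and a finite net makes it
  uniform over the compact parameter set. Wald's argument then gives consistency of the maximizer,
  once the mean criterion is known to have a unique maximum at the true parameter. This holds because
  \<open>Y t\<close> is almost surely a function of the innovations up to time \<open>t\<close>, so that the criterion can be
  integrated over the next two innovations first, and because \<open>(Y t)\<^sup>2\<close> is never almost surely constant.
  The scores are dominated by \<open>(Y t)\<^sup>2 / (1 + (Y (t - 2))\<^sup>2)\<close>, which is at most a quadratic in two
  innovations, so four moments of the innovations suffice for the plug-in step.
\<close>

section \<open>Statements holding with probability tending to one\<close>

text \<open>The obstacle is that nothing bounds the moments of \<open>Y\<close>: the contraction
  condition only puts some small power moment of the coefficient
  \<open>\<phi> + b \<epsilon>\<close> below one. Hence approximation is asked for in probability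
  only, the size of \<open>Y\<close> enters solely through tightness of its stationary law, and
  every averaged function is kept below a function of ratios in which the growth of
  \<open>Y (t - 2)\<close> cancels. Since products of two scores are averaged, the ratio occurs
  squared, which is where the fourth moment is spent. Given \<open>Y (t - 2) = x\<close>, the
  innovations at \<open>t - 1\<close> and \<open>t\<close> give \<open>Y t\<close> the mean
  \<open>\<mu> + \<phi> x\<close> and the variance
  \<open>\<sigma>\<^sup>2 (1 + b\<^sup>2 x\<^sup>2)\<close>. The criterion is a Gaussian
  log-likelihood, but its conditional mean involves only these two moments, so the divergence
  argument of the Gaussian case works for any innovation law. Neighbouring observations share an
  innovation (\<open>\<epsilon> (t - 1)\<close> enters both \<open>Y t\<close> and
  \<open>Y (t - 1)\<close>), so successive scores may be correlated; this explains the extra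
  products in \<open>Omega\<close> and the four coordinates of a window.\<close>

text \<open>
  The events \<open>A\<close> make measurability of \<open>{\<omega>. P n \<omega>}\<close> unnecessary; below, \<open>P\<close> quantifies over
  uncountable parameter sets.
\<close>

definition whp :: "'a measure \<Rightarrow> (nat \<Rightarrow> 'a \<Rightarrow> bool) \<Rightarrow> bool" where
  "whp M P \<longleftrightarrow> (\<forall>d>0. \<forall>\<^sub>F n in sequentially.
     \<exists>A\<in>sets M. measure M A \<ge> 1 - d \<and> (\<forall>\<omega>\<in>A. P n \<omega>))"

context prob_space
begin

lemma whp_mono:
  assumes "whp M P" "\<And>n \<omega>. n \<ge> 1 \<Longrightarrow> \<omega> \<in> space M \<Longrightarrow> P n \<omega> \<Longrightarrow> Q n \<omega>"
  shows "whp M Q"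
  unfolding whp_def
proof (intro allI impI)
  fix d :: real assume "d > 0"
  with assms(1) have "\<forall>\<^sub>F n in sequentially. \<exists>A\<in>sets M. measure M A \<ge> 1 - d \<and> (\<forall>\<omega>\<in>A. P n \<omega>)"
    by (auto simp: whp_def)
  with eventually_ge_at_top[of 1]
  show "\<forall>\<^sub>F n in sequentially. \<exists>A\<in>sets M. measure M A \<ge> 1 - d \<and> (\<forall>\<omega>\<in>A. Q n \<omega>)"
  proof eventually_elim
    case (elim n)
    then show ?case using assms(2) sets.sets_into_space by (meson subsetD)
  qed
qed

lemma whp_conj:
  assumes "whp M P" "whp M Q"
  shows "whp M (\<lambda>n \<omega>. P n \<omega> \<and> Q n \<omega>)"
  unfolding whp_def
proof (intro allI impI)
  fix d :: real assume "d > 0"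
  then have "\<forall>\<^sub>F n in sequentially. \<exists>A\<in>sets M. measure M A \<ge> 1 - d/2 \<and> (\<forall>\<omega>\<in>A. P n \<omega>)"
    "\<forall>\<^sub>F n in sequentially. \<exists>A\<in>sets M. measure M A \<ge> 1 - d/2 \<and> (\<forall>\<omega>\<in>A. Q n \<omega>)"
    using assms[unfolded whp_def] by (auto dest!: spec[of _ "d/2"])
  then show "\<forall>\<^sub>F n in sequentially. \<exists>A\<in>sets M. measure M A \<ge> 1 - d \<and> (\<forall>\<omega>\<in>A. P n \<omega> \<and> Q n \<omega>)"
  proof eventually_elim
    case (elim n)
    then obtain A B where AB: "A \<in> sets M" "B \<in> sets M" "prob A \<ge> 1 - d/2" "prob B \<ge> 1 - d/2"
      "\<forall>\<omega>\<in>A. P n \<omega>" "\<forall>\<omega>\<in>B. Q n \<omega>" by auto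
    have "prob (A \<union> B) = prob A + prob B - prob (A \<inter> B)"
      using measure_Un3[of A M B] AB by (auto simp: fmeasurable_eq_sets)
    with prob_le_1[of "A \<union> B"] AB have "prob (A \<inter> B) \<ge> 1 - d" by simp
    with AB show ?case by (intro bexI[of _ "A \<inter> B"]) auto
  qed
qed

lemma whp_always:
  assumes "\<And>n \<omega>. n \<ge> 1 \<Longrightarrow> \<omega> \<in> space M \<Longrightarrow> P n \<omega>"
  shows "whp M P"
proof (rule whp_mono[of "\<lambda>_ _. True"])
  show "whp M (\<lambda>_ _. True)"
    unfolding whp_def by (intro allI impI always_eventually bexI[of _ "space M"]) (auto simp: prob_space)
qed (use assms in auto)

lemma whp_ball:
  assumes "finite I" "\<And>i. i \<in> I \<Longrightarrow> whp M (P i)"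
  shows "whp M (\<lambda>n \<omega>. \<forall>i\<in>I. P i n \<omega>)"
  using assms
proof (induction I)
  case empty
  show ?case by (rule whp_always) auto
next
  case (insert i I)
  have "whp M (\<lambda>n \<omega>. P i n \<omega> \<and> (\<forall>j\<in>I. P j n \<omega>))"
    by (intro whp_conj insert) (use insert in auto)
  then show ?case by simp
qed

text \<open>The entry into \<open>whp\<close>: the laws of large numbers below are convergences in
  mean of absolute deviations, and Markov's inequality makes the bad event small.\<close>

lemma whp_markov:
  fixes X :: "nat \<Rightarrow> 'a \<Rightarrow> real"
  assumes int: "\<And>n. integrable M (X n)" and nonneg: "\<And>n \<omega>. \<omega> \<in> space M \<Longrightarrow> X n \<omega> \<ge> 0"
    and lim: "(\<lambda>n. expectation (X n)) \<longlonglongrightarrow> 0" and "e > 0"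
  shows "whp M (\<lambda>n \<omega>. X n \<omega> \<le> e)"
  unfolding whp_def
proof (intro allI impI)
  fix d :: real assume "d > 0"
  with \<open>e > 0\<close> have "e * d > 0" by simp
  with lim have "\<forall>\<^sub>F n in sequentially. expectation (X n) < e * d"
    by (rule order_tendstoD)
  then show "\<forall>\<^sub>F n in sequentially. \<exists>A\<in>sets M. measure M A \<ge> 1 - d \<and> (\<forall>\<omega>\<in>A. X n \<omega> \<le> e)"
  proof eventually_elim
    case (elim n)
    note [measurable] = borel_measurable_integrable[OF int]
    have "prob {\<omega>\<in>space M. X n \<omega> \<ge> e} \<le> expectation (X n) / e"
      by (rule integral_Markov_inequality_measure[where A="{}"]) (use int nonneg \<open>e > 0\<close> in auto)
    also have "\<dots> \<le> d" using elim \<open>e > 0\<close> by (simp add: field_simps)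
    finally have "1 - d \<le> prob (space M - {\<omega>\<in>space M. X n \<omega> \<ge> e})"
      by (subst prob_compl) auto
    then show ?case
      by (intro bexI[of _ "space M - {\<omega>\<in>space M. X n \<omega> \<ge> e}"]) auto
  qed
qed

text \<open>The exit from \<open>whp\<close>: the bad event, measurable because \<open>X n\<close>
  is, lies in the complement of the set on which the bound is known.\<close>

lemma converges_in_probI:
  fixes X :: "nat \<Rightarrow> 'a \<Rightarrow> 'b::{metric_space, second_countable_topology}"
  assumes meas [measurable]: "\<And>n. X n \<in> borel_measurable M"
    and whp: "\<And>e. e > 0 \<Longrightarrow> whp M (\<lambda>n \<omega>. dist (X n \<omega>) L \<le> e)"
  shows "converges_in_prob M X L"
  unfolding converges_in_prob_def
proof (intro conjI allI impI meas)
  fix e :: real assume "e > 0"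
  show "(\<lambda>n. prob {\<omega> \<in> space M. dist (X n \<omega>) L > e}) \<longlonglongrightarrow> 0"
  proof (rule tendstoI)
    fix d :: real assume "d > 0"
    with whp[OF \<open>e > 0\<close>]
    have "\<forall>\<^sub>F n in sequentially. \<exists>A\<in>sets M. measure M A \<ge> 1 - d/2 \<and> (\<forall>\<omega>\<in>A. dist (X n \<omega>) L \<le> e)"
      unfolding whp_def by (auto dest!: spec[of _ "d/2"])
    then show "\<forall>\<^sub>F n in sequentially. dist (prob {\<omega> \<in> space M. dist (X n \<omega>) L > e}) 0 < d"
    proof eventually_elim
      case (elim n)
      then obtain A where A: "A \<in> sets M" "prob A \<ge> 1 - d/2" "\<forall>\<omega>\<in>A. dist (X n \<omega>) L \<le> e" by auto
      have "prob {\<omega> \<in> space M. dist (X n \<omega>) L > e} \<le> prob (space M - A)"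
        using A by (intro finite_measure_mono) (auto simp: not_le[symmetric])
      also have "\<dots> \<le> d/2" using A by (simp add: prob_compl)
      finally show ?case using \<open>d > 0\<close> by (simp add: measure_nonneg)
    qed
  qed
qed

text \<open>Expand the square: centred variables more than \<open>q\<close> apart are uncorrelated,
  so each row of the covariance sum has at most \<open>2 q + 1\<close> contributions of size
  \<open>B\<^sup>2\<close>. The bound is linear in \<open>n\<close> and vanishes after division by
  \<open>n\<^sup>2\<close>.\<close>

lemma bounded_m_dependent_second_moment:
  fixes X :: "int \<Rightarrow> 'a \<Rightarrow> real"
  assumes [measurable]: "\<And>t. X t \<in> borel_measurable M" and bnd: "\<And>t \<omega>. \<bar>X t \<omega>\<bar> \<le> B"
    and ind: "\<And>s t. s + q < t \<Longrightarrow> indep_var borel (X s) borel (X t)"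
    and zero: "\<And>t. expectation (X t) = 0" and "q \<ge> 0"
  shows "expectation (\<lambda>\<omega>. (\<Sum>t\<in>{1..int n}. X t \<omega>)\<^sup>2) \<le> real n * (2 * q + 1) * B\<^sup>2"
proof -
  have B: "B \<ge> 0" using bnd[of 0 undefined] by linarith
  have int: "integrable M (X t)" for t
    by (rule integrable_const_bound[of _ B]) (use bnd in auto)
  have le: "\<bar>X s \<omega> * X t \<omega>\<bar> \<le> B\<^sup>2" for s t \<omega>
    unfolding abs_mult power2_eq_square using bnd B by (intro mult_mono) auto
  have int2: "integrable M (\<lambda>\<omega>. X s \<omega> * X t \<omega>)" for s t
    by (rule integrable_const_bound[of _ "B\<^sup>2"]) (use le in auto)
  have far: "expectation (\<lambda>\<omega>. X s \<omega> * X t \<omega>) = 0" if "s + q < t" for s t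
    using indep_var_lebesgue_integral[OF ind[OF that] int int] zero by simp
  have far': "expectation (\<lambda>\<omega>. X s \<omega> * X t \<omega>) = 0" if "t + q < s" for s t
    using far[OF that] by (simp add: mult.commute)
  have near: "expectation (\<lambda>\<omega>. X s \<omega> * X t \<omega>) \<le> B\<^sup>2" for s t
  proof -
    have "expectation (\<lambda>\<omega>. X s \<omega> * X t \<omega>) \<le> expectation (\<lambda>\<omega>. B\<^sup>2)"
      using le by (intro integral_mono int2) (auto intro: order_trans[OF abs_ge_self])
    then show ?thesis by (simp add: prob_space)
  qed
  have row: "(\<Sum>t\<in>{1..int n}. expectation (\<lambda>\<omega>. X s \<omega> * X t \<omega>)) \<le> (2 * q + 1) * B\<^sup>2" for s
  proof -
    have "(\<Sum>t\<in>{1..int n}. expectation (\<lambda>\<omega>. X s \<omega> * X t \<omega>)) \<le>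
       (\<Sum>t\<in>{1..int n}. if t \<in> {s-q..s+q} then B\<^sup>2 else 0)"
      by (intro sum_mono) (use near far far' in \<open>auto simp: not_le\<close>)
    also have "\<dots> = (\<Sum>t\<in>{1..int n} \<inter> {s-q..s+q}. B\<^sup>2)"
      by (rule sum.inter_restrict[symmetric]) simp
    also have "\<dots> \<le> (\<Sum>t\<in>{s-q..s+q}. B\<^sup>2)"
      by (intro sum_mono2) auto
    also have "\<dots> = (2 * q + 1) * B\<^sup>2" using \<open>q \<ge> 0\<close> by simp
    finally show ?thesis .
  qed
  have "expectation (\<lambda>\<omega>. (\<Sum>t\<in>{1..int n}. X t \<omega>)\<^sup>2) =
      (\<Sum>s\<in>{1..int n}. \<Sum>t\<in>{1..int n}. expectation (\<lambda>\<omega>. X s \<omega> * X t \<omega>))"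
    by (simp add: power2_eq_square sum_product int2)
  also have "\<dots> \<le> (\<Sum>s\<in>{1..int n}. (2 * q + 1) * B\<^sup>2)"
    by (intro sum_mono row)
  finally show ?thesis by (simp add: algebra_simps)
qed

end

section \<open>Laws of large numbers for approximately finitely dependent processes\<close>

text \<open>A continuous substitute for the indicator of a ball: multiplying by it makes a
  continuous function bounded and uniformly continuous, as \<open>lln_bounded\<close> demands; a
  jump would destroy the latter.\<close>

definition cutoff :: "nat \<Rightarrow> 'z::real_normed_vector \<Rightarrow> real" where
  "cutoff R z = max 0 (min 1 (real R + 1 - norm z))"

lemma cutoff_bounds: "0 \<le> cutoff R z" "cutoff R z \<le> 1"
  by (auto simp: cutoff_def)

lemma abs_cutoff_tail_le: "\<bar>a * (1 - cutoff R z)\<bar> \<le> \<bar>a\<bar>"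
  using cutoff_bounds[of R z] by (simp add: abs_mult mult_left_le)

lemma cutoff_eq_1: "norm z \<le> real R \<Longrightarrow> cutoff R z = 1"
  by (auto simp: cutoff_def)

lemma cutoff_eq_0: "norm z \<ge> real R + 1 \<Longrightarrow> cutoff R z = 0"
  by (auto simp: cutoff_def)

lemma continuous_on_cutoff [continuous_intros]:
  "continuous_on S g \<Longrightarrow> continuous_on S (\<lambda>x. cutoff R (g x))"
  unfolding cutoff_def by (intro continuous_intros)

text \<open>Compactness only covers a ball, so the margin matters: on the ball of radius
  \<open>R + 2\<close> the product is uniformly continuous, and if one of two points at distance at
  most \<open>1\<close> leaves that ball, both lie where the cutoff vanishes. Varying
  \<open>x\<close> serves the finite net, varying \<open>z\<close> the approximation of the
  process.\<close>

lemma cutoff_uniformly_continuous: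
  fixes G :: "'k::metric_space \<Rightarrow> 'z::euclidean_space \<Rightarrow> real"
  assumes K: "compact K" and G: "continuous_on (K \<times> UNIV) (\<lambda>p. G (fst p) (snd p))" and "e > 0"
  shows "\<exists>d>0. \<forall>x\<in>K. \<forall>y\<in>K. \<forall>z w. dist x y \<le> d \<longrightarrow> dist z w \<le> d \<longrightarrow>
    \<bar>G x z * cutoff R z - G y w * cutoff R w\<bar> \<le> e"
proof -
  define H where "H p = G (fst p) (snd p) * cutoff R (snd p)" for p
  let ?C = "K \<times> cball (0::'z) (real R + 2)"
  have "compact ?C" by (intro compact_Times K compact_cball)
  moreover have "continuous_on ?C H"
    unfolding H_def[abs_def] by (intro continuous_intros continuous_on_subset[OF G]) auto
  ultimately have "uniformly_continuous_on ?C H" by (rule compact_uniformly_continuous[rotated])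
  then obtain d where d: "d > 0" "\<And>p p'. p \<in> ?C \<Longrightarrow> p' \<in> ?C \<Longrightarrow> dist p' p < d \<Longrightarrow> dist (H p') (H p) < e"
    using \<open>e > 0\<close> unfolding uniformly_continuous_on_def by meson
  define d' where "d' = min 1 (d / 3)"
  have "\<bar>G x z * cutoff R z - G y w * cutoff R w\<bar> \<le> e"
    if "x \<in> K" "y \<in> K" and xy: "dist x y \<le> d'" and zw: "dist z w \<le> d'" for x y z w
  proof (cases "norm z \<le> real R + 2 \<and> norm w \<le> real R + 2")
    case True
    have "dist (x, z) (y, w) \<le> dist x y + dist z w"
      unfolding dist_Pair_Pair by (rule sqrt_sum_squares_le_sum) auto
    also have "\<dots> < d" using xy zw d(1) unfolding d'_def min_def by (auto split: if_splits)
    finally have "dist (H (x, z)) (H (y, w)) < e"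
      using d(2)[of "(y, w)" "(x, z)"] True that by auto
    then show ?thesis by (simp add: H_def dist_real_def)
  next
    case False
    have "\<bar>norm z - norm w\<bar> \<le> 1"
      using norm_triangle_ineq3[of z w] zw unfolding dist_norm d'_def by linarith
    with False have "norm z \<ge> real R + 1" "norm w \<ge> real R + 1" by linarith+
    then show ?thesis using \<open>e > 0\<close> by (simp add: cutoff_eq_0)
  qed
  moreover have "d' > 0" using d(1) by (simp add: d'_def)
  ultimately show ?thesis by blast
qed

lemma continuous_on_section:
  assumes "continuous_on (K \<times> UNIV) (\<lambda>p. G (fst p) (snd p))" and "x \<in> K"
  shows "continuous_on UNIV (G x)"
  using continuous_on_compose2[OF assms(1) continuous_on_Pair[OF continuous_on_const continuous_on_id], of x]
    assms(2) by auto

lemma cutoff_bounded: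
  fixes f :: "'z::euclidean_space \<Rightarrow> real"
  assumes f: "continuous_on UNIV f"
  shows "\<exists>B. \<forall>z. \<bar>f z * cutoff R z\<bar> \<le> B"
proof -
  have "compact (f ` cball 0 (real R + 1))"
    by (intro compact_continuous_image continuous_on_subset[OF f]) auto
  then obtain B where B: "\<And>z. z \<in> cball 0 (real R + 1) \<Longrightarrow> \<bar>f z\<bar> \<le> B"
    using compact_imp_bounded bounded_iff by (metis imageI real_norm_def)
  have "\<bar>f z * cutoff R z\<bar> \<le> B" for z
  proof (cases "norm z \<le> real R + 1")
    case True
    have "\<bar>f z * cutoff R z\<bar> \<le> \<bar>f z\<bar> * 1"
      unfolding abs_mult using cutoff_bounds[of R z] by (intro mult_mono) auto
    with B[of z] True show ?thesis by simp
  next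
    case False
    then show ?thesis using B[of 0] by (simp add: cutoff_eq_0)
  qed
  then show ?thesis by blast
qed

text \<open>Bounds a first absolute moment by a second moment and a free error \<open>c\<close>, in
  place of the Cauchy-Schwarz inequality.\<close>

lemma abs_le_add_square_div:
  fixes a c :: real
  assumes "c > 0"
  shows "\<bar>a\<bar> \<le> c + a\<^sup>2 / c"
proof (cases "\<bar>a\<bar> \<le> c")
  case True
  moreover have "a\<^sup>2 / c \<ge> 0" using assms by simp
  ultimately show ?thesis by linarith
next
  case False
  then have "\<bar>a\<bar> * c \<le> \<bar>a\<bar> * \<bar>a\<bar>" by (intro mult_left_mono) auto
  then have "\<bar>a\<bar> \<le> a\<^sup>2 / c" using assms by (simp add: pos_le_divide_eq power2_eq_square)
  with assms show ?thesis by linarith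
qed

text \<open>Closeness in probability, uniform in time, is enough for bounded uniformly continuous
  functions and asks for no moments of \<open>Z\<close>. The range \<open>q\<close> of dependence
  may grow with the quality of the approximation \<open>m\<close>.\<close>

locale approx_indep_process = prob_space M for M :: "'a measure" +
  fixes Z :: "int \<Rightarrow> 'a \<Rightarrow> 'z::euclidean_space"
    and A :: "nat \<Rightarrow> int \<Rightarrow> 'a \<Rightarrow> 'z"
  assumes Z_meas [measurable]: "\<And>t. Z t \<in> borel_measurable M"
    and A_meas [measurable]: "\<And>m t. A m t \<in> borel_measurable M"
    and Z_distr: "\<And>s t. distr M borel (Z s) = distr M borel (Z t)"
    and A_indep: "\<And>m. \<exists>q\<ge>0. \<forall>s t. s + q < t \<longrightarrow> indep_var borel (A m s) borel (A m t)"
    and approx: "\<And>d e. d > 0 \<Longrightarrow> e > 0 \<Longrightarrow>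
      \<exists>m. \<forall>t. prob {\<omega>\<in>space M. dist (Z t \<omega>) (A m t \<omega>) > d} \<le> e"
begin

definition avg :: "nat \<Rightarrow> ('z \<Rightarrow> 'v::real_vector) \<Rightarrow> 'a \<Rightarrow> 'v" where
  "avg n f \<omega> = (1 / real n) *\<^sub>R (\<Sum>t\<in>{1..int n}. f (Z t \<omega>))"

lemma expectation_Z:
  fixes f :: "'z \<Rightarrow> 'v::{banach, second_countable_topology}"
  assumes [measurable]: "f \<in> borel_measurable borel"
  shows "expectation (\<lambda>\<omega>. f (Z s \<omega>)) = expectation (\<lambda>\<omega>. f (Z t \<omega>))"
proof -
  have "expectation (\<lambda>\<omega>. f (Z r \<omega>)) = integral\<^sup>L (distr M borel (Z r)) f" for r
    by (simp add: integral_distr)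
  then show ?thesis using Z_distr[of s t] by simp
qed

lemma integrable_Z:
  fixes f :: "'z \<Rightarrow> 'v::{banach, second_countable_topology}"
  assumes [measurable]: "f \<in> borel_measurable borel"
  shows "integrable M (\<lambda>\<omega>. f (Z s \<omega>)) \<longleftrightarrow> integrable M (\<lambda>\<omega>. f (Z t \<omega>))"
proof -
  have "integrable M (\<lambda>\<omega>. f (Z r \<omega>)) \<longleftrightarrow> integrable (distr M borel (Z r)) f" for r
    by (simp add: integrable_distr_eq)
  then show ?thesis using Z_distr[of s t] by simp
qed

lemma expectation_avg:
  fixes f :: "'z \<Rightarrow> real"
  assumes [measurable]: "f \<in> borel_measurable borel" and "integrable M (\<lambda>\<omega>. f (Z t \<omega>))" and "n \<ge> 1"
  shows "integrable M (avg n f)" "expectation (avg n f) = expectation (\<lambda>\<omega>. f (Z t \<omega>))"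
proof -
  have i: "integrable M (\<lambda>\<omega>. f (Z s \<omega>))" for s
    using assms(2) integrable_Z[OF assms(1)] by blast
  show "integrable M (avg n f)" unfolding avg_def[abs_def] by (intro integrable_scaleR_right Bochner_Integration.integrable_sum i impI)
  have "expectation (avg n f) = (1 / real n) *\<^sub>R (\<Sum>s\<in>{1..int n}. expectation (\<lambda>\<omega>. f (Z s \<omega>)))"
    unfolding avg_def[abs_def] by (subst integral_scaleR_right, subst Bochner_Integration.integral_sum)
       (auto intro!: Bochner_Integration.integrable_sum i)
  also have "\<dots> = (1 / real n) *\<^sub>R (\<Sum>s\<in>{1..int n}. expectation (\<lambda>\<omega>. f (Z t \<omega>)))"
    by (intro arg_cong[of _ _ "\<lambda>x. (1 / real n) *\<^sub>R x"] sum.cong refl expectation_Z) simp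
  also have "\<dots> = expectation (\<lambda>\<omega>. f (Z t \<omega>))" using \<open>n \<ge> 1\<close> by simp
  finally show "expectation (avg n f) = expectation (\<lambda>\<omega>. f (Z t \<omega>))" .
qed

text \<open>Three errors: replacing \<open>Z\<close> by \<open>A m\<close> costs little by uniform
  continuity; the centred \<open>A m\<close> terms average out through
  \<open>bounded_m_dependent_second_moment\<close>; the means \<open>a t\<close> stay near
  \<open>\<mu>\<close>, being means of close variables. As \<open>m\<close> is fixed before
  \<open>n\<close> grows, the range \<open>q\<close> is a constant.\<close>

lemma lln_bounded:
  fixes f :: "'z \<Rightarrow> real"
  assumes [measurable]: "f \<in> borel_measurable borel" and bnd: "\<And>z. \<bar>f z\<bar> \<le> B"
    and uc: "\<And>e. e > 0 \<Longrightarrow> \<exists>d>0. \<forall>z w. dist z w \<le> d \<longrightarrow> \<bar>f z - f w\<bar> \<le> e"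
  shows "(\<lambda>n. expectation (\<lambda>\<omega>. \<bar>avg n f \<omega> - expectation (\<lambda>\<omega>. f (Z 0 \<omega>))\<bar>)) \<longlonglongrightarrow> 0"
proof (rule tendstoI)
  fix e :: real assume "e > 0"
  \<comment> \<open>The errors will add up to \<open>5 * e1\<close> and a term that vanishes with
    \<open>n\<close>.\<close>
  define e1 where "e1 = e / 8"
  have e1: "e1 > 0" using \<open>e > 0\<close> by (simp add: e1_def)
  have B: "B \<ge> 0" using bnd[of undefined] by linarith
  obtain d where d: "d > 0" "\<And>z w. dist z w \<le> d \<Longrightarrow> \<bar>f z - f w\<bar> \<le> e1"
    using uc[OF e1] by auto
  \<comment> \<open>Off the event of closeness the two values differ by at most
    \<open>2 * B\<close>; the chosen probability makes this cost at most \<open>e1\<close>, with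
    \<open>+ 1\<close> against \<open>B = 0\<close>.\<close>
  obtain m where m: "\<And>t. prob {\<omega>\<in>space M. dist (Z t \<omega>) (A m t \<omega>) > d} \<le> e1 / (2 * B + 1)"
    using approx[OF d(1), of "e1 / (2 * B + 1)"] e1 B by auto
  obtain q where q: "q \<ge> 0" "\<And>s t. s + q < t \<Longrightarrow> indep_var borel (A m s) borel (A m t)"
    using A_indep[of m] by auto
  define \<mu> where "\<mu> = expectation (\<lambda>\<omega>. f (Z 0 \<omega>))"
  define a where "a t = expectation (\<lambda>\<omega>. f (A m t \<omega>))" for t
  define X where "X t \<omega> = f (A m t \<omega>) - a t" for t \<omega>
  have iZ: "integrable M (\<lambda>\<omega>. f (Z t \<omega>))" for t
    by (rule integrable_const_bound[of _ B]) (use bnd in auto)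
  have iA: "integrable M (\<lambda>\<omega>. f (A m t \<omega>))" for t
    by (rule integrable_const_bound[of _ B]) (use bnd in auto)
  have close: "expectation (\<lambda>\<omega>. \<bar>f (Z t \<omega>) - f (A m t \<omega>)\<bar>) \<le> 2 * e1" for t
  proof -
    let ?S = "{\<omega>\<in>space M. dist (Z t \<omega>) (A m t \<omega>) > d}"
    have "expectation (\<lambda>\<omega>. \<bar>f (Z t \<omega>) - f (A m t \<omega>)\<bar>) \<le> expectation (\<lambda>\<omega>. e1 + 2 * B * indicator ?S \<omega>)"
    proof (rule integral_mono)
      fix \<omega> assume "\<omega> \<in> space M"
      then show "\<bar>f (Z t \<omega>) - f (A m t \<omega>)\<bar> \<le> e1 + 2 * B * indicator ?S \<omega>"
        using d(2)[of "Z t \<omega>" "A m t \<omega>"] bnd[of "Z t \<omega>"] bnd[of "A m t \<omega>"] e1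
        by (auto simp: indicator_def not_less)
    qed (auto intro!: integrable_abs Bochner_Integration.integrable_diff iZ iA integrable_real_indicator
          simp: emeasure_eq_measure)
    also have "\<dots> = e1 + 2 * B * prob ?S"
      by (subst Bochner_Integration.integral_add)
        (auto simp: prob_space emeasure_eq_measure intro!: integrable_real_indicator)
    also have "\<dots> \<le> e1 + 2 * B * (e1 / (2 * B + 1))"
      using m[of t] B by (intro add_mono mult_left_mono) auto
    also have "\<dots> \<le> 2 * e1" using B e1 by (simp add: field_simps)
    finally show ?thesis .
  qed
  have a_le: "\<bar>a t - \<mu>\<bar> \<le> 2 * e1" for t
  proof -
    have "\<mu> = expectation (\<lambda>\<omega>. f (Z t \<omega>))"
      unfolding \<mu>_def by (rule expectation_Z) simp
    then have "\<bar>a t - \<mu>\<bar> = \<bar>expectation (\<lambda>\<omega>. f (Z t \<omega>) - f (A m t \<omega>))\<bar>"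
      using iZ iA by (simp add: a_def)
    also have "\<dots> \<le> expectation (\<lambda>\<omega>. \<bar>f (Z t \<omega>) - f (A m t \<omega>)\<bar>)"
      by (rule integral_abs_bound)
    finally show ?thesis using close[of t] by simp
  qed
  have aB: "\<bar>a t\<bar> \<le> B" for t
  proof -
    have "\<bar>a t\<bar> \<le> expectation (\<lambda>\<omega>. \<bar>f (A m t \<omega>)\<bar>)"
      unfolding a_def by (rule integral_abs_bound)
    also have "\<dots> \<le> expectation (\<lambda>\<omega>. B)"
      by (intro integral_mono) (use iA bnd in auto)
    finally show ?thesis by (simp add: prob_space)
  qed
  have X_le: "\<bar>X t \<omega>\<bar> \<le> 2 * B" for t \<omega>
    using aB[of t] bnd[of "A m t \<omega>"] unfolding X_def by linarith
  have X_meas [measurable]: "X t \<in> borel_measurable M" for t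
    unfolding X_def[abs_def] by measurable
  have X_int: "integrable M (X t)" for t
    unfolding X_def[abs_def] using iA by auto
  have "indep_var borel (X s) borel (X t)" if "s + q < t" for s t
    using indep_var_compose[OF q(2)[OF that], of "\<lambda>z. f z - a s" borel "\<lambda>z. f z - a t" borel]
    by (simp add: X_def[abs_def] o_def)
  moreover have "expectation (X t) = 0" for t
    unfolding X_def[abs_def] using iA by (simp add: a_def prob_space)
  ultimately have var: "expectation (\<lambda>\<omega>. (\<Sum>t\<in>{1..int n}. X t \<omega>)\<^sup>2) \<le> real n * (2 * q + 1) * (2 * B)\<^sup>2" for n
    using bounded_m_dependent_second_moment[of X "2 * B" q n] X_le q(1) by simp
  define C where "C = (2 * q + 1) * (2 * B)\<^sup>2"
  have main: "expectation (\<lambda>\<omega>. \<bar>avg n f \<omega> - \<mu>\<bar>) \<le> 5 * e1 + C / e1 / real n" if "n \<ge> 1" for n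
  proof -
    let ?N = "{1..int n}"
    have n: "real n > 0" using that by simp
    have iX2: "integrable M (\<lambda>\<omega>. (\<Sum>t\<in>?N. X t \<omega>)\<^sup>2)"
    proof (rule integrable_const_bound[of _ "(real n * (2 * B))\<^sup>2"])
      have "\<bar>\<Sum>t\<in>?N. X t \<omega>\<bar> \<le> real n * (2 * B)" for \<omega>
        using sum_norm_bound[of ?N "\<lambda>t. X t \<omega>" "2 * B"] X_le by simp
      then show "AE \<omega> in M. norm ((\<Sum>t\<in>?N. X t \<omega>)\<^sup>2) \<le> (real n * (2 * B))\<^sup>2"
        by (intro AE_I2) (metis abs_ge_self abs_le_square_iff order_trans power2_abs real_norm_def abs_power2)
    qed simp
    have pw: "\<bar>avg n f \<omega> - \<mu>\<bar> \<le> (1 / real n) * (\<Sum>t\<in>?N. \<bar>f (Z t \<omega>) - f (A m t \<omega>)\<bar>)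
        + (e1 + (\<Sum>t\<in>?N. X t \<omega>)\<^sup>2 / (e1 * (real n)\<^sup>2)) + 2 * e1" for \<omega>
    proof -
      let ?a = "(1 / real n) * (\<Sum>t\<in>?N. X t \<omega>)"
      have "avg n f \<omega> - \<mu> = (1 / real n) * (\<Sum>t\<in>?N. f (Z t \<omega>) - \<mu>)"
        unfolding avg_def using n by (simp add: sum_subtractf field_simps)
      also have "(\<Sum>t\<in>?N. f (Z t \<omega>) - \<mu>) = (\<Sum>t\<in>?N. f (Z t \<omega>) - f (A m t \<omega>)) + (\<Sum>t\<in>?N. X t \<omega>) + (\<Sum>t\<in>?N. a t - \<mu>)"
        unfolding sum.distrib[symmetric] X_def by (intro sum.cong) auto
      finally have "\<bar>avg n f \<omega> - \<mu>\<bar> \<le> \<bar>(1 / real n) * (\<Sum>t\<in>?N. f (Z t \<omega>) - f (A m t \<omega>))\<bar> + \<bar>?a\<bar> + \<bar>(1 / real n) * (\<Sum>t\<in>?N. a t - \<mu>)\<bar>"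
        by (simp only: distrib_left)
      moreover have "\<bar>(1 / real n) * (\<Sum>t\<in>?N. f (Z t \<omega>) - f (A m t \<omega>))\<bar> \<le> (1 / real n) * (\<Sum>t\<in>?N. \<bar>f (Z t \<omega>) - f (A m t \<omega>)\<bar>)"
        using n by (simp add: abs_mult divide_right_mono sum_abs)
      moreover have "\<bar>?a\<bar> \<le> e1 + ?a\<^sup>2 / e1"
        using e1 by (rule abs_le_add_square_div)
      moreover have "?a\<^sup>2 / e1 = (\<Sum>t\<in>?N. X t \<omega>)\<^sup>2 / (e1 * (real n)\<^sup>2)"
        by (simp add: power_mult_distrib power_divide mult.commute)
      moreover have "\<bar>(1 / real n) * (\<Sum>t\<in>?N. a t - \<mu>)\<bar> \<le> 2 * e1"
        using sum_norm_bound[of ?N "\<lambda>t. a t - \<mu>" "2 * e1"] a_le n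
        by (simp add: abs_mult field_simps)
      ultimately show ?thesis by linarith
    qed
    have "expectation (\<lambda>\<omega>. \<bar>avg n f \<omega> - \<mu>\<bar>) \<le> expectation (\<lambda>\<omega>. (1 / real n) * (\<Sum>t\<in>?N. \<bar>f (Z t \<omega>) - f (A m t \<omega>)\<bar>)
        + (e1 + (\<Sum>t\<in>?N. X t \<omega>)\<^sup>2 / (e1 * (real n)\<^sup>2)) + 2 * e1)"
      by (intro integral_mono pw integrable_abs Bochner_Integration.integrable_diff expectation_avg(1)[where t=0]
           Bochner_Integration.integrable_add integrable_mult_right Bochner_Integration.integrable_sum iZ iA integrable_divide_zero iX2 that) auto
    also have "\<dots> = (1 / real n) * (\<Sum>t\<in>?N. expectation (\<lambda>\<omega>. \<bar>f (Z t \<omega>) - f (A m t \<omega>)\<bar>))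
        + (e1 + expectation (\<lambda>\<omega>. (\<Sum>t\<in>?N. X t \<omega>)\<^sup>2) / (e1 * (real n)\<^sup>2)) + 2 * e1"
      by (simp add: iZ iA iX2 prob_space)
    also have "\<dots> \<le> (1 / real n) * (\<Sum>t\<in>?N. 2 * e1)
        + (e1 + (real n * (2 * q + 1) * (2 * B)\<^sup>2) / (e1 * (real n)\<^sup>2)) + 2 * e1"
      by (intro add_mono mult_left_mono sum_mono close divide_right_mono var) (use e1 in auto)
    also have "\<dots> = 5 * e1 + C / e1 / real n"
      using n by (simp add: C_def power2_eq_square)
    finally show ?thesis .
  qed
  have "(\<lambda>n. 5 * e1 + C / e1 / real n) \<longlonglongrightarrow> 5 * e1 + 0"
    by (intro tendsto_intros lim_const_over_n)
  then have "\<forall>\<^sub>F n in sequentially. 5 * e1 + C / e1 / real n < e"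
    by (rule order_tendstoD) (use \<open>e > 0\<close> in \<open>simp add: e1_def\<close>)
  with eventually_ge_at_top[of 1]
  show "\<forall>\<^sub>F n in sequentially. dist (expectation (\<lambda>\<omega>. \<bar>avg n f \<omega> - expectation (\<lambda>\<omega>. f (Z 0 \<omega>))\<bar>)) 0 < e"
  proof eventually_elim
    case (elim n)
    then show ?case using main[of n] by (simp add: \<mu>_def[symmetric] integral_nonneg_AE)
  qed
qed

section \<open>Truncation of unbounded functions\<close>

lemma tail_tendsto_0:
  fixes f :: "'z \<Rightarrow> real"
  assumes [measurable]: "f \<in> borel_measurable borel" and int: "integrable M (\<lambda>\<omega>. f (Z 0 \<omega>))"
  shows "(\<lambda>R. expectation (\<lambda>\<omega>. \<bar>f (Z 0 \<omega>)\<bar> * (1 - cutoff R (Z 0 \<omega>)))) \<longlonglongrightarrow> 0"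
proof -
  have [measurable]: "(cutoff R :: 'z \<Rightarrow> real) \<in> borel_measurable borel" for R
    by (intro borel_measurable_continuous_onI continuous_intros)
  have "(\<lambda>R. expectation (\<lambda>\<omega>. \<bar>f (Z 0 \<omega>)\<bar> * (1 - cutoff R (Z 0 \<omega>)))) \<longlonglongrightarrow> expectation (\<lambda>\<omega>. 0)"
  proof (rule integral_dominated_convergence[where w="\<lambda>\<omega>. \<bar>f (Z 0 \<omega>)\<bar>"])
    show "AE \<omega> in M. (\<lambda>R. \<bar>f (Z 0 \<omega>)\<bar> * (1 - cutoff R (Z 0 \<omega>))) \<longlonglongrightarrow> 0"
    proof (rule AE_I2, rule tendsto_eventually)
      fix \<omega>
      obtain R0 :: nat where "norm (Z 0 \<omega>) \<le> real R0" using real_arch_simple by blast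
      then have "\<bar>f (Z 0 \<omega>)\<bar> * (1 - cutoff R (Z 0 \<omega>)) = 0" if "R \<ge> R0" for R
        using that by (subst cutoff_eq_1) auto
      then show "\<forall>\<^sub>F R in sequentially. \<bar>f (Z 0 \<omega>)\<bar> * (1 - cutoff R (Z 0 \<omega>)) = 0"
        by (auto simp: eventually_sequentially)
    qed
    show "AE \<omega> in M. norm (\<bar>f (Z 0 \<omega>)\<bar> * (1 - cutoff R (Z 0 \<omega>))) \<le> \<bar>f (Z 0 \<omega>)\<bar>" for R
      using abs_cutoff_tail_le[of "\<bar>f (Z 0 _)\<bar>" R] by (intro AE_I2) simp
  qed (use int in auto)
  then show ?thesis by simp
qed

text \<open>The cutoff splits \<open>f\<close>: the bounded part obeys \<open>lln_bounded\<close>,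
  and the tail \<open>h\<close> is small in mean. The tail counts twice, in the average and in the
  limit, with the same mean by stationarity; hence thirds of \<open>e\<close>.\<close>

lemma lln:
  fixes f :: "'z \<Rightarrow> real"
  assumes f: "continuous_on UNIV f" and int: "integrable M (\<lambda>\<omega>. f (Z 0 \<omega>))"
  shows "(\<lambda>n. expectation (\<lambda>\<omega>. \<bar>avg n f \<omega> - expectation (\<lambda>\<omega>. f (Z 0 \<omega>))\<bar>)) \<longlonglongrightarrow> 0"
proof (rule tendstoI)
  fix e :: real assume "e > 0"
  have f_meas [measurable]: "f \<in> borel_measurable borel"
    by (intro borel_measurable_continuous_onI f)
  have c_meas [measurable]: "(cutoff R :: 'z \<Rightarrow> real) \<in> borel_measurable borel" for R
    by (intro borel_measurable_continuous_onI continuous_intros)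
  have "\<forall>\<^sub>F R in sequentially. expectation (\<lambda>\<omega>. \<bar>f (Z 0 \<omega>)\<bar> * (1 - cutoff R (Z 0 \<omega>))) < e / 3"
    by (rule order_tendstoD[OF tail_tendsto_0]) (use int \<open>e > 0\<close> in auto)
  then obtain R where R: "expectation (\<lambda>\<omega>. \<bar>f (Z 0 \<omega>)\<bar> * (1 - cutoff R (Z 0 \<omega>))) < e / 3"
    by (auto simp: eventually_sequentially)
  have abs_tail: "\<bar>f z * (1 - cutoff R z)\<bar> = \<bar>f z\<bar> * (1 - cutoff R z)" for z
    using cutoff_bounds(2)[of R z] by (simp add: abs_mult)
  define g where "g z = f z * cutoff R z" for z
  define h where "h z = \<bar>f z * (1 - cutoff R z)\<bar>" for z
  have [measurable]: "g \<in> borel_measurable borel" "h \<in> borel_measurable borel"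
    unfolding g_def h_def by measurable
  obtain B where B: "\<And>z. \<bar>g z\<bar> \<le> B" using cutoff_bounded[OF f, of R] by (auto simp: g_def)
  have g: "(\<lambda>n. expectation (\<lambda>\<omega>. \<bar>avg n g \<omega> - expectation (\<lambda>\<omega>. g (Z 0 \<omega>))\<bar>)) \<longlonglongrightarrow> 0"
  proof (rule lln_bounded[where B=B])
    show "\<exists>d>0. \<forall>z w. dist z w \<le> d \<longrightarrow> \<bar>g z - g w\<bar> \<le> e" if "e > 0" for e
    proof -
      \<comment> \<open>A one-point parameter set reduces the statement with parameters to a single
        function.\<close>
      have "continuous_on ({0::real} \<times> UNIV) (\<lambda>p. f (snd p))"
        by (intro continuous_on_compose2[OF f] continuous_intros) auto
      from cutoff_uniformly_continuous[OF _ this that, of R]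
      have "\<exists>d>0. 0 \<le> d \<longrightarrow> (\<forall>z w. dist z w \<le> d \<longrightarrow> \<bar>g z - g w\<bar> \<le> e)"
        by (simp add: g_def)
      then show ?thesis by (meson less_imp_le)
    qed
  qed (use B in auto)
  have int_g: "integrable M (\<lambda>\<omega>. g (Z 0 \<omega>))"
    by (rule integrable_const_bound[of _ B]) (use B in auto)
  have int_h: "integrable M (\<lambda>\<omega>. h (Z 0 \<omega>))"
    by (rule Bochner_Integration.integrable_bound[OF int])
       (use abs_cutoff_tail_le in \<open>auto simp: h_def\<close>)
  have h: "\<bar>f z - g z\<bar> = h z" for z
  proof -
    have "f z - g z = f z * (1 - cutoff R z)" by (simp add: g_def algebra_simps)
    then show ?thesis by (simp add: h_def)
  qed
  have "\<forall>\<^sub>F n in sequentially. expectation (\<lambda>\<omega>. \<bar>avg n g \<omega> - expectation (\<lambda>\<omega>. g (Z 0 \<omega>))\<bar>) < e / 3"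
    by (rule order_tendstoD[OF g]) (use \<open>e > 0\<close> in auto)
  with eventually_ge_at_top[of 1]
  show "\<forall>\<^sub>F n in sequentially. dist (expectation (\<lambda>\<omega>. \<bar>avg n f \<omega> - expectation (\<lambda>\<omega>. f (Z 0 \<omega>))\<bar>)) 0 < e"
  proof eventually_elim
    case (elim n)
    let ?f = "expectation (\<lambda>\<omega>. f (Z 0 \<omega>))" and ?g = "expectation (\<lambda>\<omega>. g (Z 0 \<omega>))"
      and ?h = "expectation (\<lambda>\<omega>. h (Z 0 \<omega>))"
    note iavg = expectation_avg(1)[where t=0, OF _ _ elim(1)]
    have "\<bar>?f - ?g\<bar> = \<bar>expectation (\<lambda>\<omega>. f (Z 0 \<omega>) - g (Z 0 \<omega>))\<bar>"
      using int int_g by simp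
    also have "\<dots> \<le> expectation (\<lambda>\<omega>. \<bar>f (Z 0 \<omega>) - g (Z 0 \<omega>)\<bar>)" by (rule integral_abs_bound)
    finally have fg: "\<bar>?f - ?g\<bar> \<le> ?h" by (simp add: h)
    have pw: "\<bar>avg n f \<omega> - ?f\<bar> \<le> avg n h \<omega> + \<bar>avg n g \<omega> - ?g\<bar> + ?h" for \<omega>
    proof -
      have "\<bar>avg n f \<omega> - avg n g \<omega>\<bar> = \<bar>\<Sum>t\<in>{1..int n}. f (Z t \<omega>) - g (Z t \<omega>)\<bar> / real n"
        by (simp add: avg_def sum_subtractf diff_divide_distrib[symmetric])
      also have "\<dots> \<le> (\<Sum>t\<in>{1..int n}. \<bar>f (Z t \<omega>) - g (Z t \<omega>)\<bar>) / real n"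
        by (intro divide_right_mono sum_abs) auto
      finally have "\<bar>avg n f \<omega> - avg n g \<omega>\<bar> \<le> avg n h \<omega>" by (simp add: avg_def h)
      with fg show ?thesis by linarith
    qed
    have "expectation (\<lambda>\<omega>. \<bar>avg n f \<omega> - ?f\<bar>) \<le> expectation (\<lambda>\<omega>. avg n h \<omega> + \<bar>avg n g \<omega> - ?g\<bar> + ?h)"
      by (intro integral_mono pw integrable_abs Bochner_Integration.integrable_diff
           Bochner_Integration.integrable_add iavg int int_g int_h) auto
    also have "\<dots> = expectation (avg n h) + expectation (\<lambda>\<omega>. \<bar>avg n g \<omega> - ?g\<bar>) + ?h"
      using iavg[OF _ int_g] iavg[OF _ int_h] by (simp add: prob_space)
    also have "expectation (avg n h) = ?h"
      by (rule expectation_avg) (use int_h elim in auto)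
    also have "?h + expectation (\<lambda>\<omega>. \<bar>avg n g \<omega> - ?g\<bar>) + ?h < e"
      using R elim by (simp add: h_def abs_tail)
    finally show ?case by (simp add: integral_nonneg_AE)
  qed
qed

lemma lln_whp:
  fixes f :: "'z \<Rightarrow> real"
  assumes f: "continuous_on UNIV f" and int: "integrable M (\<lambda>\<omega>. f (Z 0 \<omega>))" and "e > 0"
  shows "whp M (\<lambda>n \<omega>. \<bar>avg n f \<omega> - expectation (\<lambda>\<omega>. f (Z 0 \<omega>))\<bar> \<le> e)"
proof (rule whp_markov[OF _ _ lln[OF f int] \<open>e > 0\<close>])
  have [measurable]: "f \<in> borel_measurable borel"
    by (intro borel_measurable_continuous_onI f)
  \<comment> \<open>For \<open>n = 0\<close> the average is \<open>0\<close>, as division by zero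
    gives \<open>0\<close>.\<close>
  have "integrable M (avg n f)" for n
    using expectation_avg(1)[OF _ int, of n] by (cases "n = 0") (auto simp: avg_def[abs_def])
  then show "integrable M (\<lambda>\<omega>. \<bar>avg n f \<omega> - expectation (\<lambda>\<omega>. f (Z 0 \<omega>))\<bar>)" for n by auto
qed auto

text \<open>Cutting off first makes the functions equicontinuous in \<open>x\<close> uniformly in
  \<open>z\<close>, so a finite net of parameters suffices: the law is invoked only for the net
  points and for the tail \<open>h\<close> of the envelope.\<close>

lemma ulln:
  fixes G :: "'k::metric_space \<Rightarrow> 'z \<Rightarrow> real"
  assumes K: "compact K" and G: "continuous_on (K \<times> UNIV) (\<lambda>p. G (fst p) (snd p))"
    and env: "\<And>x z. x \<in> K \<Longrightarrow> \<bar>G x z\<bar> \<le> E z" and E: "continuous_on UNIV E"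
    and int: "integrable M (\<lambda>\<omega>. E (Z 0 \<omega>))" and "e > 0"
  shows "whp M (\<lambda>n \<omega>. \<forall>x\<in>K. \<bar>avg n (G x) \<omega> - expectation (\<lambda>\<omega>. G x (Z 0 \<omega>))\<bar> \<le> e)"
proof (cases "K = {}")
  case True
  then show ?thesis by (simp add: whp_always)
next
  case False
  have E_meas [measurable]: "E \<in> borel_measurable borel"
    by (intro borel_measurable_continuous_onI E)
  have c_meas [measurable]: "(cutoff R :: 'z \<Rightarrow> real) \<in> borel_measurable borel" for R
    by (intro borel_measurable_continuous_onI continuous_intros)
  have Gc: "continuous_on UNIV (G x)" if "x \<in> K" for x
    using continuous_on_section[OF G that] .
  have G_meas [measurable]: "G x \<in> borel_measurable borel" if "x \<in> K" for x
    by (intro borel_measurable_continuous_onI Gc that)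
  have E0: "E z \<ge> 0" for z using env[of _ z] False by (metis abs_ge_zero equals0I order_trans)
  \<comment> \<open>Six errors of size \<open>e1\<close> will occur: two in bounding
    \<open>avg n h\<close>, one for the tail in the mean, two for moving to the net in the average
    and in the mean, one for the law at the net point.\<close>
  define e1 where "e1 = e / 8"
  have e1: "e1 > 0" using \<open>e > 0\<close> by (simp add: e1_def)
  have "\<forall>\<^sub>F R in sequentially. expectation (\<lambda>\<omega>. \<bar>E (Z 0 \<omega>)\<bar> * (1 - cutoff R (Z 0 \<omega>))) < e1"
    by (rule order_tendstoD[OF tail_tendsto_0]) (use int e1 in auto)
  then obtain R where R: "expectation (\<lambda>\<omega>. \<bar>E (Z 0 \<omega>)\<bar> * (1 - cutoff R (Z 0 \<omega>))) < e1"
    by (auto simp: eventually_sequentially)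
  define h where "h z = E z * (1 - cutoff R z)" for z
  have h_cont: "continuous_on UNIV h" unfolding h_def by (intro continuous_intros E)
  have int_h: "integrable M (\<lambda>\<omega>. h (Z 0 \<omega>))"
    by (rule Bochner_Integration.integrable_bound[OF int])
       (use abs_cutoff_tail_le in \<open>auto simp: h_def\<close>)
  have Eh: "expectation (\<lambda>\<omega>. h (Z 0 \<omega>)) < e1"
    using R E0 by (simp add: h_def)
  define H where "H x z = G x z * cutoff R z" for x z
  have GH: "\<bar>G x z - H x z\<bar> \<le> h z" if "x \<in> K" for x z
  proof -
    have "G x z - H x z = G x z * (1 - cutoff R z)" by (simp add: H_def algebra_simps)
    then have "\<bar>G x z - H x z\<bar> = \<bar>G x z\<bar> * (1 - cutoff R z)"
      using cutoff_bounds[of R z] by (simp add: abs_mult)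
    also have "\<dots> \<le> h z" unfolding h_def
      using cutoff_bounds[of R z] env[OF that, of z] by (intro mult_right_mono) auto
    finally show ?thesis .
  qed
  obtain d where d: "d > 0" "\<And>x y z. x \<in> K \<Longrightarrow> y \<in> K \<Longrightarrow> dist x y \<le> d \<Longrightarrow> \<bar>H x z - H y z\<bar> \<le> e1"
    using cutoff_uniformly_continuous[OF K G e1, of R] unfolding H_def
    by (metis dist_self less_imp_le)
  obtain I where I: "finite I" "I \<subseteq> K" "K \<subseteq> (\<Union>x\<in>I. ball x d)"
  proof -
    have "K \<subseteq> (\<Union>x\<in>K. ball x d)" using d(1) by (auto intro!: bexI)
    then show thesis using compactE_image[OF K, of K "\<lambda>x. ball x d"] that by (metis open_ball)
  qed
  have HE: "\<bar>H x z\<bar> \<le> E z" if "x \<in> K" for x z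
  proof -
    have "\<bar>H x z\<bar> \<le> \<bar>G x z\<bar> * 1" unfolding H_def abs_mult
      using cutoff_bounds[of R z] by (intro mult_left_mono) auto
    with env[OF that, of z] show ?thesis by simp
  qed
  have H_cont: "continuous_on UNIV (H x)" if "x \<in> K" for x
    unfolding H_def by (intro continuous_intros Gc that)
  have H_meas [measurable]: "H x \<in> borel_measurable borel" if "x \<in> K" for x
    by (intro borel_measurable_continuous_onI H_cont that)
  have int_G: "integrable M (\<lambda>\<omega>. G x (Z 0 \<omega>))" if "x \<in> K" for x
    by (rule Bochner_Integration.integrable_bound[OF int]) (use env[OF that] that in \<open>auto simp: E0\<close>)
  have int_H: "integrable M (\<lambda>\<omega>. H x (Z 0 \<omega>))" if "x \<in> K" for x
    by (rule Bochner_Integration.integrable_bound[OF int]) (use HE[OF that] that in \<open>auto simp: E0\<close>)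
  have "whp M (\<lambda>n \<omega>. (\<forall>x\<in>I. \<bar>avg n (H x) \<omega> - expectation (\<lambda>\<omega>. H x (Z 0 \<omega>))\<bar> \<le> e1) \<and>
      \<bar>avg n h \<omega> - expectation (\<lambda>\<omega>. h (Z 0 \<omega>))\<bar> \<le> e1)"
    using I by (intro whp_conj whp_ball lln_whp H_cont int_H h_cont int_h e1) auto
  then show ?thesis
  proof (rule whp_mono, intro ballI)
    fix n \<omega> x assume n: "n \<ge> (1::nat)" and x: "x \<in> K"
      and *: "(\<forall>x\<in>I. \<bar>avg n (H x) \<omega> - expectation (\<lambda>\<omega>. H x (Z 0 \<omega>))\<bar> \<le> e1) \<and>
      \<bar>avg n h \<omega> - expectation (\<lambda>\<omega>. h (Z 0 \<omega>))\<bar> \<le> e1"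
    obtain y where y: "y \<in> I" "dist x y \<le> d" using I x by (force simp: dist_commute)
    then have yK: "y \<in> K" using I by auto
    have avg_diff: "\<bar>avg n u \<omega> - avg n v \<omega>\<bar> \<le> avg n w \<omega>" if "\<And>z. \<bar>u z - v z\<bar> \<le> w z" for u v w :: "'z \<Rightarrow> real"
    proof -
      have "\<bar>avg n u \<omega> - avg n v \<omega>\<bar> = \<bar>\<Sum>t\<in>{1..int n}. u (Z t \<omega>) - v (Z t \<omega>)\<bar> / real n"
        by (simp add: avg_def sum_subtractf diff_divide_distrib[symmetric])
      also have "\<dots> \<le> (\<Sum>t\<in>{1..int n}. w (Z t \<omega>)) / real n"
        by (intro divide_right_mono order_trans[OF sum_abs] sum_mono that) auto
      finally show ?thesis by (simp add: avg_def)
    qed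
    have E_diff: "\<bar>expectation (\<lambda>\<omega>. u (Z 0 \<omega>)) - expectation (\<lambda>\<omega>. v (Z 0 \<omega>))\<bar> \<le> expectation (\<lambda>\<omega>. w (Z 0 \<omega>))"
      if "\<And>z. \<bar>u z - v z\<bar> \<le> w z" "integrable M (\<lambda>\<omega>. u (Z 0 \<omega>))" "integrable M (\<lambda>\<omega>. v (Z 0 \<omega>))"
        "integrable M (\<lambda>\<omega>. w (Z 0 \<omega>))" for u v w :: "'z \<Rightarrow> real"
    proof -
      have "\<bar>expectation (\<lambda>\<omega>. u (Z 0 \<omega>)) - expectation (\<lambda>\<omega>. v (Z 0 \<omega>))\<bar> = \<bar>expectation (\<lambda>\<omega>. u (Z 0 \<omega>) - v (Z 0 \<omega>))\<bar>"
        using that by simp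
      also have "\<dots> \<le> expectation (\<lambda>\<omega>. \<bar>u (Z 0 \<omega>) - v (Z 0 \<omega>)\<bar>)" by (rule integral_abs_bound)
      also have "\<dots> \<le> expectation (\<lambda>\<omega>. w (Z 0 \<omega>))"
        by (intro integral_mono integrable_abs Bochner_Integration.integrable_diff that)
      finally show ?thesis .
    qed
    have "\<bar>avg n (G x) \<omega> - avg n (H x) \<omega>\<bar> \<le> avg n h \<omega>"
      by (rule avg_diff) (rule GH[OF x])
    moreover have "\<bar>avg n (H x) \<omega> - avg n (H y) \<omega>\<bar> \<le> avg n (\<lambda>_. e1) \<omega>"
      by (rule avg_diff) (rule d(2)[OF x yK y(2)])
    moreover have "avg n (\<lambda>_. e1) \<omega> = e1" using n by (simp add: avg_def)
    moreover have "\<bar>expectation (\<lambda>\<omega>. G x (Z 0 \<omega>)) - expectation (\<lambda>\<omega>. H x (Z 0 \<omega>))\<bar> \<le> expectation (\<lambda>\<omega>. h (Z 0 \<omega>))"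
      by (rule E_diff) (use GH[OF x] int_G int_H int_h x in auto)
    moreover have "\<bar>expectation (\<lambda>\<omega>. H x (Z 0 \<omega>)) - expectation (\<lambda>\<omega>. H y (Z 0 \<omega>))\<bar> \<le> expectation (\<lambda>\<omega>. e1)"
      by (rule E_diff) (use d(2)[OF x yK y(2)] int_H x yK in auto)
    moreover have "expectation (\<lambda>\<omega>. e1) = e1" by (simp add: prob_space)
    moreover have "\<bar>avg n (H y) \<omega> - expectation (\<lambda>\<omega>. H y (Z 0 \<omega>))\<bar> \<le> e1" using * y by blast
    ultimately show "\<bar>avg n (G x) \<omega> - expectation (\<lambda>\<omega>. G x (Z 0 \<omega>))\<bar> \<le> e"
      using * Eh unfolding e1_def by linarith
  qed
qed

section \<open>Consistency of maximizers and of plug-in averages\<close>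

lemma continuous_on_expectation:
  fixes G :: "'k::metric_space \<Rightarrow> 'z \<Rightarrow> real"
  assumes G: "continuous_on (K \<times> UNIV) (\<lambda>p. G (fst p) (snd p))"
    and env: "\<And>x z. x \<in> K \<Longrightarrow> \<bar>G x z\<bar> \<le> E z"
    and int: "integrable M (\<lambda>\<omega>. E (Z 0 \<omega>))"
  shows "continuous_on K (\<lambda>x. expectation (\<lambda>\<omega>. G x (Z 0 \<omega>)))"
  unfolding continuous_on_sequentially
proof (intro allI ballI impI, elim conjE)
  fix s a assume a: "a \<in> K" and s: "\<forall>n. s n \<in> K" "s \<longlonglongrightarrow> a"
  have Gc: "continuous_on UNIV (G x)" if "x \<in> K" for x
    using continuous_on_section[OF G that] .
  have G_meas [measurable]: "G x \<in> borel_measurable borel" if "x \<in> K" for x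
    by (intro borel_measurable_continuous_onI Gc that)
  have "(\<lambda>n. expectation (\<lambda>\<omega>. G (s n) (Z 0 \<omega>))) \<longlonglongrightarrow> expectation (\<lambda>\<omega>. G a (Z 0 \<omega>))"
  proof (rule integral_dominated_convergence[where w="\<lambda>\<omega>. E (Z 0 \<omega>)"])
    have "(\<lambda>n. G (s n) z) \<longlonglongrightarrow> G a z" for z
      using continuous_on_tendsto_compose[OF G, of "\<lambda>n. (s n, z)" "(a, z)" sequentially]
        tendsto_Pair[OF s(2) tendsto_const] a s(1) by auto
    then show "AE \<omega> in M. (\<lambda>n. G (s n) (Z 0 \<omega>)) \<longlonglongrightarrow> G a (Z 0 \<omega>)" by simp
  qed (use a s env int G_meas in auto)
  then show "((\<lambda>x. expectation (\<lambda>\<omega>. G x (Z 0 \<omega>))) \<circ> s) \<longlonglongrightarrow> expectation (\<lambda>\<omega>. G a (Z 0 \<omega>))"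
    by (simp add: o_def)
qed

text \<open>Outside the ball the continuous mean criterion attains its supremum on a compact set,
  strictly below its value at \<open>x0\<close> by uniqueness. A uniform error smaller than this gap
  keeps every maximizer inside.\<close>

lemma argmax_consistent:
  fixes m :: "'k::metric_space \<Rightarrow> 'z \<Rightarrow> real" and \<theta> :: "nat \<Rightarrow> 'a \<Rightarrow> 'k"
  assumes K: "compact K" and m: "continuous_on (K \<times> UNIV) (\<lambda>p. m (fst p) (snd p))"
    and env: "\<And>x z. x \<in> K \<Longrightarrow> \<bar>m x z\<bar> \<le> E z" and E: "continuous_on UNIV E"
    and int: "integrable M (\<lambda>\<omega>. E (Z 0 \<omega>))"
    and x0: "x0 \<in> K"
    and unique: "\<And>x. x \<in> K \<Longrightarrow> x \<noteq> x0 \<Longrightarrow>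
      expectation (\<lambda>\<omega>. m x (Z 0 \<omega>)) < expectation (\<lambda>\<omega>. m x0 (Z 0 \<omega>))"
    and \<theta>: "\<And>n \<omega>. n \<ge> 1 \<Longrightarrow> \<omega> \<in> space M \<Longrightarrow>
      \<theta> n \<omega> \<in> K \<and> avg n (m x0) \<omega> \<le> avg n (m (\<theta> n \<omega>)) \<omega>"
    and "d > 0"
  shows "whp M (\<lambda>n \<omega>. dist (\<theta> n \<omega>) x0 < d)"
proof (cases "K - ball x0 d = {}")
  case True
  then show ?thesis using \<theta> by (intro whp_always) (force simp: dist_commute)
next
  case False
  have cpt: "compact (K - ball x0 d)" using K by (simp add: compact_diff)
  have cont: "continuous_on (K - ball x0 d) (\<lambda>x. expectation (\<lambda>\<omega>. m x (Z 0 \<omega>)))"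
    by (rule continuous_on_subset[OF continuous_on_expectation[OF m env int]]) auto
  obtain x1 where x1: "x1 \<in> K" "dist x0 x1 \<ge> d"
    "\<And>x. x \<in> K \<Longrightarrow> dist x0 x \<ge> d \<Longrightarrow> expectation (\<lambda>\<omega>. m x (Z 0 \<omega>)) \<le> expectation (\<lambda>\<omega>. m x1 (Z 0 \<omega>))"
    using continuous_attains_sup[OF cpt False cont] by (auto simp: not_less)
  \<comment> \<open>A third of the gap: errors \<open>g\<close> at \<open>x0\<close> and at the
    maximizer still leave \<open>g\<close>.\<close>
  define g where "g = (expectation (\<lambda>\<omega>. m x0 (Z 0 \<omega>)) - expectation (\<lambda>\<omega>. m x1 (Z 0 \<omega>))) / 3"
  have "x1 \<noteq> x0" using x1(2) \<open>d > 0\<close> by auto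
  then have g: "g > 0" using unique[OF x1(1)] by (simp add: g_def)
  have "whp M (\<lambda>n \<omega>. \<forall>x\<in>K. \<bar>avg n (m x) \<omega> - expectation (\<lambda>\<omega>. m x (Z 0 \<omega>))\<bar> \<le> g)"
    by (rule ulln[OF K m env E int g])
  then show ?thesis
  proof (rule whp_mono)
    fix n \<omega> assume n: "n \<ge> (1::nat)" "\<omega> \<in> space M"
      and u: "\<forall>x\<in>K. \<bar>avg n (m x) \<omega> - expectation (\<lambda>\<omega>. m x (Z 0 \<omega>))\<bar> \<le> g"
    show "dist (\<theta> n \<omega>) x0 < d"
    proof (rule ccontr)
      assume "\<not> dist (\<theta> n \<omega>) x0 < d"
      then have "expectation (\<lambda>\<omega>'. m (\<theta> n \<omega>) (Z 0 \<omega>')) \<le> expectation (\<lambda>\<omega>. m x1 (Z 0 \<omega>))"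
      using x1(3)[of "\<theta> n \<omega>"] \<theta>[OF n] by (simp add: dist_commute)
    moreover note \<theta>[OF n] u[rule_format, OF x0] u[rule_format, of "\<theta> n \<omega>"] g
    moreover have "3 * g = expectation (\<lambda>\<omega>. m x0 (Z 0 \<omega>)) - expectation (\<lambda>\<omega>. m x1 (Z 0 \<omega>))"
      by (simp add: g_def)
    ultimately show False by linarith
    qed
  qed
qed

text \<open>Uniformity allows the law to be applied at a random parameter, and continuity of the
  mean moves that parameter to \<open>x0\<close>. The real-valued uniform law is used coordinate by
  coordinate.\<close>

lemma plug_in_lln:
  fixes G :: "'k::metric_space \<Rightarrow> 'z \<Rightarrow> 'v::euclidean_space" and \<theta> :: "nat \<Rightarrow> 'a \<Rightarrow> 'k"
  assumes K: "compact K" and G: "continuous_on (K \<times> UNIV) (\<lambda>p. G (fst p) (snd p))"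
    and env: "\<And>x z. x \<in> K \<Longrightarrow> norm (G x z) \<le> E z" and E: "continuous_on UNIV E"
    and int: "integrable M (\<lambda>\<omega>. E (Z 0 \<omega>))"
    and x0: "x0 \<in> K" and \<theta>: "\<And>n \<omega>. n \<ge> 1 \<Longrightarrow> \<omega> \<in> space M \<Longrightarrow> \<theta> n \<omega> \<in> K"
    and cons: "\<And>d. d > 0 \<Longrightarrow> whp M (\<lambda>n \<omega>. dist (\<theta> n \<omega>) x0 < d)" and "e > 0"
  shows "whp M (\<lambda>n \<omega>. dist (avg n (G (\<theta> n \<omega>)) \<omega>) (expectation (\<lambda>\<omega>. G x0 (Z 0 \<omega>))) \<le> e)"
proof -
  \<comment> \<open>Two errors in each of the \<open>DIM('v)\<close> coordinates, summed in bounding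
    the norm.\<close>
  define e1 where "e1 = e / (2 * real DIM('v))"
  have e1: "e1 > 0" using \<open>e > 0\<close> by (simp add: e1_def)
  define Gb where "Gb b x z = G x z \<bullet> b" for b x z
  have Gb: "continuous_on (K \<times> UNIV) (\<lambda>p. Gb b (fst p) (snd p))" for b
    unfolding Gb_def by (intro continuous_intros G)
  have envb: "\<bar>Gb b x z\<bar> \<le> E z" if "b \<in> Basis" "x \<in> K" for b x z
    unfolding Gb_def using Basis_le_norm[OF that(1)] env[OF that(2)] order_trans by blast
  have "G x0 \<in> borel_measurable borel"
    by (intro borel_measurable_continuous_onI continuous_on_section[OF G x0])
  then have iG: "integrable M (\<lambda>\<omega>. G x0 (Z 0 \<omega>))"
    by (intro Bochner_Integration.integrable_bound[OF int] measurable_compose[OF Z_meas] AE_I2)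
      (auto intro: order_trans[OF env[OF x0]])
  have *: "whp M (\<lambda>n \<omega>. \<bar>avg n (Gb b (\<theta> n \<omega>)) \<omega> - expectation (\<lambda>\<omega>. Gb b x0 (Z 0 \<omega>))\<bar> \<le> 2 * e1)"
    if b: "b \<in> Basis" for b
  proof -
    have "continuous_on K (\<lambda>x. expectation (\<lambda>\<omega>. Gb b x (Z 0 \<omega>)))"
      by (rule continuous_on_expectation[OF Gb envb[OF b] int])
    with x0 e1 obtain d where d: "d > 0" "\<And>x. x \<in> K \<Longrightarrow> dist x x0 < d \<Longrightarrow>
      dist (expectation (\<lambda>\<omega>. Gb b x (Z 0 \<omega>))) (expectation (\<lambda>\<omega>. Gb b x0 (Z 0 \<omega>))) < e1"
      unfolding continuous_on_iff by meson
    have "whp M (\<lambda>n \<omega>. dist (\<theta> n \<omega>) x0 < d \<and>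
       (\<forall>x\<in>K. \<bar>avg n (Gb b x) \<omega> - expectation (\<lambda>\<omega>. Gb b x (Z 0 \<omega>))\<bar> \<le> e1))"
      by (intro whp_conj cons d ulln[OF K Gb envb[OF b] E int e1])
    then show ?thesis
    proof (rule whp_mono)
      fix n \<omega> assume n: "n \<ge> (1::nat)" "\<omega> \<in> space M" and "dist (\<theta> n \<omega>) x0 < d \<and>
       (\<forall>x\<in>K. \<bar>avg n (Gb b x) \<omega> - expectation (\<lambda>\<omega>. Gb b x (Z 0 \<omega>))\<bar> \<le> e1)"
      then show "\<bar>avg n (Gb b (\<theta> n \<omega>)) \<omega> - expectation (\<lambda>\<omega>. Gb b x0 (Z 0 \<omega>))\<bar> \<le> 2 * e1"
        using d(2)[of "\<theta> n \<omega>"] \<theta>[OF n] unfolding dist_real_def by force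
    qed
  qed
  have "whp M (\<lambda>n \<omega>. \<forall>b\<in>Basis. \<bar>avg n (Gb b (\<theta> n \<omega>)) \<omega> - expectation (\<lambda>\<omega>. Gb b x0 (Z 0 \<omega>))\<bar> \<le> 2 * e1)"
    by (intro whp_ball * finite_Basis)
  then show ?thesis
  proof (rule whp_mono)
    fix n \<omega> assume b: "\<forall>b\<in>Basis. \<bar>avg n (Gb b (\<theta> n \<omega>)) \<omega> - expectation (\<lambda>\<omega>. Gb b x0 (Z 0 \<omega>))\<bar> \<le> 2 * e1"
    have "dist (avg n (G (\<theta> n \<omega>)) \<omega>) (expectation (\<lambda>\<omega>. G x0 (Z 0 \<omega>))) \<le>
       (\<Sum>b\<in>Basis. \<bar>(avg n (G (\<theta> n \<omega>)) \<omega> - expectation (\<lambda>\<omega>. G x0 (Z 0 \<omega>))) \<bullet> b\<bar>)"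
      unfolding dist_norm by (rule norm_le_l1)
    also have "\<dots> = (\<Sum>b\<in>Basis. \<bar>avg n (Gb b (\<theta> n \<omega>)) \<omega> - expectation (\<lambda>\<omega>. Gb b x0 (Z 0 \<omega>))\<bar>)"
      using iG by (simp add: Gb_def avg_def inner_diff_left inner_sum_left)
    also have "\<dots> \<le> (\<Sum>b\<in>(Basis::'v set). 2 * e1)" using b by (intro sum_mono) auto
    also have "\<dots> = e" by (simp add: e1_def)
    finally show "dist (avg n (G (\<theta> n \<omega>)) \<omega>) (expectation (\<lambda>\<omega>. G x0 (Z 0 \<omega>))) \<le> e" .
  qed
qed

end

section \<open>Score, criterion and their bounds\<close>

lemma vector4_nth:
  "(vector [a, b, c, d] :: 'a::zero ^ 4) $ 1 = a"
  "(vector [a, b, c, d] :: 'a::zero ^ 4) $ 2 = b"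
  "(vector [a, b, c, d] :: 'a::zero ^ 4) $ 3 = c"
  "(vector [a, b, c, d] :: 'a::zero ^ 4) $ 4 = d"
  by (simp_all add: vector_def)

text \<open>\<open>p\<close> is the pair \<open>(Y t, Y (t - 2))\<close>. The closed form makes
  joint continuity in parameter and data accessible, which \<open>deriv\<close> hides.\<close>

definition score_at :: "real^4 \<Rightarrow> real \<times> real \<Rightarrow> real^4" where
  "score_at \<theta> p = (let y = fst p; x = snd p; r = y - \<theta>$1 - \<theta>$2 * x; g = 1 + \<theta>$4 * x\<^sup>2 in
     vector [r / (\<theta>$3 * g), r * x / (\<theta>$3 * g),
       - (1 / 2) * (1 / \<theta>$3 - r\<^sup>2 / ((\<theta>$3)\<^sup>2 * g)),
       - (1 / 2) * (x\<^sup>2 / g - r\<^sup>2 * x\<^sup>2 / (\<theta>$3 * g\<^sup>2))])"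

lemma axis4_nth:
  "(axis 1 1 :: real^4) $ 1 = 1" "(axis 1 1 :: real^4) $ 2 = 0" "(axis 1 1 :: real^4) $ 3 = 0" "(axis 1 1 :: real^4) $ 4 = 0"
  "(axis 2 1 :: real^4) $ 1 = 0" "(axis 2 1 :: real^4) $ 2 = 1" "(axis 2 1 :: real^4) $ 3 = 0" "(axis 2 1 :: real^4) $ 4 = 0"
  "(axis 3 1 :: real^4) $ 1 = 0" "(axis 3 1 :: real^4) $ 2 = 0" "(axis 3 1 :: real^4) $ 3 = 1" "(axis 3 1 :: real^4) $ 4 = 0"
  "(axis 4 1 :: real^4) $ 1 = 0" "(axis 4 1 :: real^4) $ 2 = 0" "(axis 4 1 :: real^4) $ 3 = 0" "(axis 4 1 :: real^4) $ 4 = 1"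
  by (simp_all add: axis_def)

text \<open>With both variance coordinates positive, the logarithm and the quotient are
  differentiable along each axis, so the total function \<open>deriv\<close> returns genuine partial
  derivatives.\<close>

lemma score_eq_score_at:
  assumes "\<theta>$3 > 0" "\<theta>$4 > 0"
  shows "score y t \<theta> = score_at \<theta> (y t, y (t - 2))"
proof -
  define x where "x = y (t - 2)"
  define r where "r = y t - \<theta>$1 - \<theta>$2 * x"
  define g where "g = 1 + \<theta>$4 * x\<^sup>2"
  have g: "g > 0" using assms by (simp add: g_def add_pos_nonneg)
  define v where "v = \<theta>$3"
  have v: "v > 0" using assms by (simp add: v_def)
  have along: "loglik y t (\<theta> + s *\<^sub>R axis 1 1) = - (1 / 2) * (ln (v * g) + (r - s)\<^sup>2 / (v * g))"
    "loglik y t (\<theta> + s *\<^sub>R axis 2 1) = - (1 / 2) * (ln (v * g) + (r - s * x)\<^sup>2 / (v * g))"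
    "loglik y t (\<theta> + s *\<^sub>R axis 3 1) = - (1 / 2) * (ln ((v + s) * g) + r\<^sup>2 / ((v + s) * g))"
    "loglik y t (\<theta> + s *\<^sub>R axis 4 1) = - (1 / 2) * (ln (v * (g + s * x\<^sup>2)) + r\<^sup>2 / (v * (g + s * x\<^sup>2)))" for s
    unfolding loglik_def vector_add_component vector_scaleR_component axis4_nth
    by (simp_all add: r_def g_def x_def v_def algebra_simps)
  have "((\<lambda>s. loglik y t (\<theta> + s *\<^sub>R axis 1 1)) has_real_derivative r / (v * g)) (at 0)"
    unfolding along using v g by (auto intro!: derivative_eq_intros)
  moreover have "((\<lambda>s. loglik y t (\<theta> + s *\<^sub>R axis 2 1)) has_real_derivative r * x / (v * g)) (at 0)"
    unfolding along using v g by (auto intro!: derivative_eq_intros)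
  moreover have "((\<lambda>s. loglik y t (\<theta> + s *\<^sub>R axis 3 1)) has_real_derivative
      - (1 / 2) * (1 / v - r\<^sup>2 / (v\<^sup>2 * g))) (at 0)"
    unfolding along using v g
    by (auto intro!: derivative_eq_intros simp: field_simps power2_eq_square)
  moreover have "((\<lambda>s. loglik y t (\<theta> + s *\<^sub>R axis 4 1)) has_real_derivative
      - (1 / 2) * (x\<^sup>2 / g - r\<^sup>2 * x\<^sup>2 / (v * g\<^sup>2))) (at 0)"
    unfolding along using v g
    by (auto intro!: derivative_eq_intros simp: field_simps power2_eq_square)
  ultimately show ?thesis
    unfolding score_def gradient_def vec_eq_iff forall_4
    by (simp add: DERIV_imp_deriv score_at_def Let_def vector4_nth g_def r_def x_def v_def)
qed

text \<open>
  The log-likelihood plus \<open>ln (1 + x\<^sup>2) / 2\<close>, which does not depend on \<open>\<theta>\<close> and bounds the logarithm;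
  hence no logarithmic moment of \<open>Y\<close> is needed.
\<close>

definition criterion :: "real^4 \<Rightarrow> real \<times> real \<Rightarrow> real" where
  "criterion \<theta> p = (let y = fst p; x = snd p; r = y - \<theta>$1 - \<theta>$2 * x; g = 1 + \<theta>$4 * x\<^sup>2 in
     - (1 / 2) * (ln (\<theta>$3 * g / (1 + x\<^sup>2)) + r\<^sup>2 / (\<theta>$3 * g)))"

lemma loglik_eq_criterion:
  assumes "\<theta>$3 > 0" "\<theta>$4 > 0"
  shows "loglik y t \<theta> = criterion \<theta> (y t, y (t - 2)) - (1 / 2) * ln (1 + (y (t - 2))\<^sup>2)"
proof -
  have "1 + \<theta>$4 * (y (t - 2))\<^sup>2 > 0" "1 + (y (t - 2))\<^sup>2 > 0"
    using assms by (simp_all add: add_pos_nonneg)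
  then have "ln (\<theta>$3 * (1 + \<theta>$4 * (y (t - 2))\<^sup>2) / (1 + (y (t - 2))\<^sup>2)) =
      ln (\<theta>$3 * (1 + \<theta>$4 * (y (t - 2))\<^sup>2)) - ln (1 + (y (t - 2))\<^sup>2)"
    using assms by (simp add: ln_div)
  then show ?thesis
    unfolding loglik_def criterion_def Let_def fst_conv snd_conv by (simp add: add_divide_distrib diff_divide_distrib)
qed

section \<open>Continuity and growth of score and criterion\<close>

lemma continuous_on_vector4:
  fixes a b c d :: "'x::topological_space \<Rightarrow> 'v::real_normed_vector"
  assumes "continuous_on S a" "continuous_on S b" "continuous_on S c" "continuous_on S d"
  shows "continuous_on S (\<lambda>x. vector [a x, b x, c x, d x] :: 'v^4)"
proof -
  have "continuous_on S (\<lambda>x. (vector [a x, b x, c x, d x] :: 'v^4) $ i)" for i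
    using assms exhaust_4[of i] by (auto simp: vector4_nth)
  then have "continuous_on S (\<lambda>x. \<chi> i. (vector [a x, b x, c x, d x] :: 'v^4) $ i)"
    by (rule continuous_on_vec_lambda)
  then show ?thesis by simp
qed

lemma one_plus_pos: "c > 0 \<Longrightarrow> 1 + c * (x::real)\<^sup>2 > 0"
  by (simp add: add_pos_nonneg)

lemma one_plus_square_pos: "1 + (x::real)\<^sup>2 > 0"
  by (simp add: add_pos_nonneg)

lemma continuous_on_score_at:
  assumes "\<And>\<theta>. \<theta> \<in> K \<Longrightarrow> \<theta>$3 > 0 \<and> \<theta>$4 > 0"
  shows "continuous_on (K \<times> UNIV) (\<lambda>q. score_at (fst q) (snd q))"
  unfolding score_at_def Let_def
  by (intro continuous_on_vector4 continuous_intros ballI)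
    (use assms one_plus_pos in \<open>fastforce simp: less_imp_neq[symmetric]\<close>)+

lemma continuous_on_criterion:
  assumes "\<And>\<theta>. \<theta> \<in> K \<Longrightarrow> \<theta>$3 > 0 \<and> \<theta>$4 > 0"
  shows "continuous_on (K \<times> UNIV) (\<lambda>q. criterion (fst q) (snd q))"
  unfolding criterion_def Let_def
  by (intro continuous_intros ballI)
    (use assms one_plus_pos one_plus_square_pos in \<open>fastforce simp: less_imp_neq[symmetric]\<close>)+

text \<open>\<open>p\<close> is again \<open>(Y t, Y (t - 2))\<close>. Since the variance factor
  grows like \<open>1 + x\<^sup>2\<close> uniformly over the parameter box, this ratio is the only
  unbounded quantity left in score and criterion.\<close>

definition rel_square :: "real \<times> real \<Rightarrow> real" where
  "rel_square p = (fst p)\<^sup>2 / (1 + (snd p)\<^sup>2)"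

lemma rel_square_nonneg: "rel_square p \<ge> 0"
  by (simp add: rel_square_def add_nonneg_nonneg)

definition param_box :: "real \<Rightarrow> real \<Rightarrow> real \<Rightarrow> real \<Rightarrow> real \<Rightarrow> real \<Rightarrow> (real^4) set" where
  "param_box mu_max phi_max om_lo om_hi al_lo al_hi =
     {\<theta>. \<bar>\<theta>$1\<bar> \<le> mu_max \<and> \<bar>\<theta>$2\<bar> \<le> phi_max \<and>
          om_lo \<le> \<theta>$3 \<and> \<theta>$3 \<le> om_hi \<and> al_lo \<le> \<theta>$4 \<and> \<theta>$4 \<le> al_hi}"

lemma residual_bound:
  fixes y x m f mu_max phi_max :: real
  assumes "\<bar>m\<bar> \<le> mu_max" "\<bar>f\<bar> \<le> phi_max"
  shows "(y - m - f * x)\<^sup>2 / (1 + x\<^sup>2) \<le> 3 * (rel_square (y, x) + mu_max\<^sup>2 + phi_max\<^sup>2)"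
proof -
  \<comment> \<open>The right side minus the left side is
    \<open>(a + b)\<^sup>2 + (a + c)\<^sup>2 + (b - c)\<^sup>2\<close>.\<close>
  have three: "(a - b - c)\<^sup>2 \<le> 3 * (a\<^sup>2 + b\<^sup>2 + c\<^sup>2)" for a b c :: real
    using zero_le_power2[of "a + b"] zero_le_power2[of "a + c"] zero_le_power2[of "b - c"]
    by (simp add: power2_eq_square algebra_simps)
  have "m\<^sup>2 \<le> mu_max\<^sup>2" "f\<^sup>2 \<le> phi_max\<^sup>2"
    using assms by (auto simp: abs_le_square_iff[symmetric])
  then have "m\<^sup>2 \<le> mu_max\<^sup>2 * (1 + x\<^sup>2)" "(f * x)\<^sup>2 \<le> phi_max\<^sup>2 * (1 + x\<^sup>2)"
    using mult_mono[of "m\<^sup>2" "mu_max\<^sup>2" 1 "1 + x\<^sup>2"] mult_mono[of "f\<^sup>2" "phi_max\<^sup>2" "x\<^sup>2" "1 + x\<^sup>2"]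
    by (auto simp: power_mult_distrib)
  moreover have "y\<^sup>2 = rel_square (y, x) * (1 + x\<^sup>2)"
    using one_plus_square_pos[of x] by (simp add: rel_square_def)
  ultimately have "(y - m - f * x)\<^sup>2 \<le> 3 * (rel_square (y, x) + mu_max\<^sup>2 + phi_max\<^sup>2) * (1 + x\<^sup>2)"
    using three[of y m "f * x"] by (simp add: algebra_simps)
  then show ?thesis using one_plus_square_pos[of x] by (simp add: pos_divide_le_eq)
qed

text \<open>Everything is measured against \<open>w = 1 + x\<^sup>2\<close>: the variance factor
  \<open>g\<close> lies between two multiples of \<open>w\<close>, so each score component is at
  most a constant times \<open>1 + q\<close> with \<open>q = r\<^sup>2 / w\<close>, and the argument
  of the logarithm in the criterion stays in a compact interval of positive numbers.\<close>

lemma score_and_criterion_bound: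
  assumes "om_lo > 0" "al_lo > 0"
  shows "\<exists>c>0. \<forall>\<theta>\<in>param_box mu_max phi_max om_lo om_hi al_lo al_hi. \<forall>p.
     (\<Sum>i\<in>UNIV. \<bar>score_at \<theta> p $ i\<bar>) \<le> c * (1 + rel_square p) \<and> \<bar>criterion \<theta> p\<bar> \<le> c * (1 + rel_square p)"
proof -
  \<comment> \<open>Chosen so that
    \<open>k * (1 + x\<^sup>2) \<le> 1 + \<theta>$4 * x\<^sup>2\<close>.\<close>
  define k where "k = min 1 al_lo"
  have k: "0 < k" "k \<le> 1" "k \<le> al_lo" using assms by (auto simp: k_def)
  \<comment> \<open>\<open>d\<close> passes from \<open>1 + q\<close> to
    \<open>1 + rel_square\<close>, \<open>c1\<close> adds up the coefficients of the quotients in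
    the score, and \<open>c2\<close> bounds the logarithm at both ends of its range.\<close>
  define d where "d = 3 + 3 * (mu_max\<^sup>2 + phi_max\<^sup>2)"
  have d: "d > 0" by (simp add: d_def add_pos_nonneg)
  define c1 where "c1 = 2 / (om_lo * k) + 1 / om_lo + 1 / (om_lo\<^sup>2 * k) + 1 / k + 1 / (om_lo * k\<^sup>2)"
  define c2 where "c2 = \<bar>ln (om_lo * k)\<bar> + \<bar>ln (om_hi * (1 + al_hi))\<bar>"
  define c where "c = (c1 + c2) * d"
  have c1: "c1 > 0" unfolding c1_def using k assms by (intro add_pos_pos divide_pos_pos mult_pos_pos) auto
  have c2: "c2 \<ge> 0" by (simp add: c2_def)
  have main: "(\<Sum>i\<in>UNIV. \<bar>score_at \<theta> (y, x) $ i\<bar>) \<le> c * (1 + rel_square (y, x)) \<and> \<bar>criterion \<theta> (y, x)\<bar> \<le> c * (1 + rel_square (y, x))"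
    if \<theta>: "\<theta> \<in> param_box mu_max phi_max om_lo om_hi al_lo al_hi" for \<theta> y x
  proof -
    define r where "r = y - \<theta>$1 - \<theta>$2 * x"
    define g where "g = 1 + \<theta>$4 * x\<^sup>2"
    define w where "w = 1 + x\<^sup>2"
    define q where "q = r\<^sup>2 / w"
    define v where "v = \<theta>$3"
    have v: "om_lo \<le> v" "v \<le> om_hi" "v > 0" using \<theta> assms by (auto simp: v_def param_box_def)
    have w: "w \<ge> 1" "x\<^sup>2 \<le> w" by (simp_all add: w_def)
    have q0: "q \<ge> 0" using w by (simp add: q_def)
    have r2: "r\<^sup>2 = q * w" using w by (simp add: q_def)
    have "k * w \<le> g"
    proof -
      have "k * x\<^sup>2 \<le> \<theta>$4 * x\<^sup>2" using \<theta> k by (intro mult_right_mono) (auto simp: param_box_def)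
      then show ?thesis using k by (simp add: w_def g_def algebra_simps)
    qed
    have g_up: "g \<le> (1 + al_hi) * w"
    proof -
      have "\<theta>$4 * x\<^sup>2 \<le> al_hi * x\<^sup>2" "al_hi > 0" using \<theta> assms by (auto simp: param_box_def intro!: mult_right_mono)
      moreover have "(1 + al_hi) * w = 1 + x\<^sup>2 + al_hi + al_hi * x\<^sup>2"
        by (simp add: w_def algebra_simps)
      ultimately show ?thesis unfolding g_def by (smt (verit) zero_le_power2)
    qed
    have kw: "k * w > 0" using k w by simp
    then have g: "g > 0" using \<open>k * w \<le> g\<close> by linarith
    have q_le: "1 + q \<le> d * (1 + rel_square (y, x))"
    proof -
      have "q \<le> 3 * (rel_square (y, x) + mu_max\<^sup>2 + phi_max\<^sup>2)"
        unfolding q_def r_def w_def by (rule residual_bound) (use \<theta> in \<open>auto simp: param_box_def\<close>)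
      moreover have "0 \<le> (mu_max\<^sup>2 + phi_max\<^sup>2) * rel_square (y, x)" 
        by (intro mult_nonneg_nonneg rel_square_nonneg) simp
      ultimately show ?thesis by (simp add: d_def algebra_simps)
    qed
    have frac: "\<bar>a\<bar> / (v * g) \<le> (1 + q) / (om_lo * k)" if "\<bar>a\<bar> \<le> (1 + q) * w" for a
    proof -
      have "\<bar>a\<bar> / (v * g) \<le> ((1 + q) * w) / (om_lo * (k * w))"
        using that v \<open>k * w \<le> g\<close> kw assms q0 w by (intro frac_le mult_mono) auto
      then show ?thesis using w by simp
    qed
    \<comment> \<open>Removes the odd powers: \<open>|r| \<le> r\<^sup>2 + 1\<close> and
      \<open>|r x| \<le> r\<^sup>2 + x\<^sup>2\<close>, both at most
      \<open>(1 + q) * w\<close>.\<close>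
    have sq: "\<bar>a * e\<bar> \<le> a\<^sup>2 + e\<^sup>2" for a e :: real
    proof -
      have "0 \<le> (\<bar>a\<bar> - \<bar>e\<bar>)\<^sup>2" "0 \<le> \<bar>a\<bar> * \<bar>e\<bar>" by simp_all
      then show ?thesis unfolding power2_diff power2_abs abs_mult by linarith
    qed
    have half: "\<bar>- (1 / 2) * (a - b)\<bar> \<le> a' + b'" if "0 \<le> a" "0 \<le> b" "a \<le> a'" "b \<le> b'" for a b a' b' :: real
    proof -
      have "\<bar>- (1 / 2) * (a - b)\<bar> \<le> \<bar>a - b\<bar>" unfolding abs_mult by simp
      also have "\<dots> \<le> a' + b'" using that by linarith
      finally show ?thesis .
    qed
    have s1: "\<bar>r / (v * g)\<bar> \<le> (1 + q) / (om_lo * k)"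
      using frac[of r] sq[of r 1] r2 w v g by (simp add: abs_mult algebra_simps)
    have s2: "\<bar>r * x / (v * g)\<bar> \<le> (1 + q) / (om_lo * k)"
      using frac[of "r * x"] sq[of r x] r2 w v g by (simp add: abs_mult algebra_simps)
    have "1 / v \<le> 1 / om_lo" using v assms by (intro divide_left_mono) auto
    have r2g: "r\<^sup>2 / (v * g) \<le> q / (om_lo * k)"
    proof -
      have "r\<^sup>2 / (v * g) \<le> (q * w) / (om_lo * (k * w))"
        unfolding r2 using v \<open>k * w \<le> g\<close> kw assms q0 w by (intro frac_le mult_mono) auto
      then show ?thesis using w by simp
    qed
    have r2vg: "r\<^sup>2 / (v\<^sup>2 * g) \<le> q / (om_lo\<^sup>2 * k)"
    proof -
      have "r\<^sup>2 / (v\<^sup>2 * g) \<le> (q * w) / (om_lo\<^sup>2 * (k * w))"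
        unfolding r2 using v \<open>k * w \<le> g\<close> kw assms q0 w by (intro frac_le mult_mono power_mono) auto
      then show ?thesis using w by simp
    qed
    have x2g: "x\<^sup>2 / g \<le> 1 / k"
    proof -
      have "x\<^sup>2 / g \<le> w / (k * w)"
        using \<open>k * w \<le> g\<close> kw w by (intro frac_le) auto
      then show ?thesis using w by simp
    qed
    have r2x2: "r\<^sup>2 * x\<^sup>2 / (v * g\<^sup>2) \<le> q / (om_lo * k\<^sup>2)"
    proof -
      have "r\<^sup>2 * x\<^sup>2 / (v * g\<^sup>2) = (r\<^sup>2 / (v * g)) * (x\<^sup>2 / g)" by (simp add: power2_eq_square)
      also have "\<dots> \<le> (q / (om_lo * k)) * (1 / k)"
        using r2g x2g q0 assms k g v by (intro mult_mono) auto
      finally show ?thesis by (simp add: power2_eq_square mult.assoc)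
    qed
    have nonneg: "0 \<le> r\<^sup>2 / (v\<^sup>2 * g)" "0 \<le> x\<^sup>2 / g" "0 \<le> r\<^sup>2 * x\<^sup>2 / (v * g\<^sup>2)" "0 \<le> r\<^sup>2 / (v * g)" "0 < 1 / v"
      using v g by auto
    have c_le: "(c1 + c2) * (1 + q) \<le> c * (1 + rel_square (y, x))"
      unfolding c_def mult.assoc using c1 c2 q_le by (intro mult_left_mono) auto
    have "(\<Sum>i\<in>UNIV. \<bar>score_at \<theta> (y, x) $ i\<bar>) =
      \<bar>r / (v * g)\<bar> + \<bar>r * x / (v * g)\<bar> + \<bar>- (1 / 2) * (1 / v - r\<^sup>2 / (v\<^sup>2 * g))\<bar> + \<bar>- (1 / 2) * (x\<^sup>2 / g - r\<^sup>2 * x\<^sup>2 / (v * g\<^sup>2))\<bar>"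
      by (simp add: sum_4 score_at_def Let_def vector4_nth r_def g_def v_def)
    also have "\<dots> \<le> (1 + q) / (om_lo * k) + (1 + q) / (om_lo * k) + (1 / om_lo + q / (om_lo\<^sup>2 * k)) + (1 / k + q / (om_lo * k\<^sup>2))"
      using s1 s2 r2vg x2g r2x2 \<open>1 / v \<le> 1 / om_lo\<close> nonneg by (intro add_mono half) auto
    also have "\<dots> \<le> c1 * (1 + q)"
    proof -
      have *: "q / a \<le> (1 / a) * (1 + q)" "1 / a \<le> (1 / a) * (1 + q)" if "a > 0" for a
        using that q0 by (simp_all add: field_simps)
      have "c1 * (1 + q) = (1 + q) / (om_lo * k) + (1 + q) / (om_lo * k) + ((1 / om_lo) * (1 + q) + (1 / (om_lo\<^sup>2 * k)) * (1 + q))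
         + ((1 / k) * (1 + q) + (1 / (om_lo * k\<^sup>2)) * (1 + q))"
        by (simp add: c1_def algebra_simps add_divide_distrib)
      then show ?thesis
        using *(2)[of om_lo] *(1)[of "om_lo\<^sup>2 * k"] *(2)[of k] *(1)[of "om_lo * k\<^sup>2"] assms k by simp
    qed
    also have "\<dots> \<le> (c1 + c2) * (1 + q)" using c2 q0 by (intro mult_right_mono) auto
    finally have 1: "(\<Sum>i\<in>UNIV. \<bar>score_at \<theta> (y, x) $ i\<bar>) \<le> c * (1 + rel_square (y, x))"
      using c_le by linarith
    have lo: "om_lo * k \<le> v * g / w"
    proof -
      have "om_lo * (k * w) \<le> v * g" using v \<open>k * w \<le> g\<close> kw assms by (intro mult_mono) auto
      then show ?thesis using w by (simp add: pos_le_divide_eq mult.assoc)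
    qed
    have hi: "v * g / w \<le> om_hi * (1 + al_hi)"
    proof -
      have "v * g \<le> om_hi * ((1 + al_hi) * w)" using v g_up g by (intro mult_mono) auto
      then show ?thesis using w by (simp add: pos_divide_le_eq mult.assoc)
    qed
    have "0 < om_lo * k" using k assms by simp
    then have ln_le: "\<bar>ln (v * g / w)\<bar> \<le> c2"
      using lo hi ln_mono[of "om_lo * k" "v * g / w"] ln_mono[of "v * g / w" "om_hi * (1 + al_hi)"]
      unfolding c2_def by linarith
    have "\<bar>criterion \<theta> (y, x)\<bar> = 1 / 2 * \<bar>ln (v * g / w) + r\<^sup>2 / (v * g)\<bar>"
      by (simp add: criterion_def Let_def v_def g_def w_def r_def abs_mult)
    also have "\<dots> \<le> \<bar>ln (v * g / w) + r\<^sup>2 / (v * g)\<bar>" by simp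
    also have "\<dots> \<le> \<bar>ln (v * g / w)\<bar> + \<bar>r\<^sup>2 / (v * g)\<bar>" by (rule abs_triangle_ineq)
    also have "\<dots> \<le> c2 + q / (om_lo * k)"
      using ln_le r2g nonneg(4) by (intro add_mono) auto
    also have "\<dots> \<le> c2 * (1 + q) + c1 * (1 + q)"
    proof (rule add_mono)
      show "c2 \<le> c2 * (1 + q)" using mult_left_mono[of 1 "1 + q" c2] c2 q0 by simp
      have "1 / (om_lo * k) \<le> c1"
        unfolding c1_def using assms k by (intro add_increasing2 divide_right_mono) auto
      then have "1 / (om_lo * k) * q \<le> c1 * (1 + q)" using q0 c1 by (intro mult_mono) auto
      then show "q / (om_lo * k) \<le> c1 * (1 + q)" by simp
    qed
    also have "\<dots> = (c1 + c2) * (1 + q)" by (simp add: algebra_simps)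
    finally have "\<bar>criterion \<theta> (y, x)\<bar> \<le> c * (1 + rel_square (y, x))"
      using c_le by linarith
    with 1 show ?thesis by blast
  qed
  have "c > 0" using c1 c2 d by (simp add: c_def)
  then show ?thesis using main by (intro exI[of _ c]) auto
qed

section \<open>Matrix-valued summands and their envelope\<close>

lemma borel_measurable_continuous_comp:
  fixes f :: "'b::topological_space \<Rightarrow> 'c::topological_space"
  assumes "continuous_on S f" "g \<in> borel_measurable M" "g \<in> space M \<rightarrow> S"
  shows "(\<lambda>\<omega>. f (g \<omega>)) \<in> borel_measurable M"
  by (rule measurable_compose[OF measurable_restrict_space2[OF assms(3,2)]
      borel_measurable_continuous_on_restrict[OF assms(1)]])

lemma borel_measurable_criterion: "criterion \<theta> \<in> borel_measurable borel"
  unfolding criterion_def[abs_def] Let_def borel_prod[symmetric] by measurable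

lemma borel_measurable_rel_square [measurable]: "rel_square \<in> borel_measurable borel"
  unfolding rel_square_def[abs_def] borel_prod[symmetric] by measurable

lemma norm_matrix_le:
  fixes A :: "real^'n^'m"
  shows "norm A \<le> (\<Sum>i\<in>UNIV. \<Sum>j\<in>UNIV. \<bar>A$i$j\<bar>)"
proof -
  have "norm A \<le> (\<Sum>i\<in>UNIV. norm (A$i))"
    unfolding norm_vec_def by (rule L2_set_le_sum) auto
  also have "\<dots> \<le> (\<Sum>i\<in>UNIV. \<Sum>j\<in>UNIV. \<bar>A$i$j\<bar>)"
    by (intro sum_mono norm_le_l1_cart)
  finally show ?thesis .
qed

lemma norm_outer_product_le: "norm (outer_product u v) \<le> (\<Sum>i\<in>UNIV. \<bar>u$i\<bar>) * (\<Sum>j\<in>UNIV. \<bar>v$j\<bar>)"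
  by (rule order_trans[OF norm_matrix_le]) (simp add: outer_product_def abs_mult sum_product)

lemma continuous_on_outer_product:
  assumes "continuous_on S f" "continuous_on S g"
  shows "continuous_on S (\<lambda>x. outer_product (f x) (g x))"
  unfolding outer_product_def using assms by (intro continuous_intros)

lemma vector2_nth:
  "(vector [a, b] :: 'a::zero ^ 2) $ 1 = a"
  "(vector [a, b] :: 'a::zero ^ 2) $ 2 = b"
  by (simp_all add: vector_def)

lemma continuous_on_vector2:
  fixes a b :: "'x::topological_space \<Rightarrow> 'v::real_normed_vector"
  assumes "continuous_on S a" "continuous_on S b"
  shows "continuous_on S (\<lambda>x. vector [a x, b x] :: 'v^2)"
proof -
  have "continuous_on S (\<lambda>x. (vector [a x, b x] :: 'v^2) $ i)" for i
    using assms exhaust_2[of i] by (auto simp: vector2_nth)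
  then have "continuous_on S (\<lambda>x. \<chi> i. (vector [a x, b x] :: 'v^2) $ i)"
    by (rule continuous_on_vec_lambda)
  then show ?thesis by simp
qed

lemma bounded_linear_block_diag: "bounded_linear (\<lambda>p. block_diag (fst p) (snd p))"
proof -
  have "linear (\<lambda>p. block_diag (fst p) (snd p))"
    by (rule linearI) (simp_all add: block_diag_def vec_eq_iff forall_4 vector4_nth)
  then show ?thesis by (simp add: linear_conv_bounded_linear)
qed

text \<open>\<open>z\<close> stands for a window: \<open>fst z\<close> is the pair of time
  \<open>t\<close> and \<open>snd z\<close> that of time \<open>t - 1\<close>, so both scores of a
  summand are read off one argument.\<close>

definition omega_term :: "real^4 \<Rightarrow> (real \<times> real) \<times> (real \<times> real) \<Rightarrow> real^4^4" where
  "omega_term \<theta> z =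
     outer_product (score_at \<theta> (fst z) + score_at \<theta> (snd z)) (score_at \<theta> (fst z) + score_at \<theta> (snd z))
     - outer_product (score_at \<theta> (fst z)) (score_at \<theta> (fst z))"

definition sigma_term :: "real^4 \<Rightarrow> (real \<times> real) \<times> (real \<times> real) \<Rightarrow> real^4^4" where
  "sigma_term \<theta> z = block_diag (Sigma1_term (snd (fst z)) \<theta>) (Sigma2_term (snd (fst z)) \<theta>)"

text \<open>Scores grow at most linearly in \<open>rel_square\<close> and their outer products
  quadratically; up to constants, this one square dominates the criterion and both matrix
  summands.\<close>

definition envelope :: "(real \<times> real) \<times> (real \<times> real) \<Rightarrow> real" where
  "envelope z = (1 + rel_square (fst z) + rel_square (snd z))\<^sup>2"

lemma envelope_ge: "1 + rel_square (fst z) \<le> envelope z" "1 \<le> envelope z"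
proof -
  let ?e = "1 + rel_square (fst z) + rel_square (snd z)"
  have "1 \<le> ?e" using rel_square_nonneg[of "fst z"] rel_square_nonneg[of "snd z"] by linarith
  then have "?e \<le> ?e\<^sup>2" by (simp add: power2_eq_square mult_le_cancel_left1)
  then show "1 + rel_square (fst z) \<le> envelope z" "1 \<le> envelope z"
    using rel_square_nonneg[of "fst z"] rel_square_nonneg[of "snd z"]
    unfolding envelope_def by linarith+
qed

lemma continuous_on_rel_square: "continuous_on S f \<Longrightarrow> continuous_on S (\<lambda>x. rel_square (f x))"
  unfolding rel_square_def
  by (intro continuous_intros ballI) (use one_plus_square_pos in \<open>auto simp: less_imp_neq[symmetric]\<close>)

lemma continuous_on_envelope: "continuous_on S envelope"
  unfolding envelope_def[abs_def] by (intro continuous_intros continuous_on_rel_square)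

lemma continuous_on_omega_term:
  assumes "\<And>\<theta>. \<theta> \<in> K \<Longrightarrow> \<theta>$3 > 0 \<and> \<theta>$4 > 0"
  shows "continuous_on (K \<times> UNIV) (\<lambda>q. omega_term (fst q) (snd q))"
proof -
  have s: "continuous_on (K \<times> UNIV) (\<lambda>q. score_at (fst q) (h (snd q)))" if "continuous_on UNIV h"
    for h :: "(real \<times> real) \<times> (real \<times> real) \<Rightarrow> real \<times> real"
  proof -
    have "continuous_on (K \<times> UNIV) (\<lambda>q. (fst q, h (snd q)))"
      by (intro continuous_intros continuous_on_compose2[OF that]) auto
    from continuous_on_compose2[OF continuous_on_score_at[OF assms] this] show ?thesis by force
  qed
  show ?thesis unfolding omega_term_def
    by (intro continuous_on_diff continuous_on_outer_product continuous_on_add s continuous_intros)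
qed

lemma continuous_on_sigma_term:
  assumes "\<And>\<theta>. \<theta> \<in> K \<Longrightarrow> \<theta>$3 > 0 \<and> \<theta>$4 > 0"
  shows "continuous_on (K \<times> UNIV) (\<lambda>q. sigma_term (fst q) (snd q))"
proof -
  have nz: "fst q $ 3 \<noteq> 0" "1 + fst q $ 4 * (snd (fst (snd q)))\<^sup>2 \<noteq> 0" if "q \<in> K \<times> UNIV" 
    for q :: "(real^4) \<times> (real \<times> real) \<times> (real \<times> real)"
    using assms[of "fst q"] one_plus_pos[of "fst q $ 4" "snd (fst (snd q))"] that by auto
  show ?thesis
    unfolding sigma_term_def block_diag_def Sigma1_term_def Sigma2_term_def
    by (intro continuous_on_vector4 continuous_on_vector2 continuous_intros ballI)
      (use nz in \<open>auto simp: vector2_nth\<close>)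
qed

text \<open>In each entry the denominator grows in \<open>x\<close> at least as fast as the
  numerator and is bounded below uniformly over the box, so the bound is free of the data.\<close>

lemma sigma_term_bound:
  assumes "om_lo > 0" "al_lo > 0"
  shows "\<exists>c>0. \<forall>\<theta>\<in>param_box mu_max phi_max om_lo om_hi al_lo al_hi. \<forall>x.
     norm (Sigma1_term x \<theta>) \<le> c \<and> norm (Sigma2_term x \<theta>) \<le> c"
proof -
  define k where "k = min 1 al_lo"
  have k: "0 < k" "k \<le> 1" "k \<le> al_lo" using assms by (auto simp: k_def)
  define c where "c = 4 / (om_lo * k) + 1 / om_lo\<^sup>2 + 1 / k\<^sup>2"
  have main: "norm (Sigma1_term x \<theta>) \<le> c \<and> norm (Sigma2_term x \<theta>) \<le> c"
    if \<theta>: "\<theta> \<in> param_box mu_max phi_max om_lo om_hi al_lo al_hi" for \<theta> x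
  proof -
    define v where "v = \<theta>$3"
    define g where "g = 1 + \<theta>$4 * x\<^sup>2"
    define w where "w = 1 + x\<^sup>2"
    have v: "om_lo \<le> v" "v > 0" using \<theta> assms by (auto simp: v_def param_box_def)
    have x: "\<bar>x\<bar> \<le> w" "x\<^sup>2 \<le> w" "1 \<le> w"
      using zero_le_power2[of "\<bar>x\<bar> - 1"] by (auto simp: w_def power2_diff)
    have "k * x\<^sup>2 \<le> \<theta>$4 * x\<^sup>2" using \<theta> k by (intro mult_right_mono) (auto simp: param_box_def)
    then have kw: "k * w \<le> g" using k by (simp add: w_def g_def algebra_simps)
    have kw0: "k * w > 0" using k x by simp
    then have g: "g > 0" using kw by linarith
    have frac: "a / (v * g) \<le> 1 / (om_lo * k)" if "a \<le> w" "0 \<le> a" for a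
    proof -
      have "a / (v * g) \<le> w / (om_lo * (k * w))"
        using that v kw kw0 assms x by (intro frac_le mult_mono) auto
      then show ?thesis using x by simp
    qed
    have f: "1 / (v * g) \<le> 1 / (om_lo * k)" "\<bar>x\<bar> / (v * g) \<le> 1 / (om_lo * k)" "x\<^sup>2 / (v * g) \<le> 1 / (om_lo * k)"
      using frac[of 1] frac[of "\<bar>x\<bar>"] frac[of "x\<^sup>2"] x by auto
    have v2: "1 / v\<^sup>2 \<le> 1 / om_lo\<^sup>2"
      using v assms by (intro divide_left_mono power_mono mult_pos_pos) auto
    have x4: "x ^ 4 / g\<^sup>2 \<le> 1 / k\<^sup>2"
    proof -
      have "x\<^sup>2 / g \<le> w / (k * w)" using kw kw0 x by (intro frac_le) auto
      also have "\<dots> = 1 / k" using x by simp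
      finally have "(x\<^sup>2 / g)\<^sup>2 \<le> (1 / k)\<^sup>2" using g by (intro power_mono) auto
      then show ?thesis by (simp add: power_divide flip: power_mult)
    qed
    have pos: "0 \<le> 1 / (om_lo * k)" "0 \<le> 1 / om_lo\<^sup>2" "0 \<le> 1 / k\<^sup>2"
      using v g assms k by auto
    have arith1: "N \<le> 4 * D + E + F" if "N \<le> p + 2 * q + r" "p \<le> D" "q \<le> D" "r \<le> D" "0 \<le> D" "0 \<le> E" "0 \<le> F"
      for N D E F p q r :: real using that by linarith
    have arith2: "N \<le> 4 * D + E + F" if "N \<le> p / 2 + q + r / 2" "p \<le> E" "q \<le> D" "r \<le> F" "0 \<le> D" "0 \<le> E" "0 \<le> F"
      for N D E F p q r :: real using that by linarith
    have c: "c = 4 * (1 / (om_lo * k)) + 1 / om_lo\<^sup>2 + 1 / k\<^sup>2" by (simp add: c_def)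
    have S1: "Sigma1_term x \<theta> = (1 / (v * g)) *\<^sub>R vector [vector [1, x], vector [x, x\<^sup>2]]"
      by (simp add: Sigma1_term_def v_def g_def)
    have "norm (Sigma1_term x \<theta>) \<le> 1 / (v * g) + 2 * (\<bar>x\<bar> / (v * g)) + x\<^sup>2 / (v * g)"
      unfolding S1 by (rule order_trans[OF norm_matrix_le])
        (use v g in \<open>simp add: sum_2 vector2_nth abs_mult ac_simps\<close>)
    then have 1: "norm (Sigma1_term x \<theta>) \<le> c" unfolding c using f pos by (rule arith1)
    have S2: "Sigma2_term x \<theta> = vector [vector [1 / (2 * v\<^sup>2), x\<^sup>2 / (2 * (v * g))], vector [x\<^sup>2 / (2 * (v * g)), x ^ 4 / (2 * g\<^sup>2)]]"
      by (simp add: Sigma2_term_def v_def g_def mult.assoc)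
    have "norm (Sigma2_term x \<theta>) \<le> (1 / v\<^sup>2) / 2 + x\<^sup>2 / (v * g) + (x ^ 4 / g\<^sup>2) / 2"
      unfolding S2 by (rule order_trans[OF norm_matrix_le])
        (use v g in \<open>simp add: sum_2 vector2_nth abs_mult ac_simps\<close>)
    then have "norm (Sigma2_term x \<theta>) \<le> c" unfolding c using v2 f(3) x4 pos by (rule arith2)
    with 1 show ?thesis by blast
  qed
  have "c > 0" unfolding c_def using assms k by (intro add_pos_pos) auto
  with main show ?thesis by blast
qed

text \<open>The two products are bounded separately because each must be integrable before the two
  integrals in \<open>Omega\<close> can be merged.\<close>

lemma omega_term_bound:
  assumes "(\<Sum>i\<in>UNIV. \<bar>score_at \<theta> (fst z) $ i\<bar>) \<le> c * (1 + rel_square (fst z))"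
    "(\<Sum>i\<in>UNIV. \<bar>score_at \<theta> (snd z) $ i\<bar>) \<le> c * (1 + rel_square (snd z))" "c > 0"
  shows "norm (outer_product (score_at \<theta> (fst z) + score_at \<theta> (snd z)) (score_at \<theta> (fst z) + score_at \<theta> (snd z))) \<le> 4 * c\<^sup>2 * envelope z"
    "norm (outer_product (score_at \<theta> (fst z)) (score_at \<theta> (fst z))) \<le> 4 * c\<^sup>2 * envelope z"
proof -
  let ?S = "\<lambda>u::real^4. \<Sum>i\<in>UNIV. \<bar>u $ i\<bar>"
  let ?e = "1 + rel_square (fst z) + rel_square (snd z)"
  have e: "rel_square (fst z) \<ge> 0" "rel_square (snd z) \<ge> 0" by (rule rel_square_nonneg)+
  have "?S (u + v) \<le> ?S u + ?S v" for u v
    unfolding sum.distrib[symmetric] by (intro sum_mono) (simp add: abs_triangle_ineq)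
  note tri = this[of "score_at \<theta> (fst z)" "score_at \<theta> (snd z)"]
  have "c * (1 + rel_square (fst z)) + c * (1 + rel_square (snd z)) \<le> 2 * c * ?e"
    using e \<open>c > 0\<close> by (simp add: algebra_simps)
  then have sum: "?S (score_at \<theta> (fst z) + score_at \<theta> (snd z)) \<le> 2 * c * ?e"
    using tri assms by linarith
  have "c * (1 + rel_square (fst z)) \<le> 2 * c * ?e"
    using e \<open>c > 0\<close> by (simp add: algebra_simps)
  then have one: "?S (score_at \<theta> (fst z)) \<le> 2 * c * ?e" using assms by linarith
  have sq: "norm (outer_product u u) \<le> 4 * c\<^sup>2 * envelope z" if "?S u \<le> 2 * c * ?e" for u
  proof -
    have "norm (outer_product u u) \<le> (?S u)\<^sup>2"
      using norm_outer_product_le[of u u] by (simp add: power2_eq_square)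
    also have "\<dots> \<le> (2 * c * ?e)\<^sup>2" using that by (intro power_mono) (auto intro: sum_nonneg)
    finally show ?thesis by (simp add: envelope_def power_mult_distrib)
  qed
  show "norm (outer_product (score_at \<theta> (fst z) + score_at \<theta> (snd z)) (score_at \<theta> (fst z) + score_at \<theta> (snd z))) \<le> 4 * c\<^sup>2 * envelope z"
    "norm (outer_product (score_at \<theta> (fst z)) (score_at \<theta> (fst z))) \<le> 4 * c\<^sup>2 * envelope z"
    using sq sum one by blast+
qed

section \<open>The stationary solution as a causal function of the innovations\<close>

lemma dist_pair_le_sum: "dist (a, b) (c, d) \<le> dist a c + dist b d"
  unfolding dist_Pair_Pair by (rule sqrt_sum_squares_le_sum) auto

lemma (in prob_space) indep_var_pair_distr:
  assumes ind: "indep_var S X T Y" and [measurable]: "f \<in> measurable S A" "g \<in> measurable T B"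
  shows "distr M (A \<Otimes>\<^sub>M B) (\<lambda>\<omega>. (f (X \<omega>), g (Y \<omega>))) =
    distr M A (\<lambda>\<omega>. f (X \<omega>)) \<Otimes>\<^sub>M distr M B (\<lambda>\<omega>. g (Y \<omega>))"
proof -
  have [measurable]: "X \<in> measurable M S" "Y \<in> measurable M T"
    using indep_var_rv1[OF ind] indep_var_rv2[OF ind] by auto
  interpret Y: prob_space "distr M T Y" by (rule prob_space_distr) simp
  interpret gY: prob_space "distr (distr M T Y) B g" by (rule Y.prob_space_distr) simp
  have "distr M A (\<lambda>\<omega>. f (X \<omega>)) \<Otimes>\<^sub>M distr M B (\<lambda>\<omega>. g (Y \<omega>)) =
      distr (distr M S X) A f \<Otimes>\<^sub>M distr (distr M T Y) B g"
    by (simp add: distr_distr o_def)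
  also have "\<dots> = distr (distr M S X \<Otimes>\<^sub>M distr M T Y) (A \<Otimes>\<^sub>M B) (\<lambda>(x, y). (f x, g y))"
    by (rule pair_measure_distr) (auto intro: gY.sigma_finite_measure_axioms)
  also have "distr M S X \<Otimes>\<^sub>M distr M T Y = distr M (S \<Otimes>\<^sub>M T) (\<lambda>\<omega>. (X \<omega>, Y \<omega>))"
    using ind unfolding indep_var_distribution_eq by blast
  also have "distr \<dots> (A \<Otimes>\<^sub>M B) (\<lambda>(x, y). (f x, g y)) = distr M (A \<Otimes>\<^sub>M B) (\<lambda>\<omega>. (f (X \<omega>), g (Y \<omega>)))"
    by (simp add: distr_distr o_def)
  finally show ?thesis ..
qed

text \<open>Only the values \<open>e s\<close> with \<open>t - 2 m < s \<le> t\<close> enter, which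
  makes the approximations at distant times independent.\<close>

primrec truncated_solution :: "real \<Rightarrow> real \<Rightarrow> real \<Rightarrow> nat \<Rightarrow> int \<Rightarrow> (int \<Rightarrow> real) \<Rightarrow> real" where
  "truncated_solution \<mu> \<phi> b 0 t e = 0"
| "truncated_solution \<mu> \<phi> b (Suc m) t e =
     \<mu> + (\<phi> + b * e (t - 1)) * truncated_solution \<mu> \<phi> b m (t - 2) e + e t"

lemma truncated_solution_cong:
  "(\<And>s. t - 2 * int m \<le> s \<Longrightarrow> s \<le> t \<Longrightarrow> e s = e' s) \<Longrightarrow>
    truncated_solution \<mu> \<phi> b m t e = truncated_solution \<mu> \<phi> b m t e'"
proof (induction m arbitrary: t)
  case (Suc m)
  have "truncated_solution \<mu> \<phi> b m (t - 2) e = truncated_solution \<mu> \<phi> b m (t - 2) e'"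
    by (rule Suc.IH) (use Suc.prems in auto)
  with Suc.prems[of t] Suc.prems[of "t - 1"] show ?case by simp
qed simp

lemma truncated_solution_measurable:
  assumes "{t - 2 * int m..t} \<subseteq> J"
  shows "(\<lambda>e. truncated_solution \<mu> \<phi> b m t e) \<in> borel_measurable (PiM J (\<lambda>_. borel))"
  using assms
proof (induction m arbitrary: t)
  case (Suc m)
  have [measurable]: "(\<lambda>e. truncated_solution \<mu> \<phi> b m (t - 2) e) \<in> borel_measurable (PiM J (\<lambda>_. borel))"
    by (rule Suc.IH) (use Suc.prems in auto)
  have "t \<in> J" "t - 1 \<in> J" using Suc.prems by auto
  then have [measurable]: "(\<lambda>e. e t) \<in> borel_measurable (PiM J (\<lambda>_. borel))"
    "(\<lambda>e. e (t - 1)) \<in> borel_measurable (PiM J (\<lambda>_. borel))"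
    by (auto intro: measurable_component_singleton)
  have "truncated_solution \<mu> \<phi> b (Suc m) t =
      (\<lambda>e. \<mu> + (\<phi> + b * e (t - 1)) * truncated_solution \<mu> \<phi> b m (t - 2) e + e t)"
    by (rule ext) simp
  then show ?case by simp
next
  case 0
  have "truncated_solution \<mu> \<phi> b 0 t = (\<lambda>_. 0)" by (rule ext) simp
  then show ?case by simp
qed

text \<open>The model at the true parameter alone, with \<open>b\<close> carrying its own sign. For
  the theorem, \<open>contraction\<close> and \<open>b \<noteq> 0\<close> are obtained from the true
  parameter lying in the region.\<close>

locale rca_model = prob_space M for M :: "'a measure" +
  fixes \<epsilon> Y :: "int \<Rightarrow> 'a \<Rightarrow> real" and \<mu> \<phi> \<sigma> b :: real
  assumes indep: "indep_vars (\<lambda>_. borel) \<epsilon> UNIV"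
    and ident: "\<And>s r. distr M borel (\<epsilon> s) = distr M borel (\<epsilon> r)"
    and mean: "expectation (\<epsilon> 1) = 0"
    and variance: "variance (\<epsilon> 1) = \<sigma>\<^sup>2" and \<sigma>: "\<sigma> > 0"
    and fourth_moment: "integrable M (\<lambda>\<omega>. \<epsilon> 1 \<omega> ^ 4)"
    and solution: "stationary_solution M \<epsilon> \<mu> \<phi> b Y"
    and contraction: "ereal_expectation M (\<lambda>\<omega>. ln_abs (\<phi> + b * \<epsilon> 1 \<omega>)) < 0"
    and b: "b \<noteq> 0"
begin

section \<open>Moments of the innovations and of the random coefficient\<close>

lemma eps_meas [measurable]: "\<epsilon> t \<in> borel_measurable M"
  using indep by (simp add: indep_vars_def)

lemma Y_meas [measurable]: "Y t \<in> borel_measurable M"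
  using solution by (simp add: stationary_solution_def strictly_stationary_def)

lemma Y_rec: "AE \<omega> in M. Y t \<omega> = \<mu> + \<phi> * Y (t - 2) \<omega> + b * Y (t - 2) \<omega> * \<epsilon> (t - 1) \<omega> + \<epsilon> t \<omega>"
  using solution by (simp add: stationary_solution_def)

lemma integrable_eps_iff:
  fixes g :: "real \<Rightarrow> real"
  assumes [measurable]: "g \<in> borel_measurable borel"
  shows "integrable M (\<lambda>\<omega>. g (\<epsilon> s \<omega>)) \<longleftrightarrow> integrable M (\<lambda>\<omega>. g (\<epsilon> t \<omega>))"
proof -
  have "integrable M (\<lambda>\<omega>. g (\<epsilon> r \<omega>)) \<longleftrightarrow> integrable (distr M borel (\<epsilon> r)) g" for r
    by (simp add: integrable_distr_eq)
  then show ?thesis using ident[of s t] by simp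
qed

lemma expectation_eps_eq:
  fixes g :: "real \<Rightarrow> real"
  assumes [measurable]: "g \<in> borel_measurable borel"
  shows "expectation (\<lambda>\<omega>. g (\<epsilon> s \<omega>)) = expectation (\<lambda>\<omega>. g (\<epsilon> t \<omega>))"
proof -
  have "expectation (\<lambda>\<omega>. g (\<epsilon> r \<omega>)) = integral\<^sup>L (distr M borel (\<epsilon> r)) g" for r
    by (simp add: integral_distr)
  then show ?thesis using ident[of s t] by simp
qed

lemma eps_moments_integrable:
  assumes "k \<le> 4"
  shows "integrable M (\<lambda>\<omega>. \<epsilon> t \<omega> ^ k)"
proof -
  have "integrable M (\<lambda>\<omega>. \<epsilon> t \<omega> ^ 4)"
    using fourth_moment integrable_eps_iff[of "\<lambda>x. x ^ 4" t 1] by simp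
  then have "integrable M (\<lambda>\<omega>. 1 + \<epsilon> t \<omega> ^ 4)" by simp
  then show ?thesis
  proof (rule Bochner_Integration.integrable_bound)
    have "\<bar>x\<bar> ^ k \<le> 1 + x ^ 4" for x :: real
    proof (cases "\<bar>x\<bar> \<le> 1")
      case True
      then have "\<bar>x\<bar> ^ k \<le> 1" by (simp add: power_le_one)
      then show ?thesis by (simp add: add_increasing2)
    next
      case False
      then have "\<bar>x\<bar> ^ k \<le> \<bar>x\<bar> ^ 4" using assms by (intro power_increasing) auto
      then show ?thesis by simp
    qed
    then show "AE \<omega> in M. norm (\<epsilon> t \<omega> ^ k) \<le> norm (1 + \<epsilon> t \<omega> ^ 4)"
      by (intro AE_I2) (auto simp: power_abs)
  qed simp
qed

lemma eps_integrable: "integrable M (\<epsilon> t)"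
  using eps_moments_integrable[of 1 t] by simp

lemma eps_mean: "expectation (\<epsilon> t) = 0"
  using expectation_eps_eq[of "\<lambda>x. x" t 1] mean by simp

lemma eps_var: "expectation (\<lambda>\<omega>. (\<epsilon> t \<omega>)\<^sup>2) = \<sigma>\<^sup>2"
  using expectation_eps_eq[of "\<lambda>x. x\<^sup>2" t 1] variance mean by simp

text \<open>
  The logarithm of \<open>\<bar>\<phi> + b \<epsilon>\<bar>\<close> is truncated below at \<open>-k\<close> so that its mean \<open>E L\<close> is finite and still
  negative; then \<open>(E (exp (\<kappa> L)) - 1) / \<kappa>\<close> tends to \<open>E L\<close> as \<open>\<kappa>\<close> decreases to \<open>0\<close>.
\<close>

lemma coefficient_moment:
  "\<exists>\<kappa>>0. integrable M (\<lambda>\<omega>. \<bar>\<phi> + b * \<epsilon> 1 \<omega>\<bar> powr \<kappa>) \<and> expectation (\<lambda>\<omega>. \<bar>\<phi> + b * \<epsilon> 1 \<omega>\<bar> powr \<kappa>) < 1"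
proof -
  define A where "A \<omega> = \<phi> + b * \<epsilon> 1 \<omega>" for \<omega>
  have A_meas [measurable]: "A \<in> borel_measurable M" unfolding A_def by measurable
  have A_int: "integrable M A" unfolding A_def[abs_def] using eps_integrable by auto
  \<comment> \<open>The positive part is at most \<open>|A|\<close>, hence integrable; only the
    negative part of the logarithm can have infinite mean.\<close>
  define p where "p \<omega> = max 0 (ln \<bar>A \<omega>\<bar>)" for \<omega>
  have [measurable]: "p \<in> borel_measurable M" unfolding p_def by measurable
  have p_le: "0 \<le> p \<omega>" "p \<omega> \<le> \<bar>A \<omega>\<bar>" for \<omega>
    using ln_le_minus_one[of "\<bar>A \<omega>\<bar>"] by (cases "A \<omega> = 0"; force simp: p_def)+
  have p_int: "integrable M p"
    by (rule Bochner_Integration.integrable_bound[OF A_int]) (use p_le in auto)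
  \<comment> \<open>Real \<open>ln 0\<close> is \<open>0\<close>, while \<open>ln_abs 0\<close> is
    minus infinity; the value \<open>k\<close> at zeros of \<open>A\<close> makes this the
    truncation of the latter.\<close>
  define n where "n k \<omega> = (if A \<omega> = 0 then real k else min (max 0 (- ln \<bar>A \<omega>\<bar>)) (real k))" for k \<omega>
  have [measurable]: "n k \<in> borel_measurable M" for k unfolding n_def by measurable
  have n_le: "0 \<le> n k \<omega>" "n k \<omega> \<le> real k" for k \<omega> by (auto simp: n_def)
  have n_int: "integrable M (n k)" for k
    by (rule integrable_const_bound[of _ "real k"]) (use n_le in auto)
  define P where "P = (\<integral>\<^sup>+ \<omega>. e2ennreal (ln_abs (A \<omega>)) \<partial>M)"
  define N where "N = (\<integral>\<^sup>+ \<omega>. e2ennreal (- ln_abs (A \<omega>)) \<partial>M)"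
  have "e2ennreal (ln_abs (A \<omega>)) = ennreal (p \<omega>)" for \<omega>
    by (cases "A \<omega> = 0") (simp_all add: ln_abs_def p_def e2ennreal_neg ennreal_max_0 ennreal_max_0')
  then have P: "P = ennreal (expectation p)"
    unfolding P_def by (simp add: nn_integral_eq_integral p_int p_le)
  have N_sup: "e2ennreal (- ln_abs (A \<omega>)) = (SUP k. ennreal (n k \<omega>))" for \<omega>
  proof (cases "A \<omega> = 0")
    case True
    then show ?thesis
      by (simp add: ln_abs_def n_def ennreal_of_nat_eq_real_of_nat[symmetric] ennreal_SUP_of_nat_eq_top e2ennreal_infty)
  next
    case False
    define u where "u = max 0 (- ln \<bar>A \<omega>\<bar>)"
    obtain k0 :: nat where k0: "u \<le> real k0" using real_arch_simple by blast
    have "(SUP k. ennreal (n k \<omega>)) = ennreal u"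
    proof (rule antisym)
      have "n k \<omega> \<le> u" for k using False by (simp add: n_def u_def)
      then show "(SUP k. ennreal (n k \<omega>)) \<le> ennreal u"
        by (intro SUP_least ennreal_leI)
      have "ennreal u = ennreal (n k0 \<omega>)" using k0 False by (simp add: n_def u_def)
      then show "ennreal u \<le> (SUP k. ennreal (n k \<omega>))" by (auto intro: SUP_upper)
    qed
    then show ?thesis using False
      by (simp add: ln_abs_def u_def ennreal_max_0 ennreal_max_0')
  qed
  have n_mono: "incseq (\<lambda>k \<omega>. ennreal (n k \<omega>))"
    by (auto simp: incseq_def le_fun_def n_def intro!: ennreal_leI)
  \<comment> \<open>Monotone convergence covers an infinite \<open>N\<close> too, so in either case
    some finite truncation already exceeds the positive part in mean.\<close>
  have "N = (SUP k. \<integral>\<^sup>+ \<omega>. ennreal (n k \<omega>) \<partial>M)"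
    unfolding N_def N_sup by (rule nn_integral_monotone_convergence_SUP[OF n_mono]) simp
  then have N: "N = (SUP k. ennreal (expectation (n k)))"
    by (simp add: nn_integral_eq_integral n_int n_le)
  have "enn2ereal P - enn2ereal N < 0"
    using contraction unfolding ereal_expectation_def P_def N_def A_def .
  then have "P < N"
    unfolding P by (cases N) (auto simp: less_ennreal.rep_eq ereal_minus_less_iff enn2ereal_ennreal top_ereal_def p_le split: if_splits)
  then obtain k where "ennreal (expectation p) < ennreal (expectation (n k))"
    unfolding N P by (auto simp: less_SUP_iff)
  then have neg: "expectation p - expectation (n k) < 0"
    by (simp add: ennreal_less_iff p_le integral_nonneg_AE)
  \<comment> \<open>\<open>L\<close> dominates the logarithm of \<open>|A|\<close>, so a bound on
    the mean of \<open>exp (\<kappa> L)\<close> passes to the power moment of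
    \<open>|A|\<close>.\<close>
  define L where "L \<omega> = p \<omega> - n k \<omega>" for \<omega>
  have [measurable]: "L \<in> borel_measurable M" unfolding L_def by measurable
  have L_int: "integrable M L" unfolding L_def[abs_def] using p_int n_int by auto
  have EL: "expectation L < 0" unfolding L_def[abs_def] using p_int n_int neg by simp
  have expL: "\<bar>A \<omega>\<bar> \<le> exp (L \<omega>)" "exp (L \<omega>) \<le> 1 + \<bar>A \<omega>\<bar>" for \<omega>
  proof -
    have "ln \<bar>A \<omega>\<bar> \<le> L \<omega>" if "A \<omega> \<noteq> 0" using that by (auto simp: L_def p_def n_def)
    then have "exp (ln \<bar>A \<omega>\<bar>) \<le> exp (L \<omega>)" if "A \<omega> \<noteq> 0"
      using that by (metis exp_le_cancel_iff)
    then show "\<bar>A \<omega>\<bar> \<le> exp (L \<omega>)" by (cases "A \<omega> = 0") auto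
    have "exp (L \<omega>) \<le> exp (p \<omega>)" using n_le by (simp add: L_def)
    also have "exp (p \<omega>) \<le> 1 + \<bar>A \<omega>\<bar>" by (cases "A \<omega> = 0") (auto simp: p_def max_def)
    finally show "exp (L \<omega>) \<le> 1 + \<bar>A \<omega>\<bar>" .
  qed
  define \<kappa> where "\<kappa> j = 1 / real (Suc j)" for j
  have \<kappa>: "0 < \<kappa> j" "\<kappa> j \<le> 1" for j by (auto simp: \<kappa>_def)
  have low: "L \<omega> \<le> (exp (\<kappa> j * L \<omega>) - 1) / \<kappa> j" for j \<omega>
    using exp_ge_add_one_self[of "\<kappa> j * L \<omega>"] \<kappa>[of j] by (simp add: field_simps)
  \<comment> \<open>Convexity of \<open>exp\<close> between \<open>0\<close> and \<open>L\<close>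
    bounds the difference quotient from above uniformly in \<open>j\<close>; together with
    \<open>low\<close> this yields the dominating function.\<close>
  have up: "(exp (\<kappa> j * L \<omega>) - 1) / \<kappa> j \<le> \<bar>A \<omega>\<bar>" for j \<omega>
  proof -
    have "exp ((1 - \<kappa> j) *\<^sub>R 0 + \<kappa> j *\<^sub>R L \<omega>) \<le> (1 - \<kappa> j) * exp 0 + \<kappa> j * exp (L \<omega>)"
      using \<kappa>[of j] by (intro convex_onD[OF exp_convex]) auto
    then have "exp (\<kappa> j * L \<omega>) - 1 \<le> \<kappa> j * (exp (L \<omega>) - 1)" by (simp add: algebra_simps)
    also have "\<dots> \<le> \<kappa> j * \<bar>A \<omega>\<bar>" using expL(2)[of \<omega>] \<kappa>[of j] by (intro mult_left_mono) auto
    finally show ?thesis using \<kappa>[of j] by (simp add: field_simps)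
  qed
  have bound: "\<bar>(exp (\<kappa> j * L \<omega>) - 1) / \<kappa> j\<bar> \<le> \<bar>L \<omega>\<bar> + \<bar>A \<omega>\<bar>" for j \<omega>
    using low[of \<omega> j] up[of j \<omega>] by linarith
  have bound_int: "integrable M (\<lambda>\<omega>. \<bar>L \<omega>\<bar> + \<bar>A \<omega>\<bar>)" using L_int A_int by auto
  have lim: "(\<lambda>j. (exp (\<kappa> j * x) - 1) / \<kappa> j) \<longlonglongrightarrow> x" for x :: real
  proof -
    have "((\<lambda>h. exp (h * x)) has_real_derivative x) (at 0)"
      by (auto intro!: derivative_eq_intros)
    from DERIV_D[OF this] have "((\<lambda>h. (exp (h * x) - 1) / h) \<longlongrightarrow> x) (at 0)" by simp
    moreover have "filterlim \<kappa> (at 0) sequentially"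
      unfolding filterlim_at \<kappa>_def using LIMSEQ_inverse_real_of_nat by (auto simp: inverse_eq_divide)
    ultimately show ?thesis by (rule filterlim_compose)
  qed
  have "(\<lambda>j. expectation (\<lambda>\<omega>. (exp (\<kappa> j * L \<omega>) - 1) / \<kappa> j)) \<longlonglongrightarrow> expectation L"
    by (rule integral_dominated_convergence[where w="\<lambda>\<omega>. \<bar>L \<omega>\<bar> + \<bar>A \<omega>\<bar>"])
      (use lim bound bound_int in auto)
  then have "\<forall>\<^sub>F j in sequentially. expectation (\<lambda>\<omega>. (exp (\<kappa> j * L \<omega>) - 1) / \<kappa> j) < 0"
    using EL by (rule order_tendstoD)
  then obtain j where j: "expectation (\<lambda>\<omega>. (exp (\<kappa> j * L \<omega>) - 1) / \<kappa> j) < 0"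
    by (auto simp: eventually_sequentially)
  have q_int: "integrable M (\<lambda>\<omega>. (exp (\<kappa> j * L \<omega>) - 1) / \<kappa> j)"
    by (rule Bochner_Integration.integrable_bound[OF bound_int]) (use bound[of j] in \<open>auto intro!: AE_I2\<close>)
  have e_int: "integrable M (\<lambda>\<omega>. exp (\<kappa> j * L \<omega>))"
  proof -
    have "integrable M (\<lambda>\<omega>. \<kappa> j * ((exp (\<kappa> j * L \<omega>) - 1) / \<kappa> j) + 1)"
      by (intro Bochner_Integration.integrable_add integrable_mult_right q_int integrable_const)
    moreover have "\<kappa> j \<noteq> 0" using \<kappa>(1)[of j] by simp
    ultimately show ?thesis by simp
  qed
  have powr_le: "\<bar>A \<omega>\<bar> powr \<kappa> j \<le> exp (\<kappa> j * L \<omega>)" for \<omega>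
  proof -
    have "\<bar>A \<omega>\<bar> powr \<kappa> j \<le> exp (L \<omega>) powr \<kappa> j"
      using expL(1)[of \<omega>] \<kappa>[of j] by (intro powr_mono2) auto
    then show ?thesis by (simp add: powr_def mult.commute)
  qed
  have powr_int: "integrable M (\<lambda>\<omega>. \<bar>A \<omega>\<bar> powr \<kappa> j)"
    by (rule Bochner_Integration.integrable_bound[OF e_int]) (use powr_le in auto)
  have "expectation (\<lambda>\<omega>. \<bar>A \<omega>\<bar> powr \<kappa> j) \<le> expectation (\<lambda>\<omega>. exp (\<kappa> j * L \<omega>))"
    by (intro integral_mono powr_int e_int powr_le)
  also have "\<dots> < 1"
  proof -
    have "expectation (\<lambda>\<omega>. (exp (\<kappa> j * L \<omega>) - 1) / \<kappa> j) = (expectation (\<lambda>\<omega>. exp (\<kappa> j * L \<omega>)) - 1) / \<kappa> j"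
      using e_int by (simp add: prob_space)
    with j \<kappa>(1)[of j] show ?thesis by (simp add: divide_less_0_iff)
  qed
  finally show ?thesis using \<kappa>(1)[of j] powr_int unfolding A_def by blast
qed

section \<open>Expansion of the solution into past innovations\<close>

abbreviation "ytrunc \<equiv> truncated_solution \<mu> \<phi> b"

lemma eps_path_measurable: "(\<lambda>\<omega>. \<lambda>s\<in>J. \<epsilon> s \<omega>) \<in> measurable M (PiM J (\<lambda>_. borel))"
  by (rule measurable_restrict) simp

lemma ytrunc_measurable [measurable]: "(\<lambda>\<omega>. ytrunc m t (\<lambda>s. \<epsilon> s \<omega>)) \<in> borel_measurable M"
proof -
  have "(\<lambda>\<omega>. ytrunc m t (\<lambda>s\<in>UNIV. \<epsilon> s \<omega>)) \<in> borel_measurable M"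
    by (rule measurable_compose[OF eps_path_measurable truncated_solution_measurable]) auto
  then show ?thesis by (simp add: restrict_def)
qed

text \<open>Both sequences obey the same affine recursion, so their difference obeys the linear one;
  the approximation starts at \<open>0\<close>, which leaves the state \<open>Y (t - 2 m)\<close> as
  initial difference.\<close>

lemma solution_minus_truncation:
  "AE \<omega> in M. \<forall>t. Y t \<omega> - ytrunc m t (\<lambda>s. \<epsilon> s \<omega>) =
     (\<Prod>j<m. \<phi> + b * \<epsilon> (t - 1 - 2 * int j) \<omega>) * Y (t - 2 * int m) \<omega>"
proof -
  \<comment> \<open>The times are countable, so one null set serves them all; the induction moves
    \<open>t\<close>.\<close>
  have "AE \<omega> in M. \<forall>t. Y t \<omega> = \<mu> + \<phi> * Y (t - 2) \<omega> + b * Y (t - 2) \<omega> * \<epsilon> (t - 1) \<omega> + \<epsilon> t \<omega>"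
    using Y_rec by (simp add: AE_all_countable)
  then show ?thesis
  proof eventually_elim
    case (elim \<omega>)
    show ?case
    proof (induction m)
      case (Suc m)
      show ?case
      proof
        fix t
        have "Y t \<omega> - ytrunc (Suc m) t (\<lambda>s. \<epsilon> s \<omega>) =
            (\<phi> + b * \<epsilon> (t - 1) \<omega>) * (Y (t - 2) \<omega> - ytrunc m (t - 2) (\<lambda>s. \<epsilon> s \<omega>))"
          by (subst elim[rule_format, of t]) (simp add: algebra_simps)
        also have "\<dots> = (\<phi> + b * \<epsilon> (t - 1) \<omega>) *
            ((\<Prod>j<m. \<phi> + b * \<epsilon> (t - 2 - 1 - 2 * int j) \<omega>) * Y (t - 2 - 2 * int m) \<omega>)"
          using Suc.IH[rule_format, of "t - 2"] by simp
        also have "\<dots> = (\<Prod>j<Suc m. \<phi> + b * \<epsilon> (t - 1 - 2 * int j) \<omega>) * Y (t - 2 * int (Suc m)) \<omega>"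
          by (simp add: prod.lessThan_Suc_shift algebra_simps del: prod.lessThan_Suc)
        finally show "Y t \<omega> - ytrunc (Suc m) t (\<lambda>s. \<epsilon> s \<omega>) =
            (\<Prod>j<Suc m. \<phi> + b * \<epsilon> (t - 1 - 2 * int j) \<omega>) * Y (t - 2 * int (Suc m)) \<omega>" .
      qed
    qed simp
  qed
qed

text \<open>The factors use innovations at the distinct times \<open>t - 1, t - 3, ...\<close>, so
  they are independent and the expectation factorizes.\<close>

lemma coefficient_product_moment:
  assumes "integrable M (\<lambda>\<omega>. \<bar>\<phi> + b * \<epsilon> 1 \<omega>\<bar> powr \<kappa>)"
  shows "integrable M (\<lambda>\<omega>. \<Prod>j<m. \<bar>\<phi> + b * \<epsilon> (t - 1 - 2 * int j) \<omega>\<bar> powr \<kappa>)" (is ?I)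
    and "expectation (\<lambda>\<omega>. \<Prod>j<m. \<bar>\<phi> + b * \<epsilon> (t - 1 - 2 * int j) \<omega>\<bar> powr \<kappa>) =
      expectation (\<lambda>\<omega>. \<bar>\<phi> + b * \<epsilon> 1 \<omega>\<bar> powr \<kappa>) ^ m" (is ?E)
proof -
  define f where "f j = t - 1 - 2 * int j" for j
  define g where "g s \<omega> = \<bar>\<phi> + b * \<epsilon> s \<omega>\<bar> powr \<kappa>" for s \<omega>
  have reindex: "(\<Prod>j<m. h (f j)) = (\<Prod>s\<in>f ` {..<m}. h s)" for h :: "int \<Rightarrow> real"
    by (subst prod.reindex) (auto simp: inj_on_def f_def)
  have ind: "indep_vars (\<lambda>_. borel) g (f ` {..<m})"
    unfolding g_def
    by (rule indep_vars_compose2[where Y="\<lambda>_ x. \<bar>\<phi> + b * x\<bar> powr \<kappa>", OF indep_vars_subset[OF indep]]) auto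
  have int: "integrable M (g s)" for s
    using assms integrable_eps_iff[of "\<lambda>x. \<bar>\<phi> + b * x\<bar> powr \<kappa>" s 1] by (simp add: g_def[abs_def])
  have E: "expectation (g s) = expectation (g 1)" for s
    unfolding g_def by (rule expectation_eps_eq[of "\<lambda>x. \<bar>\<phi> + b * x\<bar> powr \<kappa>"]) simp
  have "integrable M (\<lambda>\<omega>. \<Prod>j<m. g (f j) \<omega>)"
    unfolding reindex[of "\<lambda>s. g s _"] by (rule indep_vars_integrable[OF _ ind int]) simp
  then show ?I by (simp add: f_def g_def)
  have "expectation (\<lambda>\<omega>. \<Prod>j<m. g (f j) \<omega>) = (\<Prod>s\<in>f ` {..<m}. expectation (g s))"
    unfolding reindex[of "\<lambda>s. g s _"] by (rule indep_vars_lebesgue_integral[OF _ ind int]) simp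
  also have "\<dots> = (\<Prod>j<m. expectation (g 1))"
    unfolding reindex[of "\<lambda>s. expectation (g s)", symmetric] by (intro prod.cong refl E)
  finally show ?E by (simp add: f_def g_def[abs_def])
qed

lemma Y_distr: "distr M borel (Y s) = distr M borel (Y t)"
proof -
  have st: "distr M (PiM {0} (\<lambda>_. borel)) (\<lambda>\<omega>. \<lambda>u\<in>{0}. Y (u + h) \<omega>) =
     distr M (PiM {0} (\<lambda>_. borel)) (\<lambda>\<omega>. \<lambda>u\<in>{0}. Y u \<omega>)" for h
    using solution by (simp add: stationary_solution_def strictly_stationary_def)
  have "distr M borel (Y h) = distr (distr M (PiM {0} (\<lambda>_. borel)) (\<lambda>\<omega>. \<lambda>u\<in>{0}. Y (u + h) \<omega>)) borel (\<lambda>f. f (0::int))" for h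
    by (subst distr_distr) (auto simp: o_def intro!: measurable_component_singleton)
  then have "distr M borel (Y h) = distr M borel (Y 0)" for h
    using st[of h] st[of 0] by metis
  from this[of s] this[of t] show ?thesis by simp
qed

text \<open>No moment of \<open>Y\<close> is at hand, but a single law on the line is tight and
  stationarity makes one \<open>R\<close> valid at all times.\<close>

lemma Y_tight:
  assumes "e > 0"
  shows "\<exists>R>0. \<forall>t. prob {\<omega>\<in>space M. \<bar>Y t \<omega>\<bar> > R} < e"
proof -
  let ?A = "\<lambda>k::nat. {\<omega>\<in>space M. \<bar>Y 0 \<omega>\<bar> > real k}"
  have "(\<lambda>k. prob (?A k)) \<longlonglongrightarrow> prob (\<Inter>k. ?A k)"
    by (rule finite_Lim_measure_decseq) (auto simp: decseq_def intro!: measurable_sets)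
  moreover have "(\<Inter>k. ?A k) = {}"
  proof -
    have "\<exists>k::nat. \<not> \<bar>Y 0 \<omega>\<bar> > real k" for \<omega>
      using real_arch_simple[of "\<bar>Y 0 \<omega>\<bar>"] by (auto simp: not_less)
    then show ?thesis by blast
  qed
  ultimately have "\<forall>\<^sub>F k in sequentially. prob (?A k) < e"
    using assms by (intro order_tendstoD) auto
  with eventually_gt_at_top[of 0] obtain k where k: "k > 0" "prob (?A k) < e"
    by (metis (no_types, lifting) eventually_conj eventually_happens trivial_limit_sequentially)
  have eq: "prob {\<omega>\<in>space M. \<bar>Y t \<omega>\<bar> > real k} = prob (?A k)" for t
  proof -
    have "prob {\<omega>\<in>space M. \<bar>Y s \<omega>\<bar> > real k} = measure (distr M borel (Y s)) {x. \<bar>x\<bar> > real k}" for s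
      by (subst measure_distr) (auto intro!: arg_cong[where f=prob])
    then show ?thesis using Y_distr[of t 0] by simp
  qed
  have "prob {\<omega>\<in>space M. \<bar>Y t \<omega>\<bar> > real k} < e" for t
    using k(2) unfolding eq[of t] .
  then show ?thesis using k(1) by (intro exI[of _ "real k"]) auto
qed

text \<open>If the initial state is at most \<open>R\<close>, an error above \<open>d\<close> forces
  the coefficient product to at least \<open>d / R\<close>; its moment of order \<kappa> is
  \<open>\<rho> ^ m\<close>, so Markov's inequality gives a bound independent of
  \<open>t\<close>.\<close>

lemma truncation_converges:
  assumes "d > 0" "e > 0"
  shows "\<exists>m0. \<forall>m\<ge>m0. \<forall>t. prob {\<omega>\<in>space M. \<bar>Y t \<omega> - ytrunc m t (\<lambda>s. \<epsilon> s \<omega>)\<bar> > d} \<le> e"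
proof -
  obtain R where R: "R > 0" "\<And>t. prob {\<omega>\<in>space M. \<bar>Y t \<omega>\<bar> > R} < e / 2"
    using Y_tight[of "e / 2"] assms by auto
  obtain \<kappa> where \<kappa>: "\<kappa> > 0" "integrable M (\<lambda>\<omega>. \<bar>\<phi> + b * \<epsilon> 1 \<omega>\<bar> powr \<kappa>)"
    "expectation (\<lambda>\<omega>. \<bar>\<phi> + b * \<epsilon> 1 \<omega>\<bar> powr \<kappa>) < 1"
    using coefficient_moment by auto
  define \<rho> where "\<rho> = expectation (\<lambda>\<omega>. \<bar>\<phi> + b * \<epsilon> 1 \<omega>\<bar> powr \<kappa>)"
  have \<rho>: "0 \<le> \<rho>" "\<rho> < 1" using \<kappa>(3) by (auto simp: \<rho>_def)
  define c where "c = (d / R) powr \<kappa>"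
  have c: "c > 0" using assms R by (simp add: c_def)
  have "(\<lambda>m. \<rho> ^ m / c) \<longlonglongrightarrow> 0 / c"
    using \<rho> c by (intro tendsto_intros LIMSEQ_power_zero) auto
  then have "\<forall>\<^sub>F m in sequentially. \<rho> ^ m / c < e / 2"
    using assms by (intro order_tendstoD) auto
  then obtain m0 where m0: "\<And>m. m \<ge> m0 \<Longrightarrow> \<rho> ^ m / c < e / 2"
    by (auto simp: eventually_sequentially)
  have "prob {\<omega>\<in>space M. \<bar>Y t \<omega> - ytrunc m t (\<lambda>s. \<epsilon> s \<omega>)\<bar> > d} \<le> e" if "m \<ge> m0" for m t
  proof -
    define P where "P \<omega> = (\<Prod>j<m. \<bar>\<phi> + b * \<epsilon> (t - 1 - 2 * int j) \<omega>\<bar> powr \<kappa>)" for \<omega>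
    have P_meas [measurable]: "P \<in> borel_measurable M" unfolding P_def by measurable
    have P_nonneg: "P \<omega> \<ge> 0" for \<omega> unfolding P_def by (simp add: prod_nonneg)
    have P: "integrable M P" "expectation P = \<rho> ^ m"
      using coefficient_product_moment[OF \<kappa>(2), of t m] by (simp_all add: P_def[abs_def] \<rho>_def)
    have "prob {\<omega>\<in>space M. \<bar>Y t \<omega> - ytrunc m t (\<lambda>s. \<epsilon> s \<omega>)\<bar> > d} \<le>
        prob ({\<omega>\<in>space M. \<bar>Y (t - 2 * int m) \<omega>\<bar> > R} \<union> {\<omega>\<in>space M. P \<omega> \<ge> c})"
    proof (rule finite_measure_mono_AE)
      show "AE \<omega> in M. \<omega> \<in> {\<omega>\<in>space M. \<bar>Y t \<omega> - ytrunc m t (\<lambda>s. \<epsilon> s \<omega>)\<bar> > d} \<longrightarrow>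
         \<omega> \<in> {\<omega>\<in>space M. \<bar>Y (t - 2 * int m) \<omega>\<bar> > R} \<union> {\<omega>\<in>space M. P \<omega> \<ge> c}"
        using solution_minus_truncation[of m]
      proof eventually_elim
        case (elim \<omega>)
        let ?p = "\<bar>\<Prod>j<m. \<phi> + b * \<epsilon> (t - 1 - 2 * int j) \<omega>\<bar>" and ?y = "\<bar>Y (t - 2 * int m) \<omega>\<bar>"
        have "P \<omega> = ?p powr \<kappa>"
          unfolding P_def by (simp add: abs_prod prod_powr_distrib[symmetric])
        moreover have "d / R \<le> ?p" if "d < ?p * ?y" "?y \<le> R"
        proof -
          have "?p * ?y \<le> ?p * R" using that by (intro mult_left_mono) auto
          with that(1) R show ?thesis by (simp add: divide_le_eq)
        qed
        ultimately have "c \<le> P \<omega>" if "d < ?p * ?y" "?y \<le> R"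
          using that assms R \<kappa>(1) by (auto simp: c_def intro!: powr_mono2)
        then show ?case using elim by (cases "?y \<le> R") (auto simp: abs_mult)
      qed
    qed measurable
    also have "\<dots> \<le> prob {\<omega>\<in>space M. \<bar>Y (t - 2 * int m) \<omega>\<bar> > R} + prob {\<omega>\<in>space M. P \<omega> \<ge> c}"
      by (rule measure_Un_le) auto
    also have "prob {\<omega>\<in>space M. P \<omega> \<ge> c} \<le> expectation P / c"
      by (rule integral_Markov_inequality_measure[where A="{}"]) (use P(1) c P_nonneg in auto)
    finally show ?thesis using R(2)[of "t - 2 * int m"] m0[OF that] unfolding P(2) by linarith
  qed
  then show ?thesis by blast
qed

section \<open>Windows of the path as an approximately independent process\<close>

text \<open>The two scores entering the \<open>t\<close>-th summand depend on the path through the pairs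
  \<open>(Y t, Y (t - 2))\<close> and \<open>(Y (t - 1), Y (t - 3))\<close>.\<close>

definition window :: "int \<Rightarrow> 'a \<Rightarrow> (real \<times> real) \<times> (real \<times> real)" where
  "window t \<omega> = ((Y t \<omega>, Y (t - 2) \<omega>), (Y (t - 1) \<omega>, Y (t - 3) \<omega>))"

definition truncated_window :: "nat \<Rightarrow> int \<Rightarrow> (int \<Rightarrow> real) \<Rightarrow> (real \<times> real) \<times> (real \<times> real)" where
  "truncated_window m t e =
     ((ytrunc m t e, ytrunc m (t - 2) e), (ytrunc m (t - 1) e, ytrunc m (t - 3) e))"

lemma truncated_window_measurable:
  assumes "{t - 3 - 2 * int m..t} \<subseteq> J"
  shows "(\<lambda>e. truncated_window m t e) \<in> borel_measurable (PiM J (\<lambda>_. borel))"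
proof -
  have [measurable]: "(\<lambda>e. ytrunc m s e) \<in> borel_measurable (PiM J (\<lambda>_. borel))" if "s \<in> {t-3..t}" for s
    by (rule truncated_solution_measurable) (use that assms in auto)
  show ?thesis unfolding truncated_window_def by measurable
qed

lemma truncated_window_cong:
  assumes eq: "\<And>s. t - 3 - 2 * int m \<le> s \<Longrightarrow> s \<le> t \<Longrightarrow> e s = e' s"
  shows "truncated_window m t e = truncated_window m t e'"
  unfolding truncated_window_def
  by (intro arg_cong2[where f=Pair] truncated_solution_cong; rule eq; linarith)

lemma window_measurable [measurable]: "window t \<in> borel_measurable M"
  unfolding window_def[abs_def] by measurable

text \<open>The four approximated coordinates use innovations from \<open>t - 3 - 2 m\<close> to
  \<open>t\<close> only, which fixes the range \<open>3 + 2 m\<close> of dependence. Equality of the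
  window laws is stationarity of the path at the four times \<open>0, -1, -2, -3\<close>.\<close>

lemma window_process:
  "approx_indep_process M window (\<lambda>m t \<omega>. truncated_window m t (\<lambda>s. \<epsilon> s \<omega>))"
proof unfold_locales
  have restr: "truncated_window m t (\<lambda>s. \<epsilon> s \<omega>) = truncated_window m t (\<lambda>s\<in>{t - 3 - 2 * int m..t}. \<epsilon> s \<omega>)" for m t \<omega>
    by (rule truncated_window_cong) auto
  show "window t \<in> borel_measurable M" for t by measurable
  show meas: "(\<lambda>\<omega>. truncated_window m t (\<lambda>s. \<epsilon> s \<omega>)) \<in> borel_measurable M" for m t
    unfolding restr by (rule measurable_compose[OF eps_path_measurable truncated_window_measurable]) auto
  show "distr M borel (window s) = distr M borel (window t)" for s t
  proof -
    let ?J = "{0, -1, -2, -3 :: int}"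
    let ?F = "\<lambda>f. ((f 0, f (-2)), (f (-1), f (-3))) :: (real \<times> real) \<times> (real \<times> real)"
    have st: "distr M (PiM ?J (\<lambda>_. borel)) (\<lambda>\<omega>. \<lambda>u\<in>?J. Y (u + h) \<omega>) =
       distr M (PiM ?J (\<lambda>_. borel)) (\<lambda>\<omega>. \<lambda>u\<in>?J. Y u \<omega>)" for h
    proof -
      have "strictly_stationary M Y" using solution by (simp add: stationary_solution_def)
      note st = this[unfolded strictly_stationary_def, THEN conjunct2, rule_format]
      show ?thesis by (rule st) simp
    qed
    have F: "?F \<in> borel_measurable (PiM ?J (\<lambda>_. borel))"
    proof -
      have [measurable]: "(\<lambda>f. f u) \<in> borel_measurable (PiM ?J (\<lambda>_. borel))" if "u \<in> ?J" for u :: int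
        by (rule measurable_component_singleton) (rule that)
      show ?thesis by measurable
    qed
    have "distr M borel (window h) = distr (distr M (PiM ?J (\<lambda>_. borel)) (\<lambda>\<omega>. \<lambda>u\<in>?J. Y (u + h) \<omega>)) borel ?F" for h
    proof -
      have "(\<lambda>\<omega>. \<lambda>u\<in>?J. Y (u + h) \<omega>) \<in> measurable M (PiM ?J (\<lambda>_. borel))"
        by (rule measurable_restrict) simp
      from distr_distr[OF F this] show ?thesis by (simp add: o_def window_def[abs_def] add.commute)
    qed
    then have "distr M borel (window h) = distr (distr M (PiM ?J (\<lambda>_. borel)) (\<lambda>\<omega>. \<lambda>u\<in>?J. Y u \<omega>)) borel ?F" for h
      unfolding st .
    from this[of s] this[of t] show ?thesis by simp
  qed
  show "\<exists>q\<ge>0. \<forall>s t. s + q < t \<longrightarrow>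
     indep_var borel (\<lambda>\<omega>. truncated_window m s (\<lambda>s. \<epsilon> s \<omega>)) borel (\<lambda>\<omega>. truncated_window m t (\<lambda>s. \<epsilon> s \<omega>))" for m
  proof (intro exI[of _ "3 + 2 * int m"] conjI allI impI)
    fix s t :: int assume st: "s + (3 + 2 * int m) < t"
    show "indep_var borel (\<lambda>\<omega>. truncated_window m s (\<lambda>s. \<epsilon> s \<omega>)) borel (\<lambda>\<omega>. truncated_window m t (\<lambda>s. \<epsilon> s \<omega>))"
      unfolding restr
      by (rule indep_var_compose[OF indep_var_restrict[OF indep], unfolded o_def])
        (use st in \<open>auto intro: truncated_window_measurable\<close>)
  qed simp
  show "\<exists>m. \<forall>t. prob {\<omega>\<in>space M. dist (window t \<omega>) (truncated_window m t (\<lambda>s. \<epsilon> s \<omega>)) > d} \<le> e"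
    if "d > 0" "e > 0" for d e
  proof -
    \<comment> \<open>The errors \<open>d\<close> and \<open>e\<close> are divided equally among the
      four coordinates of a window.\<close>
    obtain m where m: "\<And>t. prob {\<omega>\<in>space M. \<bar>Y t \<omega> - ytrunc m t (\<lambda>s. \<epsilon> s \<omega>)\<bar> > d / 4} \<le> e / 4"
      using truncation_converges[of "d / 4" "e / 4"] \<open>d > 0\<close> \<open>e > 0\<close> by auto
    define B where "B s = {\<omega>\<in>space M. \<bar>Y s \<omega> - ytrunc m s (\<lambda>s. \<epsilon> s \<omega>)\<bar> > d / 4}" for s
    have B [measurable]: "B s \<in> sets M" for s unfolding B_def by measurable
    have "prob {\<omega>\<in>space M. dist (window t \<omega>) (truncated_window m t (\<lambda>s. \<epsilon> s \<omega>)) > d} \<le> e" for t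
    proof -
      let ?D = "\<lambda>s \<omega>. \<bar>Y s \<omega> - ytrunc m s (\<lambda>s. \<epsilon> s \<omega>)\<bar>"
      have "dist (window t \<omega>) (truncated_window m t (\<lambda>s. \<epsilon> s \<omega>)) \<le>
         (?D t \<omega> + ?D (t - 2) \<omega>) + (?D (t - 1) \<omega> + ?D (t - 3) \<omega>)" for \<omega>
        unfolding window_def truncated_window_def
        by (intro order_trans[OF dist_pair_le_sum] add_mono) (simp_all add: dist_real_def)
      then have "{\<omega>\<in>space M. dist (window t \<omega>) (truncated_window m t (\<lambda>s. \<epsilon> s \<omega>)) > d} \<subseteq>
          (\<Union>s\<in>{t-3..t}. B s)"
      proof (intro subsetI, elim CollectE conjE)
        fix \<omega> assume "\<omega> \<in> space M" and "d < dist (window t \<omega>) (truncated_window m t (\<lambda>s. \<epsilon> s \<omega>))"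
        moreover have "dist (window t \<omega>) (truncated_window m t (\<lambda>s. \<epsilon> s \<omega>)) \<le>
         (?D t \<omega> + ?D (t - 2) \<omega>) + (?D (t - 1) \<omega> + ?D (t - 3) \<omega>)" by fact
        ultimately have "\<omega> \<in> B t \<or> \<omega> \<in> B (t - 2) \<or> \<omega> \<in> B (t - 1) \<or> \<omega> \<in> B (t - 3)"
          unfolding B_def by (simp only: mem_Collect_eq) argo
        then show "\<omega> \<in> (\<Union>s\<in>{t-3..t}. B s)" by auto
      qed
      then have "prob {\<omega>\<in>space M. dist (window t \<omega>) (truncated_window m t (\<lambda>s. \<epsilon> s \<omega>)) > d} \<le> prob (\<Union>s\<in>{t-3..t}. B s)"
        by (rule finite_measure_mono) auto
      also have "\<dots> \<le> (\<Sum>s\<in>{t-3..t}. prob (B s))" by (rule measure_UNION_le) auto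
      also have "\<dots> \<le> (\<Sum>s\<in>{t-3..t}. e / 4)" unfolding B_def by (intro sum_mono m)
      finally show ?thesis by simp
    qed
    then show ?thesis by blast
  qed
qed

text \<open>Convergence in probability is convergence in mean of the distance capped at
  \<open>1\<close>, for which a subsequence converges almost surely; the limit along that
  subsequence is the function sought.\<close>

lemma solution_causal:
  "\<exists>F\<in>borel_measurable (PiM {..t} (\<lambda>_. borel)). AE \<omega> in M. Y t \<omega> = F (\<lambda>s\<in>{..t}. \<epsilon> s \<omega>)"
proof -
  have restr: "ytrunc m t (\<lambda>s. \<epsilon> s \<omega>) = ytrunc m t (\<lambda>s\<in>{..t}. \<epsilon> s \<omega>)" for m \<omega>
    by (rule truncated_solution_cong) auto
  define u where "u m \<omega> = min 1 \<bar>Y t \<omega> - ytrunc m t (\<lambda>s. \<epsilon> s \<omega>)\<bar>" for m \<omega>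
  have u: "0 \<le> u m \<omega>" "u m \<omega> \<le> 1" for m \<omega> by (auto simp: u_def)
  have u_int: "integrable M (u m)" for m
    by (rule integrable_const_bound[of _ 1]) (use u in \<open>auto simp: u_def[abs_def]\<close>)
  have "(\<lambda>m. expectation (u m)) \<longlonglongrightarrow> 0"
  proof (rule LIMSEQ_I)
    fix e :: real assume "e > 0"
    then obtain m0 where m0: "\<And>m. m \<ge> m0 \<Longrightarrow> prob {\<omega>\<in>space M. \<bar>Y t \<omega> - ytrunc m t (\<lambda>s. \<epsilon> s \<omega>)\<bar> > e / 4} \<le> e / 4"
      using truncation_converges[of "e / 4" "e / 4"] by auto
    have "norm (expectation (u m) - 0) < e" if "m \<ge> m0" for m
    proof -
      let ?S = "{\<omega>\<in>space M. \<bar>Y t \<omega> - ytrunc m t (\<lambda>s. \<epsilon> s \<omega>)\<bar> > e / 4}"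
      have "expectation (u m) \<le> expectation (\<lambda>\<omega>. e / 4 + indicator ?S \<omega>)"
      proof (intro integral_mono u_int)
        fix \<omega> assume "\<omega> \<in> space M"
        then show "u m \<omega> \<le> e / 4 + indicator ?S \<omega>"
          using \<open>e > 0\<close> by (auto simp: u_def indicator_def not_less min_le_iff_disj)
      qed (auto simp: emeasure_eq_measure intro!: integrable_real_indicator Bochner_Integration.integrable_add)
      also have "\<dots> = e / 4 + prob ?S"
        by (subst Bochner_Integration.integral_add)
          (auto simp: prob_space emeasure_eq_measure intro!: integrable_real_indicator)
      also have "\<dots> < e" using m0[OF that] \<open>e > 0\<close> by simp
      finally show ?thesis using u by (simp add: integral_nonneg_AE)
    qed
    then show "\<exists>m0. \<forall>m\<ge>m0. norm (expectation (u m) - 0) < e" by blast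
  qed
  then have "(\<lambda>m. \<integral>\<omega>. norm (u m \<omega>) \<partial>M) \<longlonglongrightarrow> 0" using u by simp
  from tendsto_L1_AE_subseq[OF u_int this]
  obtain r where r: "AE \<omega> in M. (\<lambda>m. u (r m) \<omega>) \<longlonglongrightarrow> 0" by auto
  \<comment> \<open>\<open>lim\<close> has a value even where the sequence diverges, so
    \<open>F\<close> is measurable on the whole space; its values matter only almost surely.\<close>
  define F where "F e = lim (\<lambda>m. ytrunc (r m) t e)" for e
  have "F \<in> borel_measurable (PiM {..t} (\<lambda>_. borel))"
    unfolding F_def by (intro borel_measurable_lim_metric truncated_solution_measurable) auto
  moreover have "AE \<omega> in M. Y t \<omega> = F (\<lambda>s\<in>{..t}. \<epsilon> s \<omega>)"
    using r
  proof eventually_elim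
    case (elim \<omega>)
    have "(\<lambda>m. \<bar>Y t \<omega> - ytrunc (r m) t (\<lambda>s. \<epsilon> s \<omega>)\<bar>) \<longlonglongrightarrow> 0"
    proof (rule Lim_transform_eventually[OF elim])
      have "\<forall>\<^sub>F m in sequentially. u (r m) \<omega> < 1" using elim by (rule order_tendstoD) simp
      then show "\<forall>\<^sub>F m in sequentially. u (r m) \<omega> = \<bar>Y t \<omega> - ytrunc (r m) t (\<lambda>s. \<epsilon> s \<omega>)\<bar>"
        by eventually_elim (auto simp: u_def min_def split: if_splits)
    qed
    then have "(\<lambda>m. Y t \<omega> - ytrunc (r m) t (\<lambda>s. \<epsilon> s \<omega>)) \<longlonglongrightarrow> 0"
      by (simp add: tendsto_rabs_zero_iff)
    then have "(\<lambda>m. Y t \<omega> - (Y t \<omega> - ytrunc (r m) t (\<lambda>s. \<epsilon> s \<omega>))) \<longlonglongrightarrow> Y t \<omega> - 0"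
      by (intro tendsto_intros)
    then have "(\<lambda>m. ytrunc (r m) t (\<lambda>s\<in>{..t}. \<epsilon> s \<omega>)) \<longlonglongrightarrow> Y t \<omega>"
      by (simp add: restr)
    then show ?case unfolding F_def by (simp add: limI)
  qed
  ultimately show ?thesis by blast
qed

lemma innovations_distr:
  "distr M (borel \<Otimes>\<^sub>M borel) (\<lambda>\<omega>. (\<epsilon> (t - 1) \<omega>, \<epsilon> t \<omega>)) =
     distr M borel (\<epsilon> 1) \<Otimes>\<^sub>M distr M borel (\<epsilon> 1)"
proof -
  have comp: "(\<lambda>f. f u) \<in> borel_measurable (PiM J (\<lambda>_. borel))" if "u \<in> J" for u :: int and J
    by (rule measurable_component_singleton) (rule that)
  have "distr M (borel \<Otimes>\<^sub>M borel) (\<lambda>\<omega>. ((\<lambda>f. f (t - 1)) (\<lambda>s\<in>{t - 1}. \<epsilon> s \<omega>), (\<lambda>f. f t) (\<lambda>s\<in>{t}. \<epsilon> s \<omega>))) =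
      distr M borel (\<lambda>\<omega>. (\<lambda>f. f (t - 1)) (\<lambda>s\<in>{t - 1}. \<epsilon> s \<omega>)) \<Otimes>\<^sub>M distr M borel (\<lambda>\<omega>. (\<lambda>f. f t) (\<lambda>s\<in>{t}. \<epsilon> s \<omega>))"
    by (rule indep_var_pair_distr[OF indep_var_restrict[OF indep]]) (auto intro!: comp)
  then have "distr M (borel \<Otimes>\<^sub>M borel) (\<lambda>\<omega>. (\<epsilon> (t - 1) \<omega>, \<epsilon> t \<omega>)) =
      distr M borel (\<epsilon> (t - 1)) \<Otimes>\<^sub>M distr M borel (\<epsilon> t)"
    by simp
  then show ?thesis unfolding ident[of "t - 1" 1] ident[of t 1] .
qed

text \<open>A stationary solution is not independent of later innovations by definition.
  Independence is obtained by replacing the state by its causal version, a function of a block of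
  innovations disjoint from the next two.\<close>

lemma state_innovations_distr:
  "distr M (borel \<Otimes>\<^sub>M (borel \<Otimes>\<^sub>M borel)) (\<lambda>\<omega>. (Y (t - 2) \<omega>, \<epsilon> (t - 1) \<omega>, \<epsilon> t \<omega>)) =
     distr M borel (Y (t - 2)) \<Otimes>\<^sub>M (distr M borel (\<epsilon> 1) \<Otimes>\<^sub>M distr M borel (\<epsilon> 1))"
proof -
  obtain F where F [measurable]: "F \<in> borel_measurable (PiM {..t - 2} (\<lambda>_. borel))"
    and YF: "AE \<omega> in M. Y (t - 2) \<omega> = F (\<lambda>s\<in>{..t - 2}. \<epsilon> s \<omega>)"
    using solution_causal[of "t - 2"] by auto
  let ?X = "\<lambda>\<omega>. F (\<lambda>s\<in>{..t - 2}. \<epsilon> s \<omega>)"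
  have X [measurable]: "?X \<in> borel_measurable M"
    by (rule measurable_compose[OF eps_path_measurable F])
  have comp: "(\<lambda>f. f u) \<in> borel_measurable (PiM J (\<lambda>_. borel))" if "u \<in> J" for u :: int and J
    by (rule measurable_component_singleton) (rule that)
  have "distr M (borel \<Otimes>\<^sub>M (borel \<Otimes>\<^sub>M borel)) (\<lambda>\<omega>. (?X \<omega>, (\<lambda>f. (f (t - 1), f t)) (\<lambda>s\<in>{t - 1, t}. \<epsilon> s \<omega>))) =
      distr M borel ?X \<Otimes>\<^sub>M distr M (borel \<Otimes>\<^sub>M borel) (\<lambda>\<omega>. (\<lambda>f. (f (t - 1), f t)) (\<lambda>s\<in>{t - 1, t}. \<epsilon> s \<omega>))"
    by (rule indep_var_pair_distr[OF indep_var_restrict[OF indep]])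
      (auto intro!: measurable_Pair comp)
  then have 1: "distr M (borel \<Otimes>\<^sub>M (borel \<Otimes>\<^sub>M borel)) (\<lambda>\<omega>. (?X \<omega>, \<epsilon> (t - 1) \<omega>, \<epsilon> t \<omega>)) =
      distr M borel ?X \<Otimes>\<^sub>M distr M (borel \<Otimes>\<^sub>M borel) (\<lambda>\<omega>. (\<epsilon> (t - 1) \<omega>, \<epsilon> t \<omega>))"
    by simp
  have 3: "distr M borel ?X = distr M borel (Y (t - 2))"
    by (rule distr_cong_AE) (use YF in auto)
  have "distr M (borel \<Otimes>\<^sub>M (borel \<Otimes>\<^sub>M borel)) (\<lambda>\<omega>. (?X \<omega>, \<epsilon> (t - 1) \<omega>, \<epsilon> t \<omega>)) =
      distr M (borel \<Otimes>\<^sub>M (borel \<Otimes>\<^sub>M borel)) (\<lambda>\<omega>. (Y (t - 2) \<omega>, \<epsilon> (t - 1) \<omega>, \<epsilon> t \<omega>))"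
    by (rule distr_cong_AE) (use YF in auto)
  with 1 show ?thesis unfolding 3 innovations_distr by simp
qed

end

section \<open>Identification\<close>

context rca_model
begin

section \<open>Integration over the next two innovations\<close>

abbreviation "innov \<equiv> distr M borel (\<epsilon> 1)"

lemma prob_space_innov: "prob_space innov"
  by (rule prob_space_distr) simp

lemma prob_space_state: "prob_space (distr M borel (Y t))"
  by (rule prob_space_distr) simp

lemma innov_integrable: "k \<le> 4 \<Longrightarrow> integrable innov (\<lambda>u. u ^ k)"
  using eps_moments_integrable[of k 1] by (simp add: integrable_distr_eq)

lemma innov_mean: "(\<integral>u. u \<partial>innov) = 0"
  using eps_mean[of 1] by (simp add: integral_distr)

lemma innov_var: "(\<integral>u. u\<^sup>2 \<partial>innov) = \<sigma>\<^sup>2"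
  using eps_var[of 1] by (simp add: integral_distr)

lemma innov_quadratic: "(\<integral>u. (m + c * u)\<^sup>2 \<partial>innov) = m\<^sup>2 + c\<^sup>2 * \<sigma>\<^sup>2"
proof -
  interpret R: prob_space innov by (rule prob_space_innov)
  have i: "integrable innov (\<lambda>u. u)" "integrable innov (\<lambda>u. u\<^sup>2)"
    using innov_integrable[of 1] innov_integrable[of 2] by simp_all
  have "(\<integral>u. (m + c * u)\<^sup>2 \<partial>innov) = (\<integral>u. m\<^sup>2 + (2 * m * c) * u + c\<^sup>2 * u\<^sup>2 \<partial>innov)"
    by (intro arg_cong[where f="integral\<^sup>L innov"] ext) (simp add: power2_eq_square algebra_simps)
  also have "\<dots> = m\<^sup>2 + (2 * m * c) * (\<integral>u. u \<partial>innov) + c\<^sup>2 * (\<integral>u. u\<^sup>2 \<partial>innov)"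
    using i R.prob_space by simp
  finally show ?thesis by (simp add: innov_mean innov_var)
qed

lemma innov_pair_quadratic:
  "integrable (innov \<Otimes>\<^sub>M innov) (\<lambda>p. (m + c * fst p + snd p)\<^sup>2)" (is ?I)
  "(\<integral>p. (m + c * fst p + snd p)\<^sup>2 \<partial>(innov \<Otimes>\<^sub>M innov)) = m\<^sup>2 + c\<^sup>2 * \<sigma>\<^sup>2 + \<sigma>\<^sup>2" (is ?E)
proof -
  interpret R: prob_space innov by (rule prob_space_innov)
  interpret RR: pair_sigma_finite innov innov ..
  have three: "(a + b' + d)\<^sup>2 \<le> 3 * (a\<^sup>2 + b'\<^sup>2 + d\<^sup>2)" for a b' d :: real
    using zero_le_power2[of "a - b'"] zero_le_power2[of "a - d"] zero_le_power2[of "b' - d"]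
    by (simp add: power2_eq_square algebra_simps)
  have "integrable M (\<lambda>\<omega>. (m + c * \<epsilon> 0 \<omega> + \<epsilon> 1 \<omega>)\<^sup>2)"
  proof (rule Bochner_Integration.integrable_bound)
    show "integrable M (\<lambda>\<omega>. 3 * (m\<^sup>2 + c\<^sup>2 * (\<epsilon> 0 \<omega>)\<^sup>2 + (\<epsilon> 1 \<omega>)\<^sup>2))"
      using eps_moments_integrable[of 2] by simp
    show "AE \<omega> in M. norm ((m + c * \<epsilon> 0 \<omega> + \<epsilon> 1 \<omega>)\<^sup>2) \<le> norm (3 * (m\<^sup>2 + c\<^sup>2 * (\<epsilon> 0 \<omega>)\<^sup>2 + (\<epsilon> 1 \<omega>)\<^sup>2))"
      using three[of m "c * \<epsilon> 0 _"] by (intro AE_I2) (simp add: power_mult_distrib)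
  qed simp
  then have "integrable (distr M (borel \<Otimes>\<^sub>M borel) (\<lambda>\<omega>. (\<epsilon> (1 - 1) \<omega>, \<epsilon> 1 \<omega>))) (\<lambda>p. (m + c * fst p + snd p)\<^sup>2)"
    by (subst integrable_distr_eq) auto
  then show I: ?I unfolding innovations_distr .
  have "(\<integral>p. (m + c * fst p + snd p)\<^sup>2 \<partial>(innov \<Otimes>\<^sub>M innov)) = (\<integral>e. (\<integral>u. (m + c * e + 1 * u)\<^sup>2 \<partial>innov) \<partial>innov)"
    using RR.integral_fst'[OF I] by simp
  also have "\<dots> = (\<integral>e. (m + c * e)\<^sup>2 + \<sigma>\<^sup>2 \<partial>innov)"
    unfolding innov_quadratic by simp
  also have "\<dots> = (\<integral>e. (m + c * e)\<^sup>2 \<partial>innov) + \<sigma>\<^sup>2"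
  proof -
    have "(\<lambda>e. (m + c * e)\<^sup>2) = (\<lambda>e. m\<^sup>2 + (2 * m * c) * e + c\<^sup>2 * e\<^sup>2)"
      by (simp add: fun_eq_iff power2_eq_square algebra_simps)
    then have "integrable innov (\<lambda>e. (m + c * e)\<^sup>2)"
      using innov_integrable[of 1] innov_integrable[of 2] by simp
    then show ?thesis using R.prob_space by simp
  qed
  finally show ?E by (simp add: innov_quadratic)
qed

text \<open>Conditioning on the state in the form of Fubini's theorem: by
  \<open>state_innovations_distr\<close> the state and the next two innovations have a product
  law.\<close>

lemma one_step_law:
  fixes f :: "real \<times> real \<Rightarrow> real"
  assumes f [measurable]: "f \<in> borel_measurable borel" and int: "integrable M (\<lambda>\<omega>. f (Y t \<omega>, Y (t - 2) \<omega>))"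
  defines "I \<equiv> \<lambda>x. \<integral>p. f (\<mu> + \<phi> * x + b * x * fst p + snd p, x) \<partial>(innov \<Otimes>\<^sub>M innov)"
  shows "integrable (distr M borel (Y (t - 2))) I"
    "expectation (\<lambda>\<omega>. f (Y t \<omega>, Y (t - 2) \<omega>)) = integral\<^sup>L (distr M borel (Y (t - 2))) I"
proof -
  let ?\<nu> = "distr M borel (Y (t - 2))"
  interpret N: prob_space ?\<nu> by (rule prob_space_state)
  interpret R: prob_space innov by (rule prob_space_innov)
  interpret RR: pair_prob_space innov innov ..
  interpret P: pair_sigma_finite ?\<nu> "innov \<Otimes>\<^sub>M innov" ..
  define F where "F q = f (\<mu> + \<phi> * fst q + b * fst q * fst (snd q) + snd (snd q), fst q)" for q
  have f' [measurable]: "f \<in> borel_measurable (borel \<Otimes>\<^sub>M borel)" using f unfolding borel_prod .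
  have F_meas [measurable]: "F \<in> borel_measurable (borel \<Otimes>\<^sub>M (borel \<Otimes>\<^sub>M borel))"
    unfolding F_def by measurable
  have Y: "AE \<omega> in M. f (Y t \<omega>, Y (t - 2) \<omega>) = F (Y (t - 2) \<omega>, \<epsilon> (t - 1) \<omega>, \<epsilon> t \<omega>)"
    using Y_rec[of t] by eventually_elim (simp add: F_def mult_ac)
  have [measurable]: "(\<lambda>\<omega>. f (Y t \<omega>, Y (t - 2) \<omega>)) \<in> borel_measurable M" by measurable
  have "integrable M (\<lambda>\<omega>. F (Y (t - 2) \<omega>, \<epsilon> (t - 1) \<omega>, \<epsilon> t \<omega>))"
    by (rule Bochner_Integration.integrable_cong_AE_imp[OF int]) (use Y in auto)
  then have i: "integrable (?\<nu> \<Otimes>\<^sub>M (innov \<Otimes>\<^sub>M innov)) F"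
    unfolding state_innovations_distr[symmetric] by (subst integrable_distr_eq) auto
  have I: "I = (\<lambda>x. \<integral>p. F (x, p) \<partial>(innov \<Otimes>\<^sub>M innov))"
    by (simp add: I_def F_def)
  show "integrable ?\<nu> I" unfolding I by (rule P.integrable_fst'[OF i])
  have "expectation (\<lambda>\<omega>. f (Y t \<omega>, Y (t - 2) \<omega>)) = expectation (\<lambda>\<omega>. F (Y (t - 2) \<omega>, \<epsilon> (t - 1) \<omega>, \<epsilon> t \<omega>))"
    by (rule integral_cong_AE) (use Y in auto)
  also have "\<dots> = integral\<^sup>L (?\<nu> \<Otimes>\<^sub>M (innov \<Otimes>\<^sub>M innov)) F"
    unfolding state_innovations_distr[symmetric] by (subst integral_distr) auto
  also have "\<dots> = integral\<^sup>L ?\<nu> I" unfolding I by (rule P.integral_fst'[OF i, symmetric])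
  finally show "expectation (\<lambda>\<omega>. f (Y t \<omega>, Y (t - 2) \<omega>)) = integral\<^sup>L ?\<nu> I" .
qed

text \<open>The identity integrated gives \<open>k\<close>; integrated after multiplication by
  \<open>u\<close> it gives \<open>m\<close>, since the multiples of \<open>u\<close> have mean
  zero. So the shift is determined by the innovation law alone.\<close>

lemma innov_shifted_square_const:
  assumes "AE u in innov. (m + u)\<^sup>2 = k"
  shows "m\<^sup>2 + \<sigma>\<^sup>2 = k" "m = - (\<integral>u. u ^ 3 \<partial>innov) / (2 * \<sigma>\<^sup>2)"
proof -
  interpret R: prob_space innov by (rule prob_space_innov)
  have i: "integrable innov (\<lambda>u. u)" "integrable innov (\<lambda>u. u\<^sup>2)" "integrable innov (\<lambda>u. u ^ 3)"
    using innov_integrable[of 1] innov_integrable[of 2] innov_integrable[of 3] by simp_all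
  have "(\<integral>u. (m + 1 * u)\<^sup>2 \<partial>innov) = (\<integral>u. k \<partial>innov)"
    by (rule integral_cong_AE) (use assms in auto)
  then show k: "m\<^sup>2 + \<sigma>\<^sup>2 = k" unfolding innov_quadratic using R.prob_space by simp
  have "(\<integral>u. m\<^sup>2 * u + 2 * m * u\<^sup>2 + u ^ 3 \<partial>innov) = (\<integral>u. k * u \<partial>innov)"
  proof (rule integral_cong_AE)
    show "AE u in innov. m\<^sup>2 * u + 2 * m * u\<^sup>2 + u ^ 3 = k * u"
      using assms
    proof eventually_elim
      case (elim u)
      have "m\<^sup>2 * u + 2 * m * u\<^sup>2 + u ^ 3 = (m + u)\<^sup>2 * u"
        by (simp add: power2_eq_square power3_eq_cube algebra_simps)
      then show ?case unfolding elim .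
    qed
  qed auto
  then have "2 * m * \<sigma>\<^sup>2 + (\<integral>u. u ^ 3 \<partial>innov) = 0"
    using i by (simp add: innov_mean innov_var)
  then show "m = - (\<integral>u. u ^ 3 \<partial>innov) / (2 * \<sigma>\<^sup>2)"
    using \<sigma> by (simp add: field_simps)
qed

text \<open>
  If \<open>(Y t)\<^sup>2 = k\<close> almost surely, the second and third moments of the innovations force
  \<open>\<mu> + \<phi> x + b x e\<close> to be the same constant for almost all states \<open>x\<close> and innovations \<open>e\<close>, so \<open>x = 0\<close>.
\<close>

lemma state_square_nondegenerate:
  assumes "AE x in distr M borel (Y (t - 2)). A + B * x\<^sup>2 = 0"
  shows "A = 0 \<and> B = 0"
proof (rule ccontr)
  assume AB: "\<not> (A = 0 \<and> B = 0)"
  let ?\<nu> = "distr M borel (Y (t - 2))"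
  interpret N: prob_space ?\<nu> by (rule prob_space_state)
  interpret R: prob_space innov by (rule prob_space_innov)
  interpret RR: pair_prob_space innov innov ..
  interpret P: pair_sigma_finite ?\<nu> "innov \<Otimes>\<^sub>M innov" ..
  have "B \<noteq> 0"
  proof
    assume "B = 0"
    with assms AB have "AE x in ?\<nu>. False" by simp
    then show False using N.AE_False by simp
  qed
  define k where "k = - A / B"
  have nu: "AE x in ?\<nu>. x\<^sup>2 = k"
    using assms by eventually_elim (use \<open>B \<noteq> 0\<close> in \<open>auto simp: k_def field_simps add_eq_0_iff\<close>)
  then have "AE x in distr M borel (Y t). x\<^sup>2 = k" unfolding Y_distr[of t "t - 2"] .
  then have "AE \<omega> in M. (Y t \<omega>)\<^sup>2 = k" by (subst (asm) AE_distr_iff) auto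
  then have "AE \<omega> in M. (\<lambda>(x, e, u). (\<mu> + \<phi> * x + b * x * e + u)\<^sup>2 = k) (Y (t - 2) \<omega>, \<epsilon> (t - 1) \<omega>, \<epsilon> t \<omega>)"
    using Y_rec[of t] by eventually_elim (simp add: mult_ac)
  then have "AE q in ?\<nu> \<Otimes>\<^sub>M (innov \<Otimes>\<^sub>M innov). (\<lambda>(x, e, u). (\<mu> + \<phi> * x + b * x * e + u)\<^sup>2 = k) q"
    unfolding state_innovations_distr[symmetric] by (subst AE_distr_iff) (auto simp: split_beta')
  from P.AE_pair[OF this]
  have "AE x in ?\<nu>. AE p in innov \<Otimes>\<^sub>M innov. (\<mu> + \<phi> * x + b * x * fst p + snd p)\<^sup>2 = k"
    by (simp add: split_beta')
  with nu have "AE x in ?\<nu>. False"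
  proof eventually_elim
    case (elim x)
    \<comment> \<open>The shift forced by \<open>innov_shifted_square_const\<close>, the same for
      all \<open>x\<close> and \<open>e\<close>.\<close>
    define c where "c = - (\<integral>u. u ^ 3 \<partial>innov) / (2 * \<sigma>\<^sup>2)"
    have "AE e in innov. AE u in innov. (\<mu> + \<phi> * x + b * x * e + u)\<^sup>2 = k"
      using RR.AE_pair[OF elim(2)] by simp
    then have e: "AE e in innov. \<mu> + \<phi> * x + b * x * e = c \<and> c\<^sup>2 + \<sigma>\<^sup>2 = k"
      by eventually_elim (use innov_shifted_square_const in \<open>auto simp: c_def\<close>)
    then have "AE e in innov. (\<mu> + \<phi> * x - c + b * x * e)\<^sup>2 = 0"
      by eventually_elim auto
    then have "(\<integral>e. (\<mu> + \<phi> * x - c + b * x * e)\<^sup>2 \<partial>innov) = (\<integral>e. 0 \<partial>innov)"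
      by (intro integral_cong_AE) auto
    then have "(\<mu> + \<phi> * x - c)\<^sup>2 + (b * x)\<^sup>2 * \<sigma>\<^sup>2 = 0" unfolding innov_quadratic by simp
    then have "(b * x)\<^sup>2 * \<sigma>\<^sup>2 = 0" by (metis add_nonneg_eq_0_iff mult_nonneg_nonneg zero_le_power2)
    then have "x = 0" using b \<sigma> by simp
    \<comment> \<open>A zero state makes \<open>k = 0\<close>, contrary to
      \<open>k = c\<^sup>2 + \<sigma>\<^sup>2\<close>.\<close>
    then have "k = 0" using elim(1) by simp
    have "AE e in innov. False"
      using e by eventually_elim (use \<sigma> \<open>k = 0\<close> in \<open>auto simp: add_nonneg_eq_0_iff\<close>)
    then show False using R.AE_False by simp
  qed
  then show False using N.AE_False by simp
qed

text \<open>The terms \<open>\<phi> x\<close> and \<open>b x e\<close> carry the factor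
  \<open>x\<close>, whose square is absorbed by \<open>1 + x\<^sup>2\<close>; what remains involves
  innovations alone.\<close>

lemma rel_square_bound:
  "AE \<omega> in M. rel_square (Y t \<omega>, Y (t - 2) \<omega>) \<le> 4 * (\<mu>\<^sup>2 + \<phi>\<^sup>2 + b\<^sup>2 * (\<epsilon> (t - 1) \<omega>)\<^sup>2 + (\<epsilon> t \<omega>)\<^sup>2)"
  using Y_rec[of t]
proof eventually_elim
  case (elim \<omega>)
  define x e u where "x = Y (t - 2) \<omega>" "e = \<epsilon> (t - 1) \<omega>" "u = \<epsilon> t \<omega>"
  note defs = this
  have four: "(p + q + r + s)\<^sup>2 \<le> 4 * (p\<^sup>2 + q\<^sup>2 + r\<^sup>2 + s\<^sup>2)" for p q r s :: real
    using zero_le_power2[of "p - q"] zero_le_power2[of "p - r"] zero_le_power2[of "p - s"]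
      zero_le_power2[of "q - r"] zero_le_power2[of "q - s"] zero_le_power2[of "r - s"]
    by (simp add: power2_eq_square algebra_simps)
  have "(\<mu> + \<phi> * x + b * x * e + u)\<^sup>2 \<le> 4 * (\<mu>\<^sup>2 + (\<phi> * x)\<^sup>2 + (b * x * e)\<^sup>2 + u\<^sup>2)" by (rule four)
  also have "\<dots> \<le> 4 * (\<mu>\<^sup>2 + \<phi>\<^sup>2 + b\<^sup>2 * e\<^sup>2 + u\<^sup>2) * (1 + x\<^sup>2)"
    by (simp add: power_mult_distrib algebra_simps)
  finally show ?case
    unfolding rel_square_def elim defs[symmetric] using one_plus_square_pos[of x]
    by (simp add: pos_divide_le_eq)
qed

text \<open>The fourth moment enters here, through the square of \<open>rel_square_bound\<close>.
  The lag is a premise so that the times \<open>t - 1\<close> and \<open>t - 3\<close> match without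
  rewriting.\<close>

lemma rel_square_sq_integrable: "integrable M (\<lambda>\<omega>. (rel_square (Y t \<omega>, Y s \<omega>))\<^sup>2)" if "s = t - 2"
proof -
  have three: "(p + q + r)\<^sup>2 \<le> 3 * (p\<^sup>2 + q\<^sup>2 + r\<^sup>2)" for p q r :: real
    using zero_le_power2[of "p - q"] zero_le_power2[of "p - r"] zero_le_power2[of "q - r"]
    by (simp add: power2_eq_square algebra_simps)
  \<comment> \<open>\<open>48 = 4\<^sup>2 * 3\<close>: the squared constant of
    \<open>rel_square_bound\<close> times the factor for squaring a sum of three terms.\<close>
  let ?B = "\<lambda>\<omega>. 48 * ((\<mu>\<^sup>2 + \<phi>\<^sup>2)\<^sup>2 + b ^ 4 * \<epsilon> (t - 1) \<omega> ^ 4 + \<epsilon> t \<omega> ^ 4)"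
  have "integrable M ?B" using eps_moments_integrable[of 4] by simp
  then show ?thesis unfolding that
  proof (rule Bochner_Integration.integrable_bound)
    show "AE \<omega> in M. norm ((rel_square (Y t \<omega>, Y (t - 2) \<omega>))\<^sup>2) \<le> norm (?B \<omega>)"
      using rel_square_bound[of t]
    proof eventually_elim
      case (elim \<omega>)
      let ?S = "(\<mu>\<^sup>2 + \<phi>\<^sup>2) + b\<^sup>2 * (\<epsilon> (t - 1) \<omega>)\<^sup>2 + (\<epsilon> t \<omega>)\<^sup>2"
      have "(rel_square (Y t \<omega>, Y (t - 2) \<omega>))\<^sup>2 \<le> (4 * ?S)\<^sup>2"
        using elim rel_square_nonneg by (intro power_mono) auto
      also have "(4 * ?S)\<^sup>2 = 16 * ?S\<^sup>2" by (simp only: power_mult_distrib) simp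
      also have "\<dots> \<le> 16 * (3 * ((\<mu>\<^sup>2 + \<phi>\<^sup>2)\<^sup>2 + (b\<^sup>2 * (\<epsilon> (t - 1) \<omega>)\<^sup>2)\<^sup>2 + ((\<epsilon> t \<omega>)\<^sup>2)\<^sup>2))"
        by (intro mult_left_mono three) simp
      also have "\<dots> = ?B \<omega>"
        by (simp add: power_mult_distrib flip: power_mult)
      finally show ?case by simp
    qed
  qed measurable
qed

text \<open>By \<open>one_step_law\<close> the mean criterion is an integral of \<open>J\<close>
  over the state. Twice the gap in \<open>J\<close> is \<open>\<rho> - 1 - ln \<rho>\<close>, with
  \<open>\<rho>\<close> the ratio of true to proposed variance, plus the squared difference of the
  conditional means over the proposed variance. Both are nonnegative and vanish only if variances
  and means agree at the state; nondegeneracy of the squared state then separates the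
  coefficients.\<close>

lemma identification:
  assumes \<theta>: "\<theta>$3 > 0" "\<theta>$4 > 0" and \<theta>0: "\<theta>0 = vector [\<mu>, \<phi>, \<sigma>\<^sup>2, b\<^sup>2]" and ne: "\<theta> \<noteq> \<theta>0"
    and int: "integrable M (\<lambda>\<omega>. criterion \<theta> (Y t \<omega>, Y (t - 2) \<omega>))"
    and int0: "integrable M (\<lambda>\<omega>. criterion \<theta>0 (Y t \<omega>, Y (t - 2) \<omega>))"
  shows "expectation (\<lambda>\<omega>. criterion \<theta> (Y t \<omega>, Y (t - 2) \<omega>)) <
    expectation (\<lambda>\<omega>. criterion \<theta>0 (Y t \<omega>, Y (t - 2) \<omega>))"
proof (rule ccontr)
  assume "\<not> ?thesis"
  then have le: "expectation (\<lambda>\<omega>. criterion \<theta>0 (Y t \<omega>, Y (t - 2) \<omega>)) \<le>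
    expectation (\<lambda>\<omega>. criterion \<theta> (Y t \<omega>, Y (t - 2) \<omega>))" by simp
  let ?\<nu> = "distr M borel (Y (t - 2))"
  interpret N: prob_space ?\<nu> by (rule prob_space_state)
  interpret R: prob_space innov by (rule prob_space_innov)
  interpret RR: pair_prob_space innov innov ..
  define h where "h \<eta> x = \<eta>$3 * (1 + \<eta>$4 * x\<^sup>2)" for \<eta> :: "real^4" and x
  define D where "D \<eta> x = (\<mu> - \<eta>$1) + (\<phi> - \<eta>$2) * x" for \<eta> :: "real^4" and x
  have inner: "(\<integral>p. criterion \<eta> (\<mu> + \<phi> * x + b * x * fst p + snd p, x) \<partial>(innov \<Otimes>\<^sub>M innov)) =
      - (1 / 2) * (ln (h \<eta> x / (1 + x\<^sup>2)) + ((D \<eta> x)\<^sup>2 + h \<theta>0 x) / h \<eta> x)" for \<eta> x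
  proof -
    have "criterion \<eta> (\<mu> + \<phi> * x + b * x * fst p + snd p, x) =
       - (1 / 2) * (ln (h \<eta> x / (1 + x\<^sup>2)) + (D \<eta> x + b * x * fst p + snd p)\<^sup>2 / h \<eta> x)" for p :: "real \<times> real"
      by (simp add: criterion_def Let_def h_def D_def algebra_simps)
    moreover have "(b * x)\<^sup>2 * \<sigma>\<^sup>2 + \<sigma>\<^sup>2 = h \<theta>0 x"
      by (simp add: h_def \<theta>0 vector4_nth algebra_simps power_mult_distrib)
    ultimately show ?thesis
      using innov_pair_quadratic[of "D \<eta> x" "b * x"] RR.prob_space by (simp add: add.assoc)
  qed
  define J where "J \<eta> x = - (1 / 2) * (ln (h \<eta> x / (1 + x\<^sup>2)) + ((D \<eta> x)\<^sup>2 + h \<theta>0 x) / h \<eta> x)" for \<eta> x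
  have law: "integrable ?\<nu> (J \<theta>)" "expectation (\<lambda>\<omega>. criterion \<theta> (Y t \<omega>, Y (t - 2) \<omega>)) = integral\<^sup>L ?\<nu> (J \<theta>)"
    "integrable ?\<nu> (J \<theta>0)" "expectation (\<lambda>\<omega>. criterion \<theta>0 (Y t \<omega>, Y (t - 2) \<omega>)) = integral\<^sup>L ?\<nu> (J \<theta>0)"
    using one_step_law[OF borel_measurable_criterion int] one_step_law[OF borel_measurable_criterion int0]
    unfolding inner J_def[symmetric] by simp_all
  have h: "h \<theta> x > 0" "h \<theta>0 x > 0" for x
    using \<theta> \<sigma> one_plus_pos[of "\<theta>$4" x] by (auto simp: h_def \<theta>0 vector4_nth intro!: mult_pos_pos add_pos_nonneg)
  have D0: "D \<theta>0 x = 0" for x by (simp add: D_def \<theta>0 vector4_nth)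
  have diff: "2 * (J \<theta>0 x - J \<theta> x) = (h \<theta>0 x / h \<theta> x - 1 - ln (h \<theta>0 x / h \<theta> x)) + (D \<theta> x)\<^sup>2 / h \<theta> x" for x
    using h[of x] one_plus_square_pos[of x]
    by (simp add: J_def D0 ln_divide_pos add_divide_distrib diff_divide_distrib)
  have gap: "h \<theta>0 x / h \<theta> x - 1 - ln (h \<theta>0 x / h \<theta> x) \<ge> 0" "(D \<theta> x)\<^sup>2 / h \<theta> x \<ge> 0" for x
    using h[of x] ln_le_minus_one[of "h \<theta>0 x / h \<theta> x"] by simp_all
  have nonneg: "J \<theta>0 x - J \<theta> x \<ge> 0" for x
  proof -
    have "2 * (J \<theta>0 x - J \<theta> x) \<ge> 0" unfolding diff by (intro add_nonneg_nonneg gap)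
    then show ?thesis by simp
  qed
  have intJ: "integrable ?\<nu> (\<lambda>x. J \<theta>0 x - J \<theta> x)" using law by auto
  have "(\<integral>x. J \<theta>0 x - J \<theta> x \<partial>?\<nu>) \<le> 0" using law le by simp
  moreover have "(\<integral>x. J \<theta>0 x - J \<theta> x \<partial>?\<nu>) \<ge> 0" using nonneg by (intro integral_nonneg_AE) auto
  ultimately have "AE x in ?\<nu>. J \<theta>0 x - J \<theta> x = 0"
    using integral_nonneg_eq_0_iff_AE[OF intJ] nonneg by auto
  then have "AE x in ?\<nu>. h \<theta>0 x = h \<theta> x \<and> D \<theta> x = 0"
  proof eventually_elim
    case (elim x)
    then have "h \<theta>0 x / h \<theta> x - 1 - ln (h \<theta>0 x / h \<theta> x) = 0" "(D \<theta> x)\<^sup>2 / h \<theta> x = 0"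
      using diff[of x] add_nonneg_eq_0_iff[OF gap(1) gap(2)] by auto
    then have "h \<theta>0 x / h \<theta> x = 1" "(D \<theta> x)\<^sup>2 = 0"
      using ln_eq_minus_one[of "h \<theta>0 x / h \<theta> x"] h[of x] by auto
    then show ?case using h[of x] by simp
  qed
  note AE = this
  \<comment> \<open>The constant coefficient gives \<open>\<theta>$3\<close>, after which the other
    gives \<open>\<theta>$4\<close>, as \<open>\<sigma>\<close> is positive.\<close>
  have "AE x in ?\<nu>. (\<sigma>\<^sup>2 - \<theta>$3) + (\<sigma>\<^sup>2 * b\<^sup>2 - \<theta>$3 * \<theta>$4) * x\<^sup>2 = 0"
    using AE by eventually_elim (simp add: h_def \<theta>0 vector4_nth algebra_simps)
  from state_square_nondegenerate[OF this] have 34: "\<theta>$3 = \<sigma>\<^sup>2" "\<theta>$4 = b\<^sup>2" using \<sigma> by auto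
  \<comment> \<open>Squaring turns the linear relation between the means into one in
    \<open>x\<^sup>2\<close>, so the same nondegeneracy applies.\<close>
  have "AE x in ?\<nu>. (\<mu> - \<theta>$1)\<^sup>2 + (- ((\<phi> - \<theta>$2)\<^sup>2)) * x\<^sup>2 = 0"
    using AE
  proof eventually_elim
    case (elim x)
    then have "\<mu> - \<theta>$1 = - ((\<phi> - \<theta>$2) * x)" by (simp add: D_def)
    then have "(\<mu> - \<theta>$1)\<^sup>2 = (\<phi> - \<theta>$2)\<^sup>2 * x\<^sup>2" by (simp only: power2_minus power_mult_distrib)
    then show ?case by simp
  qed
  from state_square_nondegenerate[OF this] have "\<theta>$1 = \<mu>" "\<theta>$2 = \<phi>" by auto
  with 34 ne show False by (simp add: \<theta>0 vec_eq_iff forall_4 vector4_nth)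
qed

end

section \<open>Consistency\<close>

context rca_model
begin

lemma envelope_integrable: "integrable M (\<lambda>\<omega>. envelope (window t \<omega>))"
proof (rule Bochner_Integration.integrable_bound)
  let ?a = "\<lambda>\<omega>. rel_square (Y t \<omega>, Y (t - 2) \<omega>)" and ?b = "\<lambda>\<omega>. rel_square (Y (t - 1) \<omega>, Y (t - 3) \<omega>)"
  show "integrable M (\<lambda>\<omega>. 3 * (1 + (?a \<omega>)\<^sup>2 + (?b \<omega>)\<^sup>2))"
    using rel_square_sq_integrable[of "t - 2" t] rel_square_sq_integrable[of "t - 3" "t - 1"] by simp
  have three: "(1 + q + r)\<^sup>2 \<le> 3 * (1 + q\<^sup>2 + r\<^sup>2)" for q r :: real
    using zero_le_power2[of "1 - q"] zero_le_power2[of "1 - r"] zero_le_power2[of "q - r"]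
    by (simp add: power2_eq_square algebra_simps)
  show "AE \<omega> in M. norm (envelope (window t \<omega>)) \<le> norm (3 * (1 + (?a \<omega>)\<^sup>2 + (?b \<omega>)\<^sup>2))"
    using three by (intro AE_I2) (simp add: envelope_def window_def)
  show "(\<lambda>\<omega>. envelope (window t \<omega>)) \<in> borel_measurable M"
    by (rule measurable_compose[OF window_measurable borel_measurable_continuous_onI[OF continuous_on_envelope]])
qed

sublocale W: approx_indep_process M window "\<lambda>m t \<omega>. truncated_window m t (\<lambda>s. \<epsilon> s \<omega>)"
  by (rule window_process)

text \<open>Continuity of \<open>G\<close> is available only over \<open>K\<close>, so measurability
  is drawn from the pair of \<open>h\<close> and the window staying in
  \<open>K \<times> UNIV\<close>.\<close>

lemma avg_window_measurable:
  fixes G :: "'k::{second_countable_topology, metric_space} \<Rightarrow> (real \<times> real) \<times> (real \<times> real) \<Rightarrow> 'v::euclidean_space"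
  assumes "continuous_on (K \<times> UNIV) (\<lambda>q. G (fst q) (snd q))"
    and [measurable]: "h \<in> borel_measurable M" and "\<And>\<omega>. \<omega> \<in> space M \<Longrightarrow> h \<omega> \<in> K"
  shows "(\<lambda>\<omega>. W.avg n (G (h \<omega>)) \<omega>) \<in> borel_measurable M"
proof -
  have "(\<lambda>\<omega>. G (h \<omega>) (window t \<omega>)) \<in> borel_measurable M" for t
  proof -
    have "(\<lambda>\<omega>. (h \<omega>, window t \<omega>)) \<in> borel_measurable M" by measurable
    from borel_measurable_continuous_comp[OF assms(1) this] assms(3) show ?thesis by auto
  qed
  then show ?thesis unfolding W.avg_def by measurable
qed

text \<open>Identification makes the maximizer consistent through \<open>argmax_consistent\<close>;
  each estimator is an average of a window function at \<open>\<theta>hat\<close>, to which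
  \<open>plug_in_lln\<close> applies.\<close>

lemma matrix_estimators_consistent:
  assumes \<theta>0: "\<theta>0 = vector [\<mu>, \<phi>, \<sigma>\<^sup>2, b\<^sup>2]" and "om_lo > 0" "al_lo > 0"
    and \<Theta>: "compact \<Theta>" "\<Theta> \<subseteq> param_box mu_max phi_max om_lo om_hi al_lo al_hi" "\<theta>0 \<in> \<Theta>"
    and hat: "\<And>n. n \<ge> 1 \<Longrightarrow> \<theta>hat n \<in> borel_measurable M"
    and argmax: "\<And>n \<omega>. n \<ge> 1 \<Longrightarrow> \<omega> \<in> space M \<Longrightarrow>
           is_arg_max (total_loglik (\<lambda>s. Y s \<omega>) n) (\<lambda>\<theta>. \<theta> \<in> \<Theta>) (\<theta>hat n \<omega>)"
  shows "converges_in_prob M (\<lambda>n \<omega>. Omega_hat (\<lambda>s. Y s \<omega>) n (\<theta>hat n \<omega>)) (Omega M Y \<theta>0 t)"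
    and "converges_in_prob M (\<lambda>n \<omega>. Sigma_hat (\<lambda>s. Y s \<omega>) n (\<theta>hat n \<omega>)) (Sigma_mat M Y \<theta>0 t)"
proof -
  have pos: "\<theta>$3 > 0 \<and> \<theta>$4 > 0" if "\<theta> \<in> \<Theta>" for \<theta>
    using that \<Theta>(2) assms(2,3) by (force simp: param_box_def)
  obtain c where c: "c > 0" "\<And>\<theta> p. \<theta> \<in> \<Theta> \<Longrightarrow> (\<Sum>i\<in>UNIV. \<bar>score_at \<theta> p $ i\<bar>) \<le> c * (1 + rel_square p)"
    "\<And>\<theta> p. \<theta> \<in> \<Theta> \<Longrightarrow> \<bar>criterion \<theta> p\<bar> \<le> c * (1 + rel_square p)"
    using score_and_criterion_bound[OF assms(2,3), of mu_max phi_max om_hi al_hi] \<Theta>(2) by blast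
  obtain c' where c': "c' > 0" "\<And>\<theta> x. \<theta> \<in> \<Theta> \<Longrightarrow> norm (Sigma1_term x \<theta>) \<le> c'"
    "\<And>\<theta> x. \<theta> \<in> \<Theta> \<Longrightarrow> norm (Sigma2_term x \<theta>) \<le> c'"
    using sigma_term_bound[OF assms(2,3), of mu_max phi_max om_hi al_hi] \<Theta>(2) by blast
  have hat_in: "\<theta>hat n \<omega> \<in> \<Theta>" if "n \<ge> 1" "\<omega> \<in> space M" for n \<omega>
    using argmax[OF that] by (simp add: is_arg_max_def)

  define m where "m \<theta> z = criterion \<theta> (fst z)" for \<theta> and z :: "(real \<times> real) \<times> (real \<times> real)"
  have m_cont: "continuous_on (\<Theta> \<times> UNIV) (\<lambda>q. m (fst q) (snd q))"
  proof -
    have "continuous_on (\<Theta> \<times> UNIV) (\<lambda>q :: (real^4) \<times> (real \<times> real) \<times> (real \<times> real). (fst q, fst (snd q)))"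
      by (intro continuous_intros)
    from continuous_on_compose2[OF continuous_on_criterion[OF pos] this] show ?thesis
      unfolding m_def by force
  qed
  have m_env: "\<bar>m \<theta> z\<bar> \<le> c * envelope z" if "\<theta> \<in> \<Theta>" for \<theta> z
  proof -
    have "\<bar>m \<theta> z\<bar> \<le> c * (1 + rel_square (fst z))" unfolding m_def by (rule c(3)[OF that])
    also have "\<dots> \<le> c * envelope z" using c(1) envelope_ge(1) by (intro mult_left_mono) auto
    finally show ?thesis .
  qed
  have env_cont: "continuous_on UNIV (\<lambda>z. a * envelope z)" for a
    by (intro continuous_intros continuous_on_envelope)
  have env_int: "integrable M (\<lambda>\<omega>. a * envelope (window s \<omega>))" for a s
    by (intro integrable_mult_right envelope_integrable)
  have crit_int: "integrable M (\<lambda>\<omega>. criterion \<theta> (Y 0 \<omega>, Y (0 - 2) \<omega>))" if "\<theta> \<in> \<Theta>" for \<theta>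
  proof (rule Bochner_Integration.integrable_bound[OF env_int[of c 0]])
    show "(\<lambda>\<omega>. criterion \<theta> (Y 0 \<omega>, Y (0 - 2) \<omega>)) \<in> borel_measurable M"
      by (rule measurable_compose[OF _ borel_measurable_criterion]) measurable
    show "AE \<omega> in M. norm (criterion \<theta> (Y 0 \<omega>, Y (0 - 2) \<omega>)) \<le> norm (c * envelope (window 0 \<omega>))"
      using m_env[OF that, of "window 0 _"] by (intro AE_I2) (simp add: m_def window_def order_trans[OF _ abs_ge_self])
  qed
  have cons: "whp M (\<lambda>n \<omega>. dist (\<theta>hat n \<omega>) \<theta>0 < d)" if "d > 0" for d
  proof (rule W.argmax_consistent[OF \<Theta>(1) m_cont m_env env_cont env_int \<Theta>(3) _ _ that])
    fix \<theta> assume "\<theta> \<in> \<Theta>" "\<theta> \<noteq> \<theta>0"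
    then show "expectation (\<lambda>\<omega>. m \<theta> (window 0 \<omega>)) < expectation (\<lambda>\<omega>. m \<theta>0 (window 0 \<omega>))"
      using identification[of \<theta> \<theta>0 0] pos[of \<theta>] \<theta>0 crit_int[of \<theta>] crit_int[OF \<Theta>(3)]
      by (simp add: m_def window_def)
  next
    fix n \<omega> assume n: "n \<ge> (1::nat)" "\<omega> \<in> space M"
    \<comment> \<open>The sum of logarithms free of \<theta> cancels when two parameters are
      compared, so a maximizer of the likelihood maximizes the average criterion.\<close>
    have tot: "total_loglik (\<lambda>s. Y s \<omega>) n \<theta> =
        real n * W.avg n (m \<theta>) \<omega> - (\<Sum>t\<in>{1..int n}. (1 / 2) * ln (1 + (Y (t - 2) \<omega>)\<^sup>2))" if "\<theta> \<in> \<Theta>" for \<theta>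
      using pos[OF that] n(1)
      by (simp add: total_loglik_def loglik_eq_criterion W.avg_def m_def window_def sum_subtractf)
    have "\<not> total_loglik (\<lambda>s. Y s \<omega>) n \<theta>0 > total_loglik (\<lambda>s. Y s \<omega>) n (\<theta>hat n \<omega>)"
      using argmax[OF n] \<Theta>(3) unfolding is_arg_max_def by blast
    then have "real n * W.avg n (m \<theta>0) \<omega> \<le> real n * W.avg n (m (\<theta>hat n \<omega>)) \<omega>"
      unfolding tot[OF \<Theta>(3)] tot[OF hat_in[OF n]] by simp
    then show "\<theta>hat n \<omega> \<in> \<Theta> \<and> W.avg n (m \<theta>0) \<omega> \<le> W.avg n (m (\<theta>hat n \<omega>)) \<omega>"
      using hat_in[OF n] n(1) by simp
  qed

  \<comment> \<open>Common to both estimators. At \<open>n = 0\<close> nothing is known of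
    \<open>\<theta>hat 0\<close>; there the estimators are \<open>0\<close> through the factor
    \<open>1 / 0 = 0\<close>, hence measurable.\<close>
  have conv: "converges_in_prob M X (expectation (\<lambda>\<omega>. G \<theta>0 (window 0 \<omega>)))"
    if X: "\<And>n \<omega>. n \<ge> 1 \<Longrightarrow> \<omega> \<in> space M \<Longrightarrow> X n \<omega> = W.avg n (G (\<theta>hat n \<omega>)) \<omega>"
      and X0: "\<And>\<omega>. X 0 \<omega> = 0"
      and G: "continuous_on (\<Theta> \<times> UNIV) (\<lambda>q. G (fst q) (snd q))"
      and env: "\<And>\<theta> z. \<theta> \<in> \<Theta> \<Longrightarrow> norm (G \<theta> z) \<le> a * envelope z"
    for X :: "nat \<Rightarrow> 'a \<Rightarrow> real^4^4" and G a
  proof (rule converges_in_probI)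
    show "X n \<in> borel_measurable M" for n
    proof (cases "n = 0")
      case True
      then have "X n = (\<lambda>_. 0)" using X0 by (simp add: fun_eq_iff)
      then show ?thesis by simp
    next
      case False
      then have n: "n \<ge> 1" by simp
      have "X n \<in> borel_measurable M \<longleftrightarrow> (\<lambda>\<omega>. W.avg n (G (\<theta>hat n \<omega>)) \<omega>) \<in> borel_measurable M"
        by (rule measurable_cong) (rule X[OF n])
      then show ?thesis using avg_window_measurable[OF G hat[OF n] hat_in[OF n]] by simp
    qed
    fix e :: real assume "e > 0"
    have "whp M (\<lambda>n \<omega>. dist (W.avg n (G (\<theta>hat n \<omega>)) \<omega>) (expectation (\<lambda>\<omega>. G \<theta>0 (window 0 \<omega>))) \<le> e)"
      by (rule W.plug_in_lln[OF \<Theta>(1) G env env_cont env_int \<Theta>(3) hat_in cons \<open>e > 0\<close>])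
    then show "whp M (\<lambda>n \<omega>. dist (X n \<omega>) (expectation (\<lambda>\<omega>. G \<theta>0 (window 0 \<omega>))) \<le> e)"
      by (rule whp_mono) (simp add: X)
  qed
  have stationary: "expectation (\<lambda>\<omega>. G \<theta>0 (window t \<omega>)) = expectation (\<lambda>\<omega>. G \<theta>0 (window 0 \<omega>))"
    if G: "continuous_on (\<Theta> \<times> UNIV) (\<lambda>q. G (fst q) (snd q))" for G :: "real^4 \<Rightarrow> _ \<Rightarrow> real^4^4"
    by (rule W.expectation_Z, rule borel_measurable_continuous_onI, rule continuous_on_section[OF G \<Theta>(3)])

  note omega_cont = continuous_on_omega_term[OF pos]
  note sigma_cont = continuous_on_sigma_term[OF pos]
  note outer = omega_term_bound[OF c(2) c(2) c(1)]
  have window_comp: "(\<lambda>\<omega>. f (window s \<omega>)) \<in> borel_measurable M" if "continuous_on UNIV f" for s and f :: "_ \<Rightarrow> 'v::topological_space"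
    by (rule measurable_compose[OF window_measurable borel_measurable_continuous_onI[OF that]])

  show "converges_in_prob M (\<lambda>n \<omega>. Omega_hat (\<lambda>s. Y s \<omega>) n (\<theta>hat n \<omega>)) (Omega M Y \<theta>0 t)"
  proof -
    have "Omega M Y \<theta>0 t = expectation (\<lambda>\<omega>. omega_term \<theta>0 (window t \<omega>))"
    proof -
      have sc: "continuous_on UNIV (\<lambda>z. score_at \<theta>0 (h z))" if "continuous_on UNIV h"
        for h :: "(real \<times> real) \<times> (real \<times> real) \<Rightarrow> real \<times> real"
        by (rule continuous_on_compose2[OF continuous_on_section[OF continuous_on_score_at[OF pos] \<Theta>(3)] that]) auto
      have i1: "integrable M (\<lambda>\<omega>. outer_product (score_at \<theta>0 (fst (window t \<omega>)) + score_at \<theta>0 (snd (window t \<omega>)))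
          (score_at \<theta>0 (fst (window t \<omega>)) + score_at \<theta>0 (snd (window t \<omega>))))"
        by (rule Bochner_Integration.integrable_bound[OF env_int[of "4 * c\<^sup>2" t] window_comp])
          (auto intro!: continuous_on_outer_product continuous_on_add sc continuous_intros AE_I2
            intro: order_trans[OF outer(1)[OF \<Theta>(3) \<Theta>(3)] abs_ge_self])
      have i2: "integrable M (\<lambda>\<omega>. outer_product (score_at \<theta>0 (fst (window t \<omega>))) (score_at \<theta>0 (fst (window t \<omega>))))"
        by (rule Bochner_Integration.integrable_bound[OF env_int[of "4 * c\<^sup>2" t] window_comp])
          (auto intro!: continuous_on_outer_product continuous_on_add sc continuous_intros AE_I2
            intro: order_trans[OF outer(2)[OF \<Theta>(3) \<Theta>(3)] abs_ge_self])
      have "score (\<lambda>s. Y s \<omega>) t \<theta>0 = score_at \<theta>0 (fst (window t \<omega>))"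
        "score (\<lambda>s. Y s \<omega>) (t - 1) \<theta>0 = score_at \<theta>0 (snd (window t \<omega>))" for \<omega>
        using pos[OF \<Theta>(3)] by (simp_all add: score_eq_score_at window_def)
      then show ?thesis
        unfolding Omega_def omega_term_def using Bochner_Integration.integral_diff[OF i1 i2] by simp
    qed
    also have "\<dots> = expectation (\<lambda>\<omega>. omega_term \<theta>0 (window 0 \<omega>))" by (rule stationary[OF omega_cont])
    finally have L: "Omega M Y \<theta>0 t = expectation (\<lambda>\<omega>. omega_term \<theta>0 (window 0 \<omega>))" .
    show ?thesis unfolding L
    proof (rule conv[OF _ _ omega_cont])
      fix n \<omega> assume n: "n \<ge> (1::nat)" "\<omega> \<in> space M"
      have "score (\<lambda>s. Y s \<omega>) s (\<theta>hat n \<omega>) = score_at (\<theta>hat n \<omega>) (fst (window s \<omega>))"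
        "score (\<lambda>s. Y s \<omega>) (s - 1) (\<theta>hat n \<omega>) = score_at (\<theta>hat n \<omega>) (snd (window s \<omega>))" for s
        using pos[OF hat_in[OF n]] by (simp_all add: score_eq_score_at window_def)
      then show "Omega_hat (\<lambda>s. Y s \<omega>) n (\<theta>hat n \<omega>) = W.avg n (omega_term (\<theta>hat n \<omega>)) \<omega>"
        by (simp add: Omega_hat_def W.avg_def omega_term_def sum_subtractf scaleR_diff_right)
    next
      show "Omega_hat (\<lambda>s. Y s \<omega>) 0 (\<theta>hat 0 \<omega>) = 0" for \<omega> by (simp add: Omega_hat_def)
      fix \<theta> z assume \<theta>: "\<theta> \<in> \<Theta>"
      show "norm (omega_term \<theta> z) \<le> (8 * c\<^sup>2) * envelope z"
        unfolding omega_term_def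
        by (rule order_trans[OF norm_triangle_ineq4])
          (use outer[OF \<theta> \<theta>, of z] in linarith)
    qed
  qed
  show "converges_in_prob M (\<lambda>n \<omega>. Sigma_hat (\<lambda>s. Y s \<omega>) n (\<theta>hat n \<omega>)) (Sigma_mat M Y \<theta>0 t)"
  proof -
    \<comment> \<open>\<open>block_diag\<close> is a bounded linear map of the pair of blocks, so it
      commutes with expectations and with sums.\<close>
    obtain k where k: "\<And>p. norm (block_diag (fst p) (snd p)) \<le> norm p * k" "k \<ge> 0"
      using bounded_linear.nonneg_bounded[OF bounded_linear_block_diag] by blast
    define S where "S z = (Sigma1_term (snd (fst z)) \<theta>0, Sigma2_term (snd (fst z)) \<theta>0)"
      for z :: "(real \<times> real) \<times> (real \<times> real)"
    have S_cont: "continuous_on UNIV S"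
    proof -
      have nz: "\<theta>0 $ 3 \<noteq> 0" "1 + \<theta>0 $ 4 * x\<^sup>2 \<noteq> 0" for x
        using pos[OF \<Theta>(3)] one_plus_pos[of "\<theta>0 $ 4" x] by auto
      show ?thesis unfolding S_def[abs_def] Sigma1_term_def Sigma2_term_def
        by (intro continuous_on_Pair continuous_on_vector2 continuous_intros ballI) (use nz in auto)
    qed
    have S_norm: "norm (Sigma1_term x \<theta>, Sigma2_term x \<theta>) \<le> 2 * c'" if "\<theta> \<in> \<Theta>" for \<theta> x
      using norm_Pair_le[of "Sigma1_term x \<theta>" "Sigma2_term x \<theta>"] c'(2)[OF that, of x] c'(3)[OF that, of x] by linarith
    have S_int: "integrable M (\<lambda>\<omega>. S (window t \<omega>))"
      by (rule integrable_const_bound[of _ "2 * c'", OF _ window_comp[OF S_cont]])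
        (use S_norm[OF \<Theta>(3)] in \<open>auto simp: S_def\<close>)
    have "Sigma_mat M Y \<theta>0 t = block_diag (fst (expectation (\<lambda>\<omega>. S (window t \<omega>)))) (snd (expectation (\<lambda>\<omega>. S (window t \<omega>))))"
      using integral_fst[OF S_int] integral_snd[OF S_int]
      by (simp add: Sigma_mat_def S_def window_def)
    also have "\<dots> = expectation (\<lambda>\<omega>. sigma_term \<theta>0 (window t \<omega>))"
      using integral_bounded_linear[OF bounded_linear_block_diag S_int]
      by (simp add: S_def sigma_term_def)
    also have "\<dots> = expectation (\<lambda>\<omega>. sigma_term \<theta>0 (window 0 \<omega>))" by (rule stationary[OF sigma_cont])
    finally have L: "Sigma_mat M Y \<theta>0 t = expectation (\<lambda>\<omega>. sigma_term \<theta>0 (window 0 \<omega>))" .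
    interpret B: bounded_linear "\<lambda>p :: (real^2^2) \<times> (real^2^2). block_diag (fst p) (snd p)"
      by (rule bounded_linear_block_diag)
    have hat_eq: "Sigma_hat (\<lambda>s. Y s \<omega>) n \<theta> = W.avg n (sigma_term \<theta>) \<omega>" for n \<omega> \<theta>
    proof -
      let ?T = "\<lambda>t. (Sigma1_term (Y (t - 2) \<omega>) \<theta>, Sigma2_term (Y (t - 2) \<omega>) \<theta>)"
      have "Sigma_hat (\<lambda>s. Y s \<omega>) n \<theta> = block_diag (fst ((1 / real n) *\<^sub>R (\<Sum>t\<in>{1..int n}. ?T t))) (snd ((1 / real n) *\<^sub>R (\<Sum>t\<in>{1..int n}. ?T t)))"
        by (simp add: Sigma_hat_def fst_sum snd_sum)
      also have "\<dots> = (1 / real n) *\<^sub>R (\<Sum>t\<in>{1..int n}. block_diag (fst (?T t)) (snd (?T t)))"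
        unfolding B.scaleR B.sum ..
      finally show ?thesis by (simp add: W.avg_def sigma_term_def window_def)
    qed
    show ?thesis unfolding L
    proof (rule conv[OF _ _ sigma_cont])
      show "Sigma_hat (\<lambda>s. Y s \<omega>) n (\<theta>hat n \<omega>) = W.avg n (sigma_term (\<theta>hat n \<omega>)) \<omega>" for n \<omega> by (rule hat_eq)
      show "Sigma_hat (\<lambda>s. Y s \<omega>) 0 (\<theta>hat 0 \<omega>) = 0" for \<omega> unfolding hat_eq by (simp add: W.avg_def)
      fix \<theta> z assume \<theta>: "\<theta> \<in> \<Theta>"
      have "norm (sigma_term \<theta> z) \<le> 2 * c' * k"
        unfolding sigma_term_def using k(1)[of "(Sigma1_term (snd (fst z)) \<theta>, Sigma2_term (snd (fst z)) \<theta>)"]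
          mult_right_mono[OF S_norm[OF \<theta>, of "snd (fst z)"] k(2)] by simp
      also have "\<dots> \<le> (2 * c' * k) * envelope z"
        using mult_left_mono[OF envelope_ge(2)[of z], of "2 * c' * k"] c'(1) k(2) by simp
      finally show "norm (sigma_term \<theta> z) \<le> (2 * c' * k) * envelope z" .
    qed
  qed
qed

end

theorem mainTheorem3:
  fixes M :: "'a measure"
    and \<epsilon> Y :: "int \<Rightarrow> 'a \<Rightarrow> real"
    and \<mu>0 \<phi>0 \<sigma>0 b0 :: real
    and mu_max phi_max om_lo om_hi al_lo al_hi :: real
    and \<Theta> :: "(real^4) set"
    and \<theta>0 :: "real^4"
    and \<theta>hat :: "nat \<Rightarrow> 'a \<Rightarrow> real^4"
    and t :: int
  assumes "prob_space M"
    and indep: "prob_space.indep_vars M (\<lambda>_. borel) \<epsilon> UNIV"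
    and ident: "\<And>s r. distr M borel (\<epsilon> s) = distr M borel (\<epsilon> r)"
    and mean: "prob_space.expectation M (\<epsilon> 1) = 0"
    and variance: "prob_space.variance M (\<epsilon> 1) = \<sigma>0\<^sup>2" and "\<sigma>0 > 0"
    and fourth_moment: "integrable M (\<lambda>\<omega>. \<epsilon> 1 \<omega> ^ 4)"
    and solution: "stationary_solution M \<epsilon> \<mu>0 \<phi>0 b0 Y"
    and \<theta>0: "\<theta>0 = vector [\<mu>0, \<phi>0, \<sigma>0\<^sup>2, b0\<^sup>2]"
    and "mu_max > 0" "phi_max > 0" "om_lo > 0" "om_hi > 0" "al_lo > 0" "al_hi > 0"
    and "compact \<Theta>"
    and "\<Theta> \<subseteq> param_region M (\<epsilon> 1) b0 mu_max phi_max om_lo om_hi al_lo al_hi"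
    and "\<theta>0 \<in> interior \<Theta>"
    and "\<And>n. n \<ge> 1 \<Longrightarrow> \<theta>hat n \<in> borel_measurable M"
    and "\<And>n \<omega>. n \<ge> 1 \<Longrightarrow> \<omega> \<in> space M \<Longrightarrow>
           is_arg_max (total_loglik (\<lambda>s. Y s \<omega>) n) (\<lambda>\<theta>. \<theta> \<in> \<Theta>) (\<theta>hat n \<omega>)"
  shows "converges_in_prob M (\<lambda>n \<omega>. Omega_hat (\<lambda>s. Y s \<omega>) n (\<theta>hat n \<omega>)) (Omega M Y \<theta>0 t) \<and>
         converges_in_prob M (\<lambda>n \<omega>. Sigma_hat (\<lambda>s. Y s \<omega>) n (\<theta>hat n \<omega>)) (Sigma_mat M Y \<theta>0 t)"
proof -
  interpret prob_space M by fact
  have "\<theta>0 \<in> \<Theta>" using \<open>\<theta>0 \<in> interior \<Theta>\<close> interior_subset by auto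
  then have region: "\<theta>0 \<in> param_region M (\<epsilon> 1) b0 mu_max phi_max om_lo om_hi al_lo al_hi"
    using \<open>\<Theta> \<subseteq> _\<close> by blast
  have b0: "b0 \<noteq> 0"
    using region \<open>al_lo > 0\<close> by (auto simp: param_region_def \<theta>0 vector4_nth)
  \<comment> \<open>The sign convention of the region returns the true \<open>b0\<close>, so
    membership of \<open>\<theta>0\<close> contains the contraction condition of the actual
    recursion.\<close>
  have "sgn b0 * sqrt (b0\<^sup>2) = b0" by (simp add: sgn_mult_abs)
  then have contraction: "ereal_expectation M (\<lambda>\<omega>. ln_abs (\<phi>0 + b0 * \<epsilon> 1 \<omega>)) < 0"
    using region by (simp add: param_region_def \<theta>0 vector4_nth)
  interpret rca_model M \<epsilon> Y \<mu>0 \<phi>0 \<sigma>0 b0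
    by unfold_locales
      (fact indep ident mean variance fourth_moment solution contraction b0 \<open>\<sigma>0 > 0\<close>)+
  have box: "\<Theta> \<subseteq> param_box mu_max phi_max om_lo om_hi al_lo al_hi"
    using \<open>\<Theta> \<subseteq> _\<close> by (auto simp: param_region_def param_box_def)
  show ?thesis
    using matrix_estimators_consistent[OF \<theta>0 \<open>om_lo > 0\<close> \<open>al_lo > 0\<close> \<open>compact \<Theta>\<close> box \<open>\<theta>0 \<in> \<Theta>\<close>] assms by blast
qed

end
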